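(* Let $R$ be a ring essentially of finite type over an $F$-finite field of characteristic $p>0$, let $f\in R$ and $t\in\mathbb{Q}_{\ge 0}$. Let $\varphi:(M,\kappa_M)\to (N,\kappa_N)$ be a nil-isomorphism of coherent Cartier modules over $R$. Then $\varphi(\tau(M,f^t))=\tau(N,f^t)$. Moreover, let $\mathcal{M}=\operatorname{colim}_e {F^e}^!M$ and $\mathcal{N}=\operatorname{colim}_e {F^e}^!N$, and let $\tau(\mathcal{M},f^t)$ (resp. $\tau(\mathcal{N},f^t)$) denote the image of $\tau(M,f^t)$ (resp. $\tau(N,f^t)$) under the natural map $M\to\mathcal{M}$ (resp. $N\to\mathcal{N}$). Then the test module filtration $\tau(M,f^t)$, $t\in\mathbb{Q}_{\geq 0}$, induces in this way a decreasing filtration $\tau(\mathcal{M},f^t)$ of $\mathcal{M}$, and $\Phi(\tau(\mathcal{M},f^t))=\tau(\mathcal{N},f^t)$, where $\Phi:\mathcal{M}\to\mathcal{N}$ is the isomorphism induced by $\varphi$.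
   Context: $F$ denotes the absolute Frobenius; a noetherian ring $R$ of characteristic $p$ is $F$-finite if $F:R\to F_*R$ is finite. A Cartier module $(M,\kappa)$ over $R$ is an $R$-module $M$ with an $R$-linear map $\kappa:F_*M\to M$ (i.e. $r\kappa(m)=\kappa(r^pm)$, $\kappa$ additive); it is coherent if $M$ is finitely generated. A morphism of Cartier modules is an $R$-linear map commuting with the structural maps $\kappa$. A coherent Cartier module is nilpotent if $\kappa^e M=0$ for some $e$; a morphism is a nil-isomorphism if its kernel and cokernel are nilpotent. For $f\in R$, $t\in\mathbb{Q}_{\ge 0}$ let $\mathcal{C}$ be the graded algebra acting on $M$ with $\mathcal{C}_0=R$ and $\mathcal{C}_e=\kappa^e f^{\lceil tp^e\rceil}R$ for $e\ge1$, and $\mathcal{C}_+=\bigoplus_{e\ge1}\mathcal{C}_e$. Put $\underline{M}_{\mathcal{C}}=(\mathcal{C}_+)^hM$ for $h\gg0$ (this stabilizes for coherent $M$). The test module $\tau(M,f^t)$ is the smallest $\mathcal{C}$-submodule $N'\subseteq M$ with $N'_\eta=(\underline{M}_{\mathcal{C}})_\eta$ for every generic point $\eta$ of $\operatorname{Supp}\underline{M}_{\mathcal{C}}$; it exists when $R$ is essentially of finite type over an $F$-finite field. ${F^e}^!M=\operatorname{Hom}_R(F^e_*R,M)$, viewed as an $R$-module via the first argument. The adjoint structural map is $C:M\to F^!M$, $m\mapsto[r\mapsto\kappa(rm)]$; the colimit is taken along the maps ${F^e}^!C:{F^e}^!M\to{F^{e+1}}^!M$. A nil-isomorphism $\varphi$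 induces an isomorphism on these colimits. *)

theory Defs
  imports "HOL-Algebra.Algebra"
begin

section \<open>Modules and linear maps\<close>

text \<open>The multiplicative part of a module record is never used.\<close>

definition reg_mod :: "('a, 'x) ring_scheme \<Rightarrow> ('a, 'a) module" where
  "reg_mod R = \<lparr>carrier = carrier R, monoid.mult = (\<otimes>\<^bsub>R\<^esub>), monoid.one = \<one>\<^bsub>R\<^esub>,
     ring.zero = \<zero>\<^bsub>R\<^esub>, ring.add = (\<oplus>\<^bsub>R\<^esub>), smult = (\<otimes>\<^bsub>R\<^esub>)\<rparr>"

definition mod_hom ::
  "('a, 'x) ring_scheme \<Rightarrow> ('a, 'b, 'y) module_scheme \<Rightarrow> ('a, 'c, 'z) module_scheme \<Rightarrow> ('b \<Rightarrow> 'c) set" where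
  "mod_hom R M N = {h \<in> carrier M \<rightarrow> carrier N.
     (\<forall>x\<in>carrier M. \<forall>y\<in>carrier M. h (x \<oplus>\<^bsub>M\<^esub> y) = h x \<oplus>\<^bsub>N\<^esub> h y) \<and>
     (\<forall>r\<in>carrier R. \<forall>x\<in>carrier M. h (r \<odot>\<^bsub>M\<^esub> x) = r \<odot>\<^bsub>N\<^esub> h x)}"

definition mod_iso ::
  "('a, 'x) ring_scheme \<Rightarrow> ('a, 'b, 'y) module_scheme \<Rightarrow> ('a, 'c, 'z) module_scheme \<Rightarrow> ('b \<Rightarrow> 'c) set" where
  "mod_iso R M N = {h \<in> mod_hom R M N. bij_betw h (carrier M) (carrier N)}"

definition fin_gen :: "('a, 'x) ring_scheme \<Rightarrow> ('a, 'b, 'y) module_scheme \<Rightarrow> bool" where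
  "fin_gen R M \<longleftrightarrow> (\<exists>B. finite B \<and> B \<subseteq> carrier M \<and>
     (\<forall>N. submodule N R M \<longrightarrow> B \<subseteq> N \<longrightarrow> N = carrier M))"

definition sub_mod :: "('a, 'b, 'y) module_scheme \<Rightarrow> 'b set \<Rightarrow> ('a, 'b, 'y) module_scheme" where
  "sub_mod M I = M\<lparr>carrier := I\<rparr>"

definition quot_mod :: "('a, 'b, 'y) module_scheme \<Rightarrow> 'b set \<Rightarrow> ('a, 'b set) module" where
  "quot_mod M I = \<lparr>carrier = a_rcosets\<^bsub>M\<^esub> I, monoid.mult = undefined, monoid.one = undefined,
     ring.zero = I, ring.add = set_add M, smult = (\<lambda>r U. \<Union>x\<in>U. I +>\<^bsub>M\<^esub> (r \<odot>\<^bsub>M\<^esub> x))\<rparr>"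

definition quot_map :: "('a, 'b, 'y) module_scheme \<Rightarrow> 'b set \<Rightarrow> ('b \<Rightarrow> 'b) \<Rightarrow> 'b set \<Rightarrow> 'b set" where
  "quot_map M I h U = (\<Union>x\<in>U. I +>\<^bsub>M\<^esub> h x)"


section \<open>Base rings\<close>

text \<open>\<open>frob_push R p e M\<close> is the module \<open>F\<^sup>e\<^sub>* M\<close>.\<close>

definition frob_push ::
  "('a, 'x) ring_scheme \<Rightarrow> nat \<Rightarrow> nat \<Rightarrow> ('a, 'b, 'y) module_scheme \<Rightarrow> ('a, 'b, 'y) module_scheme" where
  "frob_push R p e M = M\<lparr>smult := (\<lambda>r m. (r [^]\<^bsub>R\<^esub> (p ^ e)) \<odot>\<^bsub>M\<^esub> m)\<rparr>"

definition F_finite :: "nat \<Rightarrow> ('a, 'x) ring_scheme \<Rightarrow> bool" where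
  "F_finite p R \<longleftrightarrow> cring R \<and> noetherian_ring R \<and> [p] \<cdot>\<^bsub>R\<^esub> \<one>\<^bsub>R\<^esub> = \<zero>\<^bsub>R\<^esub> \<and>
     fin_gen R (frob_push R p 1 (reg_mod R))"

definition finite_type_algebra ::
  "('k, 'x) ring_scheme \<Rightarrow> ('a, 'y) ring_scheme \<Rightarrow> ('k \<Rightarrow> 'a) \<Rightarrow> bool" where
  "finite_type_algebra k A \<alpha> \<longleftrightarrow> \<alpha> \<in> ring_hom k A \<and>
     (\<exists>S. finite S \<and> S \<subseteq> carrier A \<and> generate_ring A (\<alpha> ` carrier k \<union> S) = carrier A)"

definition is_localization ::
  "('a, 'x) ring_scheme \<Rightarrow> 'a set \<Rightarrow> ('b, 'y) ring_scheme \<Rightarrow> ('a \<Rightarrow> 'b) \<Rightarrow> bool" where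
  "is_localization A W R \<iota> \<longleftrightarrow> \<iota> \<in> ring_hom A R \<and> \<iota> ` W \<subseteq> Units R \<and>
     (\<forall>r\<in>carrier R. \<exists>a\<in>carrier A. \<exists>w\<in>W. r \<otimes>\<^bsub>R\<^esub> \<iota> w = \<iota> a) \<and>
     (\<forall>a\<in>carrier A. \<forall>b\<in>carrier A. \<iota> a = \<iota> b \<longrightarrow> (\<exists>w\<in>W. w \<otimes>\<^bsub>A\<^esub> a = w \<otimes>\<^bsub>A\<^esub> b))"

text \<open>\<open>R\<close> is the localization, via \<open>\<iota>\<close>, of the finitely generated \<open>k\<close>-algebra \<open>A\<close> (with structure
  map \<open>\<alpha>\<close>) at the multiplicative set \<open>W\<close>.  The presentation \<open>(A, \<alpha>, W, \<iota>)\<close> is kept as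
  arguments because the type of \<open>A\<close> cannot be quantified existentially.\<close>

definition ess_finite_type ::
  "('k, 'x) ring_scheme \<Rightarrow> ('a, 'y) ring_scheme \<Rightarrow> ('k \<Rightarrow> 'a) \<Rightarrow> 'a set \<Rightarrow> ('a \<Rightarrow> 'r) \<Rightarrow> ('r, 'z) ring_scheme \<Rightarrow> bool" where
  "ess_finite_type k A \<alpha> W \<iota> R \<longleftrightarrow> cring k \<and> cring A \<and> cring R \<and>
     finite_type_algebra k A \<alpha> \<and> submonoid W A \<and> is_localization A W R \<iota>"


section \<open>Cartier modules\<close>

definition cartier_module ::
  "('a, 'x) ring_scheme \<Rightarrow> nat \<Rightarrow> ('a, 'b, 'y) module_scheme \<Rightarrow> ('b \<Rightarrow> 'b) \<Rightarrow> bool" where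
  "cartier_module R p M \<kappa> \<longleftrightarrow> module R M \<and> \<kappa> \<in> mod_hom R (frob_push R p 1 M) M"

definition coherent_cartier ::
  "('a, 'x) ring_scheme \<Rightarrow> nat \<Rightarrow> ('a, 'b, 'y) module_scheme \<Rightarrow> ('b \<Rightarrow> 'b) \<Rightarrow> bool" where
  "coherent_cartier R p M \<kappa> \<longleftrightarrow> cartier_module R p M \<kappa> \<and> fin_gen R M"

definition cartier_hom ::
  "('a, 'x) ring_scheme \<Rightarrow> ('a, 'b, 'y) module_scheme \<Rightarrow> ('b \<Rightarrow> 'b) \<Rightarrow>
   ('a, 'c, 'z) module_scheme \<Rightarrow> ('c \<Rightarrow> 'c) \<Rightarrow> ('b \<Rightarrow> 'c) \<Rightarrow> bool" where
  "cartier_hom R M \<kappa>\<^sub>M N \<kappa>\<^sub>N \<phi> \<longleftrightarrow> \<phi> \<in> mod_hom R M N \<and> (\<forall>m\<in>carrier M. \<phi> (\<kappa>\<^sub>M m) = \<kappa>\<^sub>N (\<phi> m))"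

definition nilpotent_cartier :: "('a, 'b, 'y) module_scheme \<Rightarrow> ('b \<Rightarrow> 'b) \<Rightarrow> bool" where
  "nilpotent_cartier M \<kappa> \<longleftrightarrow> (\<exists>e. \<forall>m\<in>carrier M. (\<kappa> ^^ e) m = \<zero>\<^bsub>M\<^esub>)"

definition nil_isomorphism ::
  "('a, 'x) ring_scheme \<Rightarrow> ('a, 'b, 'y) module_scheme \<Rightarrow> ('b \<Rightarrow> 'b) \<Rightarrow>
   ('a, 'c, 'z) module_scheme \<Rightarrow> ('c \<Rightarrow> 'c) \<Rightarrow> ('b \<Rightarrow> 'c) \<Rightarrow> bool" where
  "nil_isomorphism R M \<kappa>\<^sub>M N \<kappa>\<^sub>N \<phi> \<longleftrightarrow> cartier_hom R M \<kappa>\<^sub>M N \<kappa>\<^sub>N \<phi> \<and>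
     nilpotent_cartier (sub_mod M (a_kernel M N \<phi>)) \<kappa>\<^sub>M \<and>
     nilpotent_cartier (quot_mod N (\<phi> ` carrier M)) (quot_map N (\<phi> ` carrier M) \<kappa>\<^sub>N)"


section \<open>Localization of submodules and generic points of the support\<close>

text \<open>The fraction \<open>m / s\<close> in \<open>M\<^sub>P\<close>, as an equivalence class of pairs.\<close>

definition loc_frac ::
  "('a, 'x) ring_scheme \<Rightarrow> ('a, 'b, 'y) module_scheme \<Rightarrow> 'a set \<Rightarrow> 'b \<Rightarrow> 'a \<Rightarrow> ('b \<times> 'a) set" where
  "loc_frac R M P m s = {(m', s'). m' \<in> carrier M \<and> s' \<in> carrier R - P \<and>
     (\<exists>u\<in>carrier R - P. u \<odot>\<^bsub>M\<^esub> (s' \<odot>\<^bsub>M\<^esub> m) = u \<odot>\<^bsub>M\<^esub> (s \<odot>\<^bsub>M\<^esub> m'))}"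

text \<open>For a submodule \<open>N\<close> of \<open>M\<close>, the localization \<open>N\<^sub>P\<close> as a submodule of \<open>M\<^sub>P\<close>.\<close>

definition loc_sub ::
  "('a, 'x) ring_scheme \<Rightarrow> ('a, 'b, 'y) module_scheme \<Rightarrow> 'a set \<Rightarrow> 'b set \<Rightarrow> ('b \<times> 'a) set set" where
  "loc_sub R M P N = {loc_frac R M P m s | m s. m \<in> N \<and> s \<in> carrier R - P}"

definition supp :: "('a, 'x) ring_scheme \<Rightarrow> ('a, 'b, 'y) module_scheme \<Rightarrow> 'b set \<Rightarrow> 'a set set" where
  "supp R M N = {P. primeideal P R \<and> loc_sub R M P N \<noteq> loc_sub R M P {\<zero>\<^bsub>M\<^esub>}}"

definition generic_points :: "('a, 'x) ring_scheme \<Rightarrow> ('a, 'b, 'y) module_scheme \<Rightarrow> 'b set \<Rightarrow> 'a set set" where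
  "generic_points R M N = {P \<in> supp R M N. \<forall>Q\<in>supp R M N. Q \<subseteq> P \<longrightarrow> Q = P}"


section \<open>The Cartier algebra of \<open>f\<^sup>t\<close> and test modules\<close>

text \<open>The operators on \<open>M\<close> given by the elements of \<open>\<C>\<^sub>e\<close>.\<close>

definition cartier_ops ::
  "('a, 'x) ring_scheme \<Rightarrow> nat \<Rightarrow> ('a, 'b, 'y) module_scheme \<Rightarrow> ('b \<Rightarrow> 'b) \<Rightarrow> 'a \<Rightarrow> rat \<Rightarrow> nat \<Rightarrow> ('b \<Rightarrow> 'b) set" where
  "cartier_ops R p M \<kappa> f t e =
     (if e = 0 then {\<lambda>m. r \<odot>\<^bsub>M\<^esub> m | r. r \<in> carrier R}
      else {\<lambda>m. (\<kappa> ^^ e) ((f [^]\<^bsub>R\<^esub> nat \<lceil>t * of_nat (p ^ e)\<rceil> \<otimes>\<^bsub>R\<^esub> r) \<odot>\<^bsub>M\<^esub> m) | r. r \<in> carrier R})"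

definition c_submodule ::
  "('a, 'x) ring_scheme \<Rightarrow> nat \<Rightarrow> ('a, 'b, 'y) module_scheme \<Rightarrow> ('b \<Rightarrow> 'b) \<Rightarrow> 'a \<Rightarrow> rat \<Rightarrow> 'b set \<Rightarrow> bool" where
  "c_submodule R p M \<kappa> f t N \<longleftrightarrow> submodule N R M \<and>
     (\<forall>e. \<forall>c\<in>cartier_ops R p M \<kappa> f t e. \<forall>n\<in>N. c n \<in> N)"

definition c_plus ::
  "('a, 'x) ring_scheme \<Rightarrow> nat \<Rightarrow> ('a, 'b, 'y) module_scheme \<Rightarrow> ('b \<Rightarrow> 'b) \<Rightarrow> 'a \<Rightarrow> rat \<Rightarrow> 'b set \<Rightarrow> 'b set" where
  "c_plus R p M \<kappa> f t N = generate (add_monoid M)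
     {c n | c n e. e \<ge> 1 \<and> c \<in> cartier_ops R p M \<kappa> f t e \<and> n \<in> N}"

text \<open>\<open>(\<C>\<^sub>+)\<^sup>h M\<close> for large \<open>h\<close>: the eventual value of the descending chain.\<close>

definition c_stable ::
  "('a, 'x) ring_scheme \<Rightarrow> nat \<Rightarrow> ('a, 'b, 'y) module_scheme \<Rightarrow> ('b \<Rightarrow> 'b) \<Rightarrow> 'a \<Rightarrow> rat \<Rightarrow> 'b set" where
  "c_stable R p M \<kappa> f t =
     (THE U. \<forall>\<^sub>F h in sequentially. (c_plus R p M \<kappa> f t ^^ h) (carrier M) = U)"

definition generic_c_submodule ::
  "('a, 'x) ring_scheme \<Rightarrow> nat \<Rightarrow> ('a, 'b, 'y) module_scheme \<Rightarrow> ('b \<Rightarrow> 'b) \<Rightarrow> 'a \<Rightarrow> rat \<Rightarrow> 'b set \<Rightarrow> bool" where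
  "generic_c_submodule R p M \<kappa> f t N \<longleftrightarrow> c_submodule R p M \<kappa> f t N \<and>
     (\<forall>\<eta>\<in>generic_points R M (c_stable R p M \<kappa> f t).
        loc_sub R M \<eta> N = loc_sub R M \<eta> (c_stable R p M \<kappa> f t))"

definition test_module ::
  "('a, 'x) ring_scheme \<Rightarrow> nat \<Rightarrow> ('a, 'b, 'y) module_scheme \<Rightarrow> ('b \<Rightarrow> 'b) \<Rightarrow> 'a \<Rightarrow> rat \<Rightarrow> 'b set" where
  "test_module R p M \<kappa> f t = (THE T. generic_c_submodule R p M \<kappa> f t T \<and>
     (\<forall>N. generic_c_submodule R p M \<kappa> f t N \<longrightarrow> T \<subseteq> N))"


section \<open>The functors \<open>F\<^sup>e\<^sup>!\<close>\<close>

text \<open>\<open>Hom\<^sub>R(F\<^sup>e\<^sub>* R, M)\<close> with \<open>R\<close> acting by \<open>(s \<cdot> \<psi>)(r) = \<psi>(s r)\<close>.  Elements are extensional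
  functions on the carrier of \<open>R\<close>.\<close>

definition shriek ::
  "('a, 'x) ring_scheme \<Rightarrow> nat \<Rightarrow> ('a, 'b, 'y) module_scheme \<Rightarrow> nat \<Rightarrow> ('a, 'a \<Rightarrow> 'b) module" where
  "shriek R p M e = \<lparr>carrier = mod_hom R (frob_push R p e (reg_mod R)) M \<inter> extensional (carrier R),
     monoid.mult = undefined, monoid.one = undefined,
     ring.zero = (\<lambda>r\<in>carrier R. \<zero>\<^bsub>M\<^esub>),
     ring.add = (\<lambda>\<psi> \<chi>. \<lambda>r\<in>carrier R. \<psi> r \<oplus>\<^bsub>M\<^esub> \<chi> r),
     smult = (\<lambda>s \<psi>. \<lambda>r\<in>carrier R. \<psi> (s \<otimes>\<^bsub>R\<^esub> r))\<rparr>"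

text \<open>\<open>F\<^sup>e\<^sup>! h\<close> is post-composition with \<open>h\<close>, for every \<open>e\<close>.\<close>

definition shriek_map :: "('a, 'x) ring_scheme \<Rightarrow> ('b \<Rightarrow> 'c) \<Rightarrow> ('a \<Rightarrow> 'b) \<Rightarrow> ('a \<Rightarrow> 'c)" where
  "shriek_map R h \<psi> = (\<lambda>r\<in>carrier R. h (\<psi> r))"

definition adj_structure ::
  "('a, 'x) ring_scheme \<Rightarrow> ('a, 'b, 'y) module_scheme \<Rightarrow> ('b \<Rightarrow> 'b) \<Rightarrow> 'b \<Rightarrow> ('a \<Rightarrow> 'b)" where
  "adj_structure R M \<kappa> m = (\<lambda>r\<in>carrier R. \<kappa> (r \<odot>\<^bsub>M\<^esub> m))"

text \<open>The canonical isomorphism from \<open>F\<^sup>e\<^sup>! F\<^sup>! M = Hom\<^sub>R(F\<^sup>e\<^sub>* R, Hom\<^sub>R(F\<^sub>* R, M))\<close> to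
  \<open>Hom\<^sub>R(F\<^sup>e\<^sup>+\<^sup>1\<^sub>* R, M)\<close>.\<close>

definition shriek_comp :: "('a, 'x) ring_scheme \<Rightarrow> ('a \<Rightarrow> 'a \<Rightarrow> 'b) \<Rightarrow> ('a \<Rightarrow> 'b)" where
  "shriek_comp R \<Psi> = (\<lambda>r\<in>carrier R. \<Psi> r \<one>\<^bsub>R\<^esub>)"

definition shriek_trans ::
  "('a, 'x) ring_scheme \<Rightarrow> ('a, 'b, 'y) module_scheme \<Rightarrow> ('b \<Rightarrow> 'b) \<Rightarrow> ('a \<Rightarrow> 'b) \<Rightarrow> ('a \<Rightarrow> 'b)" where
  "shriek_trans R M \<kappa> \<psi> = shriek_comp R (shriek_map R (adj_structure R M \<kappa>) \<psi>)"


section \<open>Sequential colimits\<close>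

text \<open>Colimit of \<open>G 0 \<rightarrow> G 1 \<rightarrow> \<dots>\<close>, where all the transition maps are given by one function \<open>T\<close>.\<close>

definition colim_rel ::
  "(nat \<Rightarrow> ('a, 'c, 'y) module_scheme) \<Rightarrow> ('c \<Rightarrow> 'c) \<Rightarrow> ((nat \<times> 'c) \<times> (nat \<times> 'c)) set" where
  "colim_rel G T = {((i, x), (j, y)). x \<in> carrier (G i) \<and> y \<in> carrier (G j) \<and>
     (\<exists>k l. i + k = j + l \<and> (T ^^ k) x = (T ^^ l) y)}"

definition colim_class ::
  "(nat \<Rightarrow> ('a, 'c, 'y) module_scheme) \<Rightarrow> ('c \<Rightarrow> 'c) \<Rightarrow> nat \<Rightarrow> 'c \<Rightarrow> (nat \<times> 'c) set" where
  "colim_class G T i x = colim_rel G T `` {(i, x)}"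

definition colim ::
  "(nat \<Rightarrow> ('a, 'c, 'y) module_scheme) \<Rightarrow> ('c \<Rightarrow> 'c) \<Rightarrow> ('a, (nat \<times> 'c) set) module" where
  "colim G T = \<lparr>carrier = (SIGMA i:UNIV. carrier (G i)) // colim_rel G T,
     monoid.mult = undefined, monoid.one = undefined,
     ring.zero = colim_class G T 0 \<zero>\<^bsub>G 0\<^esub>,
     ring.add = (\<lambda>U V. \<Union>(i, x)\<in>U. \<Union>(j, y)\<in>V.
        colim_class G T (i + j) ((T ^^ j) x \<oplus>\<^bsub>G (i + j)\<^esub> (T ^^ i) y)),
     smult = (\<lambda>r U. \<Union>(i, x)\<in>U. colim_class G T i (r \<odot>\<^bsub>G i\<^esub> x))\<rparr>"

definition cartier_colim ::
  "('a, 'x) ring_scheme \<Rightarrow> nat \<Rightarrow> ('a, 'b, 'y) module_scheme \<Rightarrow> ('b \<Rightarrow> 'b) \<Rightarrow> ('a, (nat \<times> ('a \<Rightarrow> 'b)) set) module" where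
  "cartier_colim R p M \<kappa> = colim (shriek R p M) (shriek_trans R M \<kappa>)"

text \<open>The natural map, using \<open>M \<cong> F\<^sup>0\<^sup>! M = Hom\<^sub>R(R, M)\<close>.\<close>

definition to_cartier_colim ::
  "('a, 'x) ring_scheme \<Rightarrow> nat \<Rightarrow> ('a, 'b, 'y) module_scheme \<Rightarrow> ('b \<Rightarrow> 'b) \<Rightarrow> 'b \<Rightarrow> (nat \<times> ('a \<Rightarrow> 'b)) set" where
  "to_cartier_colim R p M \<kappa> m =
     colim_class (shriek R p M) (shriek_trans R M \<kappa>) 0 (\<lambda>r\<in>carrier R. r \<odot>\<^bsub>M\<^esub> m)"

text \<open>The map on colimits induced by \<open>\<phi> : M \<rightarrow> N\<close>, i.e. by the maps \<open>F\<^sup>e\<^sup>! \<phi>\<close>.\<close>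

definition cartier_colim_map ::
  "('a, 'x) ring_scheme \<Rightarrow> nat \<Rightarrow> ('a, 'c, 'z) module_scheme \<Rightarrow> ('c \<Rightarrow> 'c) \<Rightarrow> ('b \<Rightarrow> 'c) \<Rightarrow>
   (nat \<times> ('a \<Rightarrow> 'b)) set \<Rightarrow> (nat \<times> ('a \<Rightarrow> 'c)) set" where
  "cartier_colim_map R p N \<kappa>\<^sub>N \<phi> U =
     (\<Union>(e, \<psi>)\<in>U. colim_class (shriek R p N) (shriek_trans R N \<kappa>\<^sub>N) e (shriek_map R \<phi> \<psi>))"

definition test_module_colim ::
  "('a, 'x) ring_scheme \<Rightarrow> nat \<Rightarrow> ('a, 'b, 'y) module_scheme \<Rightarrow> ('b \<Rightarrow> 'b) \<Rightarrow> 'a \<Rightarrow> rat \<Rightarrow> (nat \<times> ('a \<Rightarrow> 'b)) set set" where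
  "test_module_colim R p M \<kappa> f t = to_cartier_colim R p M \<kappa> ` test_module R p M \<kappa> f t"

end

theory Submission
  imports Defs
begin

text \<open>Everything rests on the finiteness of \<open>k\<close> over its \<open>p\<close>-th powers.  Writing a ring element as a
  fraction over a finitely generated \<open>k\<close>-algebra and measuring elements of \<open>M\<close> by the exponents of monomials
  (a gauge), \<open>\<kappa>\<^sup>e\<close> divides gauges by \<open>p\<^sup>e\<close> up to a constant.  Hence all submodules \<open>N\<close> with
  \<open>\<C>\<^sub>+ N = N\<close> are generated inside one fixed finite-dimensional \<open>k\<close>-space.  The family of such submodules
  that are generically equal to \<open>\<C>\<^sub>+\<^sup>h M\<close> is directed downwards, so it has a smallest element, and this is the
  test module.

  A nil-isomorphism \<open>\<phi>\<close> maps \<open>\<C>\<^sub>+\<^sup>h M\<close> onto \<open>\<C>\<^sub>+\<^sup>h N\<close> for large \<open>h\<close>, and both have the same support because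
  \<open>\<C>\<^sub>e\<close> kills the kernel for large \<open>e\<close>.  So images and preimages of generically full submodules are generically
  full, and minimality gives the equality of test modules.  For the filtration, a generic point for an exponent
  \<open>t > 0\<close> does not contain \<open>f\<close>, and where \<open>f\<close> is invertible the exponent does not matter.  On colimits the
  transition maps are postcomposition with \<open>\<kappa>\<close>, which makes both kernel and cokernel of \<open>\<phi>\<close> disappear.\<close>

section \<open>Finite sums and Hilbert's basis theorem\<close>

text \<open>Both \<open>c_stable\<close> and \<open>test_module\<close> are definite descriptions,
  so nothing can be said about them before the chain is known to become stationary and a smallest
  generically full submodule is known to exist; this takes the larger part of the work. A finitely
  generated module over \<open>R\<close> has no descending chain condition, hence the detour through
  finite-dimensional spaces. The obstacle is localization: exponents measure elements only over the
  finitely generated subalgebra, while both \<open>R\<close> and \<open>\<kappa>\<close> create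
  denominators. What saves the argument is that a unit leaves \<open>\<kappa>^e\<close> when it
  stands inside as a \<open>p^e\<close>-th power, so denominators can be cleared inside and restored
  outside. The bound must also be uniform: generators of \<open>N\<close> have arbitrary gauge, but
  \<open>N = C_+ N\<close> permits \<open>e\<close> to be as large as that gauge requires.
  Localizations at primes enter only through multipliers outside \<open>P\<close> that send elements
  of one submodule into another, and noetherianity is proved relative to subsets of
  \<open>R\<close>, so that a single ambient ring carries the whole argument.\<close>

inductive_set addspan :: "('a, 'x) ring_scheme \<Rightarrow> 'a set \<Rightarrow> 'a set"
  for G and E where
  addspan_zero: "\<zero>\<^bsub>G\<^esub> \<in> addspan G E"
| addspan_add: "\<lbrakk>x \<in> E; y \<in> addspan G E\<rbrakk> \<Longrightarrow> x \<oplus>\<^bsub>G\<^esub> y \<in> addspan G E"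

lemma addspan_mono: "E \<subseteq> Y \<Longrightarrow> addspan G E \<subseteq> addspan G Y"
proof
  fix x assume "E \<subseteq> Y" "x \<in> addspan G E"
  from this(2,1) show "x \<in> addspan G Y" by induction (auto intro: addspan.intros)
qed

lemma addspan_least:
  assumes "E \<subseteq> H" "\<zero>\<^bsub>G\<^esub> \<in> H" "\<And>x y. \<lbrakk>x \<in> H; y \<in> H\<rbrakk> \<Longrightarrow> x \<oplus>\<^bsub>G\<^esub> y \<in> H"
  shows "addspan G E \<subseteq> H"
proof
  fix x assume "x \<in> addspan G E"
  then show "x \<in> H" by induction (use assms in auto)
qed

context abelian_group begin

lemma addspan_closed: "E \<subseteq> carrier G \<Longrightarrow> addspan G E \<subseteq> carrier G"
  by (rule addspan_least) auto

lemma addspan_incl: "\<lbrakk>x \<in> E; E \<subseteq> carrier G\<rbrakk> \<Longrightarrow> x \<in> addspan G E"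
  using addspan_add[OF _ addspan_zero, of x E G] by auto

lemma addspan_plus: "\<lbrakk>E \<subseteq> carrier G; x \<in> addspan G E; y \<in> addspan G E\<rbrakk> \<Longrightarrow> x \<oplus> y \<in> addspan G E"
proof -
  assume E: "E \<subseteq> carrier G" and x: "x \<in> addspan G E" and y: "y \<in> addspan G E"
  have yc: "y \<in> carrier G" using y addspan_closed[OF E] by auto
  from x show ?thesis
  proof induction
    case addspan_zero then show ?case using y yc by simp
  next
    case (addspan_add a z)
    have "(a \<oplus> z) \<oplus> y = a \<oplus> (z \<oplus> y)" using addspan_add E yc addspan_closed[OF E] by (intro a_assoc) auto
    then show ?case using addspan_add by (auto intro: addspan.addspan_add)
  qed
qed

lemma addspan_subset_addspan: "\<lbrakk>E \<subseteq> carrier G; Y \<subseteq> addspan G E\<rbrakk> \<Longrightarrow> addspan G Y \<subseteq> addspan G E"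
  by (rule addspan_least) (auto intro: addspan_zero addspan_plus)

lemma addspan_minus:
  assumes "E \<subseteq> carrier G" "\<And>x. x \<in> E \<Longrightarrow> \<ominus> x \<in> E" "x \<in> addspan G E"
  shows "\<ominus> x \<in> addspan G E"
  using assms(3)
proof induction
  case addspan_zero show ?case by (metis addspan.addspan_zero minus_equality l_zero zero_closed)
next
  case (addspan_add a z)
  have "\<ominus> (a \<oplus> z) = \<ominus> a \<oplus> \<ominus> z"
    using addspan_add assms addspan_closed[of E] by (intro minus_add) auto
  then show ?case using addspan_add assms(2) by (auto intro: addspan.addspan_add)
qed

text \<open>Reduction to generators for any additive map. Only additivity is asked of
  \<open>h\<close>, so it serves multiplication by scalars, the semilinear \<open>\<kappa>\<close>,
  and maps such as \<open>a\<close> to \<open>a x\<close> that vary the scalar.\<close>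

lemma addspan_map:
  assumes "abelian_group H" "E \<subseteq> carrier G" "x \<in> addspan G E" "Y \<subseteq> carrier H"
    and "h \<zero> = \<zero>\<^bsub>H\<^esub>"
    and "\<And>x y. \<lbrakk>x \<in> carrier G; y \<in> carrier G\<rbrakk> \<Longrightarrow> h (x \<oplus> y) = h x \<oplus>\<^bsub>H\<^esub> h y"
    and "\<And>x. x \<in> E \<Longrightarrow> h x \<in> addspan H Y"
  shows "h x \<in> addspan H Y"
  using assms(3)
proof induction
  case addspan_zero then show ?case using assms(5) by (simp add: addspan.addspan_zero)
next
  case (addspan_add a z)
  have "h (a \<oplus> z) = h a \<oplus>\<^bsub>H\<^esub> h z"
    using addspan_add assms addspan_closed[of E] by (intro assms(6)) auto
  then show ?case
    using abelian_group.addspan_plus[OF assms(1,4) assms(7)[OF addspan_add(1)] addspan_add(3)] by simp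
qed

text \<open>Needed for \<open>c_plus\<close>, which is defined as a generated subgroup. Its
  generators are closed under negation because the ring coefficient of an operator absorbs a
  sign.\<close>

lemma generate_eq_addspan:
  assumes "E \<subseteq> carrier G" "\<And>x. x \<in> E \<Longrightarrow> \<ominus> x \<in> E"
  shows "generate (add_monoid G) E = addspan G E"
proof
  show "generate (add_monoid G) E \<subseteq> addspan G E"
  proof
    fix x assume "x \<in> generate (add_monoid G) E"
    then show "x \<in> addspan G E"
    proof induction
      case one then show ?case by (simp add: addspan_zero)
    next
      case (incl h) then show ?case using addspan_incl assms by auto
    next
      case (inv h) 
      then have "\<ominus> h \<in> addspan G E" using addspan_incl[of "\<ominus> h" E] assms by auto
      then show ?case by (simp add: a_inv_def)
    next
      case (eng h1 h2) then show ?case using addspan_plus[OF assms(1)] by simp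
    qed
  qed
  show "addspan G E \<subseteq> generate (add_monoid G) E"
    by (rule addspan_least) (auto intro: generate.incl generate.eng[of _ "add_monoid G", simplified]
        generate.one[of "add_monoid G", simplified])
qed

end

text \<open>Finite generation of the ideals of \<open>B\<close>, where \<open>B\<close> is a subring
  of \<open>R\<close> in every use. Working inside one ambient ring lets elements be adjoined
  repeatedly without leaving its type.\<close>

definition noeth_in :: "('a, 'x) ring_scheme \<Rightarrow> 'a set \<Rightarrow> bool" where
  "noeth_in R B \<longleftrightarrow> (\<forall>J. J \<subseteq> B \<longrightarrow> \<zero>\<^bsub>R\<^esub> \<in> J \<longrightarrow> (\<forall>x\<in>J. \<forall>y\<in>J. x \<oplus>\<^bsub>R\<^esub> y \<in> J) \<longrightarrow>
     (\<forall>b\<in>B. \<forall>x\<in>J. b \<otimes>\<^bsub>R\<^esub> x \<in> J) \<longrightarrow>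
     (\<exists>E. finite E \<and> E \<subseteq> J \<and> J \<subseteq> addspan R {b \<otimes>\<^bsub>R\<^esub> x | b x. b \<in> B \<and> x \<in> E}))"

text \<open>Values at \<open>s\<close> of polynomials of degree strictly below \<open>n\<close> over
  \<open>B\<close>. As \<open>s\<close> may satisfy relations over \<open>B\<close>, the degree
  belongs to an expression and not to the element.\<close>

primrec pols :: "('a, 'x) ring_scheme \<Rightarrow> 'a set \<Rightarrow> 'a \<Rightarrow> nat \<Rightarrow> 'a set" where
  "pols R B s 0 = {\<zero>\<^bsub>R\<^esub>}"
| "pols R B s (Suc n) = {b \<otimes>\<^bsub>R\<^esub> s [^]\<^bsub>R\<^esub> n \<oplus>\<^bsub>R\<^esub> y | b y. b \<in> B \<and> y \<in> pols R B s n}"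

definition adjoin :: "('a, 'x) ring_scheme \<Rightarrow> 'a set \<Rightarrow> 'a \<Rightarrow> 'a set" where
  "adjoin R B s = (\<Union>n. pols R B s n)"

section \<open>Hilbert's basis theorem for subrings of a commutative ring\<close>

context cring begin

lemma sub_add_cancel_common:
  assumes "q \<in> carrier R" "u \<in> carrier R" "v \<in> carrier R"
  shows "u \<oplus> (\<ominus> \<one>) \<otimes> v = (q \<oplus> u) \<oplus> (\<ominus> \<one>) \<otimes> (q \<oplus> v)"
    and "(u \<oplus> (\<ominus> \<one>) \<otimes> v) \<oplus> (q \<oplus> v) = q \<oplus> u"
  using assms by algebra+

lemma lead_reduce_identity:
  assumes "b \<in> carrier R" "w \<in> carrier R" "c \<in> carrier R" "d \<in> carrier R"
    "y \<in> carrier R" "y' \<in> carrier R"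
  shows "(b \<otimes> c \<oplus> w) \<otimes> d \<oplus> (b \<otimes> y \<oplus> y') = b \<otimes> (c \<otimes> d \<oplus> y) \<oplus> (w \<otimes> d \<oplus> y')"
  using assms by algebra

context
  fixes B s
  assumes B: "subring B R" and s: "s \<in> carrier R"
begin

lemma B_carr: "b \<in> B \<Longrightarrow> b \<in> carrier R"
  using subringE(1)[OF B] by auto

lemma pols_closed: "pols R B s n \<subseteq> carrier R"
  using B_carr s by (induction n) auto

lemma pols_carr: "y \<in> pols R B s n \<Longrightarrow> y \<in> carrier R"
  using pols_closed by auto

lemma pols_Suc: "pols R B s n \<subseteq> pols R B s (Suc n)"
proof
  fix y assume y: "y \<in> pols R B s n"
  then have "y = \<zero> \<otimes> s [^] n \<oplus> y" using pols_carr s by simp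
  then show "y \<in> pols R B s (Suc n)" using y subringE(2)[OF B] by auto
qed

lemma pols_mono: "m \<le> n \<Longrightarrow> pols R B s m \<subseteq> pols R B s n"
  by (rule lift_Suc_mono_le[of "pols R B s"]) (use pols_Suc in auto)

lemma pols_zero: "\<zero> \<in> pols R B s n"
  using pols_mono[of 0 n] by auto

lemma pols_plus: "\<lbrakk>x \<in> pols R B s n; y \<in> pols R B s n\<rbrakk> \<Longrightarrow> x \<oplus> y \<in> pols R B s n"
proof (induction n arbitrary: x y)
  case (Suc n)
  obtain b u where x: "x = b \<otimes> s [^] n \<oplus> u" "b \<in> B" "u \<in> pols R B s n" using Suc.prems by auto
  obtain c v where y: "y = c \<otimes> s [^] n \<oplus> v" "c \<in> B" "v \<in> pols R B s n" using Suc.prems by auto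
  have "x \<oplus> y = (b \<oplus> c) \<otimes> s [^] n \<oplus> (u \<oplus> v)"
    using x y B_carr pols_carr s by (simp add: l_distr a_ac)
  then show ?case using Suc.IH[OF x(3) y(3)] subringE(7)[OF B x(2) y(2)] by auto
qed auto

lemma pols_smult: "\<lbrakk>c \<in> B; x \<in> pols R B s n\<rbrakk> \<Longrightarrow> c \<otimes> x \<in> pols R B s n"
proof (induction n arbitrary: x)
  case 0 then show ?case using B_carr by auto
next
  case (Suc n)
  obtain b u where x: "x = b \<otimes> s [^] n \<oplus> u" "b \<in> B" "u \<in> pols R B s n" using Suc.prems by auto
  have "c \<otimes> x = (c \<otimes> b) \<otimes> s [^] n \<oplus> c \<otimes> u"
    using x B_carr pols_carr s Suc.prems by (simp add: r_distr m_assoc)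
  then show ?case using Suc.IH[OF Suc.prems(1) x(3)] subringE(6)[OF B Suc.prems(1) x(2)] by auto
qed

lemma pols_shift: "x \<in> pols R B s n \<Longrightarrow> s \<otimes> x \<in> pols R B s (Suc n)"
proof (induction n arbitrary: x)
  case 0 then show ?case using s pols_zero[of "Suc 0"] by auto
next
  case (Suc n)
  obtain b u where x: "x = b \<otimes> s [^] n \<oplus> u" "b \<in> B" "u \<in> pols R B s n" using Suc.prems by auto
  have "s \<otimes> x = b \<otimes> s [^] Suc n \<oplus> s \<otimes> u"
    using x B_carr pols_carr s by (simp add: r_distr m_ac)
  then show ?case using Suc.IH[OF x(3)] x by auto
qed

lemma pols_shift_pow: "x \<in> pols R B s n \<Longrightarrow> s [^] k \<otimes> x \<in> pols R B s (n + k)"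
proof (induction k)
  case 0 then show ?case using pols_carr by simp
next
  case (Suc k)
  have "s [^] Suc k \<otimes> x = s \<otimes> (s [^] k \<otimes> x)" using s pols_carr[OF Suc.prems] by (simp add: m_ac)
  then show ?case using pols_shift[OF Suc.IH[OF Suc.prems]] by (simp del: pols.simps)
qed

lemma pols_mult: "\<lbrakk>x \<in> pols R B s m; y \<in> pols R B s n\<rbrakk> \<Longrightarrow> x \<otimes> y \<in> pols R B s (m + n)"
proof (induction m arbitrary: x)
  case 0 then show ?case using pols_carr pols_zero by auto
next
  case (Suc m)
  obtain b u where x: "x = b \<otimes> s [^] m \<oplus> u" "b \<in> B" "u \<in> pols R B s m" using Suc.prems by auto
  have "x \<otimes> y = b \<otimes> (s [^] m \<otimes> y) \<oplus> u \<otimes> y"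
    using x B_carr pols_carr s Suc.prems by (simp add: l_distr m_assoc)
  moreover have "b \<otimes> (s [^] m \<otimes> y) \<in> pols R B s (Suc m + n)"
    using pols_smult[OF x(2) pols_shift_pow[OF Suc.prems(2)]] pols_mono[of "n + m" "Suc m + n"] by auto
  moreover have "u \<otimes> y \<in> pols R B s (Suc m + n)"
    using Suc.IH[OF x(3) Suc.prems(2)] pols_mono[of "m + n" "Suc m + n"] by auto
  ultimately show ?case using pols_plus by metis
qed

lemma B_pols: "b \<in> B \<Longrightarrow> b \<in> pols R B s (Suc 0)"
proof -
  assume "b \<in> B"
  then have "b = b \<otimes> s [^] (0::nat) \<oplus> \<zero>" "b \<in> B" using B_carr by auto
  then show ?thesis by auto
qed

lemma adjoin_incl: "B \<subseteq> adjoin R B s"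
  using B_pols unfolding adjoin_def by blast

lemma adjoin_mem: "s \<in> adjoin R B s"
proof -
  have "s \<otimes> \<one> \<in> pols R B s (Suc (Suc 0))" using pols_shift[OF B_pols[OF subringE(3)[OF B]]] .
  then show ?thesis using s unfolding adjoin_def by (metis UN_I UNIV_I r_one)
qed

lemma adjoin_subring: "subring (adjoin R B s) R"
proof (rule subringI)
  show "adjoin R B s \<subseteq> carrier R" using pols_closed unfolding adjoin_def by auto
  show "\<one> \<in> adjoin R B s" using adjoin_incl subringE(3)[OF B] by auto
  fix x assume "x \<in> adjoin R B s"
  then obtain n where x: "x \<in> pols R B s n" unfolding adjoin_def by auto
  have "\<ominus> x = (\<ominus> \<one>) \<otimes> x" using pols_carr[OF x] by (simp add: l_minus)
  then show "\<ominus> x \<in> adjoin R B s"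
    using pols_smult[OF subringE(5)[OF B subringE(3)[OF B]] x] unfolding adjoin_def by auto
next
  fix x y assume "x \<in> adjoin R B s" "y \<in> adjoin R B s"
  then obtain m n where x: "x \<in> pols R B s m" and y: "y \<in> pols R B s n" unfolding adjoin_def by auto
  show "x \<otimes> y \<in> adjoin R B s" using pols_mult[OF x y] unfolding adjoin_def by auto
  have "x \<in> pols R B s (max m n)" "y \<in> pols R B s (max m n)"
    using x y pols_mono[of m "max m n"] pols_mono[of n "max m n"] by auto
  then show "x \<oplus> y \<in> adjoin R B s" using pols_plus unfolding adjoin_def by blast
qed

text \<open>A \<open>B\<close>-combination of leading coefficients is lifted to the same combination
  of the elements of \<open>Z\<close> that carry them; the lower terms combine inside
  \<open>pols R B s n\<close>.\<close>

lemma lead_reduce: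
  assumes J: "\<And>x y. \<lbrakk>x \<in> J; y \<in> J\<rbrakk> \<Longrightarrow> x \<oplus> y \<in> J" "\<And>x y. \<lbrakk>x \<in> adjoin R B s; y \<in> J\<rbrakk> \<Longrightarrow> x \<otimes> y \<in> J" "\<zero> \<in> J"
    and Z: "\<And>c. c \<in> Y \<Longrightarrow> \<exists>y\<in>pols R B s n. c \<otimes> s [^] n \<oplus> y \<in> Z" 
    and ZJ: "Z \<subseteq> J" "J \<subseteq> carrier R" and Y: "Y \<subseteq> B"
    and b: "b \<in> addspan R {b \<otimes> x | b x. b \<in> B \<and> x \<in> Y}"
  shows "\<exists>y\<in>pols R B s n. b \<otimes> s [^] n \<oplus> y \<in> addspan R {a \<otimes> x | a x. a \<in> adjoin R B s \<and> x \<in> Z}"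
  using b
proof induction
  case addspan_zero
  show ?case using pols_zero s by (intro bexI[of _ \<zero>]) (auto intro: addspan.addspan_zero)
next
  case (addspan_add v w)
  obtain b c where v: "v = b \<otimes> c" "b \<in> B" "c \<in> Y" using addspan_add by auto
  obtain y where y: "y\<in>pols R B s n" "c \<otimes> s [^] n \<oplus> y \<in> Z" using Z v by blast
  obtain y' where y': "y'\<in>pols R B s n" 
    "w \<otimes> s [^] n \<oplus> y' \<in> addspan R {a \<otimes> x | a x. a \<in> adjoin R B s \<and> x \<in> Z}" using addspan_add.IH by blast
  have "{b \<otimes> x | b x. b \<in> B \<and> x \<in> Y} \<subseteq> carrier R" using Y B_carr by auto
  then have wc: "w \<in> carrier R" using addspan_add(2) addspan_closed by blast
  have cc: "b \<in> carrier R" "c \<in> carrier R" "y \<in> carrier R" "y' \<in> carrier R" "s [^] n \<in> carrier R"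
    using v Y B_carr pols_carr y y' s by auto
  have "(v \<oplus> w) \<otimes> s [^] n \<oplus> (b \<otimes> y \<oplus> y') = b \<otimes> (c \<otimes> s [^] n \<oplus> y) \<oplus> (w \<otimes> s [^] n \<oplus> y')"
    unfolding v(1) using cc wc by (rule_tac lead_reduce_identity)
  also have "\<dots> \<in> addspan R {a \<otimes> x | a x. a \<in> adjoin R B s \<and> x \<in> Z}"
    by (rule addspan.addspan_add) (use y y' v adjoin_incl in auto)
  finally show ?case using pols_plus[OF pols_smult[OF v(2) y(1)] y'(1)] by blast
qed

text \<open>Hilbert's argument with leading coefficients. \<open>L n\<close> collects every
  \<open>b\<close> for which some expression \<open>b s^n + lower terms\<close> lies in
  \<open>J\<close>; multiplication by \<open>s\<close> makes these ideals increase, and finite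
  generation of their union puts all its generators into a single \<open>L N\<close>.\<close>

lemma hilbert_basis:
  assumes noeth: "noeth_in R B"
  shows "noeth_in R (adjoin R B s)"
  unfolding noeth_in_def
proof (intro allI impI)
  fix J assume JA: "J \<subseteq> adjoin R B s" and J0: "\<zero> \<in> J" and Jp: "\<forall>x\<in>J. \<forall>y\<in>J. x \<oplus> y \<in> J"
    and Jm: "\<forall>b\<in>adjoin R B s. \<forall>x\<in>J. b \<otimes> x \<in> J"
  let ?A = "adjoin R B s"
  have AR: "?A \<subseteq> carrier R" using subringE(1)[OF adjoin_subring] .
  have JR: "J \<subseteq> carrier R" using JA AR by auto
  define L where "L n = {b \<in> B. \<exists>y\<in>pols R B s n. b \<otimes> s [^] n \<oplus> y \<in> J}" for n
  have L_B: "L n \<subseteq> B" for n unfolding L_def by auto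
  have L_zero: "\<zero> \<in> L n" for n unfolding L_def
    using subringE(2)[OF B] s J0 pols_zero by (auto intro!: bexI[of _ \<zero>])
  have L_plus: "x \<oplus> y \<in> L n" if "x \<in> L n" "y \<in> L n" for x y n
  proof -
    obtain u v where u: "u \<in> pols R B s n" "x \<otimes> s [^] n \<oplus> u \<in> J" and v: "v \<in> pols R B s n" "y \<otimes> s [^] n \<oplus> v \<in> J"
      and xy: "x \<in> B" "y \<in> B"
      using \<open>x \<in> L n\<close> \<open>y \<in> L n\<close> unfolding L_def by auto
    have "(x \<oplus> y) \<otimes> s [^] n \<oplus> (u \<oplus> v) = (x \<otimes> s [^] n \<oplus> u) \<oplus> (y \<otimes> s [^] n \<oplus> v)"
      using B_carr pols_carr s xy u v by (simp add: l_distr a_ac)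
    also have "\<dots> \<in> J" using u v Jp by auto
    finally show ?thesis unfolding L_def using pols_plus[OF u(1) v(1)] subringE(7)[OF B xy] by auto
  qed
  have L_mult: "b \<otimes> x \<in> L n" if bx: "b \<in> B" "x \<in> L n" for b x n
  proof -
    obtain u where u: "u \<in> pols R B s n" "x \<otimes> s [^] n \<oplus> u \<in> J" and x: "x \<in> B"
      using bx unfolding L_def by auto
    have "(b \<otimes> x) \<otimes> s [^] n \<oplus> b \<otimes> u = b \<otimes> (x \<otimes> s [^] n \<oplus> u)"
      using B_carr pols_carr s x u that by (simp add: r_distr m_assoc)
    also have "\<dots> \<in> J" using u Jm that adjoin_incl by auto
    finally show ?thesis unfolding L_def using pols_smult[OF that(1) u(1)] subringE(6)[OF B that(1) x] by auto
  qed
  have L_Suc: "L n \<subseteq> L (Suc n)" for n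
  proof
    fix x assume "x \<in> L n"
    then obtain u where u: "u \<in> pols R B s n" "x \<otimes> s [^] n \<oplus> u \<in> J" and x: "x \<in> B" unfolding L_def by auto
    have "x \<otimes> s [^] Suc n \<oplus> s \<otimes> u = s \<otimes> (x \<otimes> s [^] n \<oplus> u)"
      using B_carr pols_carr s x u by (simp add: r_distr m_ac)
    also have "\<dots> \<in> J" using u Jm adjoin_mem by auto
    finally show "x \<in> L (Suc n)" unfolding L_def using pols_shift[OF u(1)] x by auto
  qed
  have L_mono: "m \<le> n \<Longrightarrow> L m \<subseteq> L n" for m n
    by (rule lift_Suc_mono_le[of L]) (use L_Suc in auto)
  have "\<exists>E. finite E \<and> E \<subseteq> (\<Union>n. L n) \<and> (\<Union>n. L n) \<subseteq> addspan R {b \<otimes> x | b x. b \<in> B \<and> x \<in> E}"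
  proof (rule noeth[unfolded noeth_in_def, rule_format])
    show "(\<Union>n. L n) \<subseteq> B" unfolding L_def by auto
    show "\<zero> \<in> (\<Union>n. L n)" using L_zero by auto
    fix x y assume "x \<in> (\<Union>n. L n)" "y \<in> (\<Union>n. L n)"
    then obtain m n where "x \<in> L m" "y \<in> L n" by auto
    then have "x \<in> L (max m n)" "y \<in> L (max m n)" using L_mono[of m "max m n"] L_mono[of n "max m n"] by auto
    then show "x \<oplus> y \<in> (\<Union>n. L n)" using L_plus by auto
  next
    fix b x assume "b \<in> B" "x \<in> (\<Union>n. L n)"
    then show "b \<otimes> x \<in> (\<Union>n. L n)" using L_mult by auto
  qed
  then obtain E where E: "finite E" "E \<subseteq> (\<Union>n. L n)" "(\<Union>n. L n) \<subseteq> addspan R {b \<otimes> x | b x. b \<in> B \<and> x \<in> E}" by auto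
  have "\<exists>N. E \<subseteq> L N" using E(1,2)
  proof (induction E rule: finite_induct)
    case empty then show ?case by auto
  next
    case (insert x F)
    then obtain m n where "x \<in> L m" "F \<subseteq> L n" by auto
    then show ?case using L_mono[of m "max m n"] L_mono[of n "max m n"] by (intro exI[of _ "max m n"]) auto
  qed
  then obtain N where N: "E \<subseteq> L N" by auto
  have "\<forall>n. \<exists>Y. finite Y \<and> Y \<subseteq> L n \<and> L n \<subseteq> addspan R {b \<otimes> x | b x. b \<in> B \<and> x \<in> Y}"
  proof
    fix n show "\<exists>Y. finite Y \<and> Y \<subseteq> L n \<and> L n \<subseteq> addspan R {b \<otimes> x | b x. b \<in> B \<and> x \<in> Y}"
      by (rule noeth[unfolded noeth_in_def, rule_format])
         (use L_zero L_plus L_mult L_B in auto)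
  qed
  from choice[OF this] obtain Y where
    "\<forall>n. finite (Y n) \<and> Y n \<subseteq> L n \<and> L n \<subseteq> addspan R {b \<otimes> x | b x. b \<in> B \<and> x \<in> Y n}" ..
  then have Y: "\<And>n. finite (Y n)" "\<And>n. Y n \<subseteq> L n" "\<And>n. L n \<subseteq> addspan R {b \<otimes> x | b x. b \<in> B \<and> x \<in> Y n}"
    by auto
  have "\<forall>n c. \<exists>y. c \<in> L n \<longrightarrow> y \<in> pols R B s n \<and> c \<otimes> s [^] n \<oplus> y \<in> J" unfolding L_def by auto
  then obtain z where z: "\<And>n c. c \<in> L n \<Longrightarrow> z n c \<in> pols R B s n \<and> c \<otimes> s [^] n \<oplus> z n c \<in> J" by metis
  \<comment> \<open>Below \<open>N\<close> each degree needs its own generators \<open>Y n\<close>;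
    at \<open>N\<close> the generators \<open>E\<close> of the union are taken, and they also serve
    all higher degrees.\<close>
  define Z where "Z n = (\<lambda>c. c \<otimes> s [^] n \<oplus> z n c) ` (if n < N then Y n else E)" for n
  define E' where "E' = (\<Union>n\<le>N. Z n)"
  have ZJ: "Z n \<subseteq> J" if "n \<le> N" for n using z Y(2)[of n] N that unfolding Z_def by (auto split: if_splits)
  then have E'J: "E' \<subseteq> J" unfolding E'_def by auto
  have E'f: "finite E'" unfolding E'_def Z_def using E(1) Y(1) by auto
  let ?S = "addspan R {a \<otimes> x | a x. a \<in> ?A \<and> x \<in> E'}"
  have ScR: "{a \<otimes> x | a x. a \<in> ?A \<and> x \<in> E'} \<subseteq> carrier R" using AR E'J JR by auto
  have Sm: "a \<otimes> x \<in> ?S" if "a \<in> ?A" "x \<in> ?S" for a x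
  proof (rule addspan_map[OF abelian_group_axioms ScR that(2) ScR])
    show "a \<otimes> \<zero> = \<zero>" using that AR by auto
    fix x y assume "x \<in> carrier R" "y \<in> carrier R" then show "a \<otimes> (x \<oplus> y) = a \<otimes> x \<oplus> a \<otimes> y" using that AR by
        (auto simp: r_distr)
  next
    fix x assume "x \<in> {a \<otimes> x | a x. a \<in> ?A \<and> x \<in> E'}"
    then obtain c w where x: "x = c \<otimes> w" "c \<in> ?A" "w \<in> E'" by auto
    have "a \<otimes> x = (a \<otimes> c) \<otimes> w" using x that AR E'J JR by (simp add: m_assoc subset_iff)
    moreover have "a \<otimes> c \<in> ?A" using subringE(6)[OF adjoin_subring that(1) x(2)] .
    ultimately show "a \<otimes> x \<in> ?S" using x by (intro addspan_incl[OF _ ScR]) auto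
  qed
  have SJ: "?S \<subseteq> J" by (rule addspan_least) (use Jm E'J J0 Jp in auto)
  have lead: "\<exists>y\<in>pols R B s n. b \<otimes> s [^] n \<oplus> y \<in> ?S" if "b \<in> L n" for b n
  proof (cases "n < N")
    case True
    have "\<exists>y\<in>pols R B s n. b \<otimes> s [^] n \<oplus> y \<in> addspan R {a \<otimes> x | a x. a \<in> ?A \<and> x \<in> Z n}"
    proof (rule lead_reduce[where Y="Y n" and J=J])
      show "\<exists>y\<in>pols R B s n. c \<otimes> s [^] n \<oplus> y \<in> Z n" if "c \<in> Y n" for c
        using z[of c n] Y(2)[of n] True that unfolding Z_def by (intro bexI[of _ "z n c"]) auto
      show "b \<in> addspan R {b \<otimes> x |b x. b \<in> B \<and> x \<in> Y n}" using Y(3) that by blast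
      show "Y n \<subseteq> B" using Y(2) L_B by blast
    qed (use Jp Jm J0 ZJ[of n] True JR in auto)
    moreover have "addspan R {a \<otimes> x | a x. a \<in> ?A \<and> x \<in> Z n} \<subseteq> ?S"
      by (rule addspan_mono) (use True in \<open>auto simp: E'_def intro: less_imp_le\<close>)
    ultimately show ?thesis by blast
  next
    case False
    have "\<exists>y\<in>pols R B s N. b \<otimes> s [^] N \<oplus> y \<in> addspan R {a \<otimes> x | a x. a \<in> ?A \<and> x \<in> Z N}"
    proof (rule lead_reduce[where Y=E and J=J])
      show "\<exists>y\<in>pols R B s N. c \<otimes> s [^] N \<oplus> y \<in> Z N" if "c \<in> E" for c
        using z[of c N] N that unfolding Z_def by (intro bexI[of _ "z N c"]) auto
      show "b \<in> addspan R {b \<otimes> x |b x. b \<in> B \<and> x \<in> E}" using E(3) that by auto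
      show "E \<subseteq> B" using N unfolding L_def by auto
    qed (use Jp Jm J0 ZJ[of N] JR in auto)
    moreover have "addspan R {a \<otimes> x | a x. a \<in> ?A \<and> x \<in> Z N} \<subseteq> ?S"
      by (rule addspan_mono) (auto simp: E'_def)
    ultimately obtain y where y: "y \<in> pols R B s N" "b \<otimes> s [^] N \<oplus> y \<in> ?S" by blast
    have bB: "b \<in> B" using that by (auto simp: L_def)
    have sA: "s [^] k \<in> ?A" for k :: nat
    proof (induction k)
      case 0 show ?case using subringE(3)[OF adjoin_subring] by simp
    next
      case (Suc k) then show ?case using subringE(6)[OF adjoin_subring Suc adjoin_mem] by simp
    qed
    \<comment> \<open>Above degree \<open>N\<close> a lift found in degree \<open>N\<close> is
      multiplied by \<open>s^(n-N)\<close>, which keeps its leading coefficient.\<close>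
    have "s [^] (n - N) \<otimes> (b \<otimes> s [^] N \<oplus> y) = b \<otimes> (s [^] (n - N) \<otimes> s [^] N) \<oplus> s [^] (n - N) \<otimes> y"
      using bB B_carr s pols_carr[OF y(1)] by (simp add: r_distr m_ac)
    also have "s [^] (n - N) \<otimes> s [^] N = s [^] n" using False s by (simp add: nat_pow_mult)
    finally have eq: "s [^] (n - N) \<otimes> (b \<otimes> s [^] N \<oplus> y) = b \<otimes> s [^] n \<oplus> s [^] (n - N) \<otimes> y" .
    have "b \<otimes> s [^] n \<oplus> s [^] (n - N) \<otimes> y \<in> ?S" using Sm[OF sA[of "n - N"] y(2)] unfolding eq .
    moreover have "s [^] (n - N) \<otimes> y \<in> pols R B s n" using pols_shift_pow[OF y(1), of "n - N"] False by simp
    ultimately show ?thesis by blast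
  qed
  \<comment> \<open>Division by the leading term: subtracting an element of \<open>?S\<close> with
    the same leading term lowers the degree and stays in \<open>J\<close>, since \<open>?S\<close>
    is contained in \<open>J\<close>.\<close>
  have main: "y \<in> ?S" if "y \<in> pols R B s n" "y \<in> J" for y n
    using that
  proof (induction n arbitrary: y)
    case 0 then show ?case by (simp add: addspan_zero)
  next
    case (Suc n)
    obtain b u where y: "y = b \<otimes> s [^] n \<oplus> u" "b \<in> B" "u \<in> pols R B s n" using Suc.prems by auto
    then have "b \<in> L n" using Suc.prems unfolding L_def by auto
    then obtain v where v: "v \<in> pols R B s n" "b \<otimes> s [^] n \<oplus> v \<in> ?S" using lead by blast
    have mone: "\<ominus> \<one> \<in> B" using subringE(5)[OF B subringE(3)[OF B]] .
    let ?w = "u \<oplus> (\<ominus> \<one>) \<otimes> v"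
    have w: "?w \<in> pols R B s n" using pols_plus[OF y(3) pols_smult[OF mone v(1)]] .
    have c: "u \<in> carrier R" "v \<in> carrier R" "b \<in> carrier R" "s [^] n \<in> carrier R" using pols_carr y v
        B_carr s by auto
    then have "?w = y \<oplus> (\<ominus> \<one>) \<otimes> (b \<otimes> s [^] n \<oplus> v)" unfolding y(1)
      by (intro sub_add_cancel_common(1)) auto
    moreover have "y \<oplus> (\<ominus> \<one>) \<otimes> (b \<otimes> s [^] n \<oplus> v) \<in> J"
      using Suc.prems(2) SJ v(2) Jm Jp mone adjoin_incl by blast
    ultimately have "?w \<in> ?S" using Suc.IH[OF w] by auto
    then have "?w \<oplus> (b \<otimes> s [^] n \<oplus> v) \<in> ?S" using v(2) addspan_plus[OF ScR] by auto
    moreover have "?w \<oplus> (b \<otimes> s [^] n \<oplus> v) = y" unfolding y(1) using c by (intro sub_add_cancel_common(2)) auto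
    ultimately show ?case by simp
  qed
  have "J \<subseteq> ?S" using main JA unfolding adjoin_def by blast
  then show "\<exists>E. finite E \<and> E \<subseteq> J \<and> J \<subseteq> addspan R {b \<otimes> x |b x. b \<in> ?A \<and> x \<in> E}"
    using E'f E'J by auto
qed

end
end

section \<open>Noetherian modules\<close>

lemma (in abelian_group) r_neg_mid:
  "\<lbrakk>x \<in> carrier G; y \<in> carrier G; z \<in> carrier G\<rbrakk> \<Longrightarrow> x \<oplus> (y \<oplus> (\<ominus> x \<oplus> z)) = y \<oplus> z"
  by (metis a_closed a_inv_closed a_lcomm r_neg2)

lemma (in abelian_group) diff_add_swap:
  assumes "x \<in> carrier G" "y \<in> carrier G" "z \<in> carrier G"
  shows "(y \<oplus> \<ominus> z) \<oplus> (x \<oplus> z) = x \<oplus> y"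
  using assms by (simp add: a_ac r_neg r_neg_mid)

text \<open>A nonzero element of \<open>J\<close> is the image of a nonzero, hence invertible,
  element of the field and generates everything.\<close>

lemma (in cring) noeth_in_field_image:
  assumes "field k" "g \<in> ring_hom k R"
  shows "noeth_in R (g ` carrier k)"
  unfolding noeth_in_def
proof (intro allI impI)
  fix J assume J: "J \<subseteq> g ` carrier k" "\<zero> \<in> J"
  interpret k: field k by fact
  interpret g: ring_hom_ring k R g by (simp add: assms(2) k.ring_axioms ring_axioms ring_hom_ringI2)
  show "\<exists>E. finite E \<and> E \<subseteq> J \<and> J \<subseteq> addspan R {b \<otimes> x |b x. b \<in> g ` carrier k \<and> x \<in> E}"
  proof (cases "J \<subseteq> {\<zero>}")
    case True
    then show ?thesis using addspan_zero[of R] by (intro exI[of _ "{}"]) auto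
  next
    case False
    then obtain x where x: "x \<in> J" "x \<noteq> \<zero>" by auto
    then obtain c where c: "c \<in> carrier k" "x = g c" using J by auto
    have "c \<noteq> \<zero>\<^bsub>k\<^esub>" using c x by auto
    then have cu: "c \<in> Units k" using c k.field_Units by auto
    have "J \<subseteq> addspan R {b \<otimes> x' |b x'. b \<in> g ` carrier k \<and> x' \<in> {x}}"
    proof
      fix z assume "z \<in> J"
      then obtain d where d: "d \<in> carrier k" "z = g d" using J by auto
      have ic: "inv\<^bsub>k\<^esub> c \<in> carrier k" using cu by simp
      have "d = (d \<otimes>\<^bsub>k\<^esub> inv\<^bsub>k\<^esub> c) \<otimes>\<^bsub>k\<^esub> c" using d c cu ic by (simp add: k.m_assoc)
      then have zx: "z = g (d \<otimes>\<^bsub>k\<^esub> inv\<^bsub>k\<^esub> c) \<otimes> x" using d c ic by (metis g.hom_mult k.m_closed)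
      have gc: "g (d \<otimes>\<^bsub>k\<^esub> inv\<^bsub>k\<^esub> c) \<in> g ` carrier k" using d ic by blast
      then show "z \<in> addspan R {b \<otimes> x' |b x'. b \<in> g ` carrier k \<and> x' \<in> {x}}"
        unfolding zx using gc by (intro addspan_incl) (use c in auto)
    qed
    then show ?thesis using x by (intro exI[of _ "{x}"]) auto
  qed
qed

text \<open>An ideal of \<open>R\<close> is generated by its trace on \<open>B\<close>: each of its
  elements has a unit multiple in that trace, and the unit can be divided out again.\<close>

lemma (in cring) noeth_in_localization:
  assumes B: "subring B R" and n: "noeth_in R B"
    and loc: "\<And>r. r \<in> carrier R \<Longrightarrow> \<exists>w\<in>Units R. w \<otimes> r \<in> B"
  shows "noeth_in R (carrier R)"
  unfolding noeth_in_def
proof (intro allI impI)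
  fix J assume J: "J \<subseteq> carrier R" "\<zero> \<in> J" "\<forall>x\<in>J. \<forall>y\<in>J. x \<oplus> y \<in> J" "\<forall>b\<in>carrier R. \<forall>x\<in>J. b \<otimes> x \<in> J"
  have BR: "B \<subseteq> carrier R" using subringE(1)[OF B] .
  have "\<exists>E. finite E \<and> E \<subseteq> J \<inter> B \<and> J \<inter> B \<subseteq> addspan R {b \<otimes> x |b x. b \<in> B \<and> x \<in> E}"
  proof (rule n[unfolded noeth_in_def, rule_format])
    show "J \<inter> B \<subseteq> B" by blast
    show "\<zero> \<in> J \<inter> B" using J(2) subringE(2)[OF B] by blast
    show "x \<oplus> y \<in> J \<inter> B" if "x \<in> J \<inter> B" "y \<in> J \<inter> B" for x y
      using that J(3) subringE(7)[OF B, of x y] by blast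
    show "b \<otimes> x \<in> J \<inter> B" if "b \<in> B" "x \<in> J \<inter> B" for b x
      using that J(4) subringE(6)[OF B, of b x] BR by blast
  qed
  then obtain E where E: "finite E" "E \<subseteq> J \<inter> B" "J \<inter> B \<subseteq> addspan R {b \<otimes> x |b x. b \<in> B \<and> x \<in> E}" by auto
  let ?S = "addspan R {b \<otimes> x |b x. b \<in> carrier R \<and> x \<in> E}"
  have ScR: "{b \<otimes> x |b x. b \<in> carrier R \<and> x \<in> E} \<subseteq> carrier R" using E J by auto
  have "J \<subseteq> ?S"
  proof
    fix r assume r: "r \<in> J"
    then obtain w where w: "w \<in> Units R" "w \<otimes> r \<in> B" using loc[OF subsetD[OF J(1) r]] by blast
    have wr: "w \<otimes> r \<in> J" using w r J(4) Units_closed by blast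
    then have "w \<otimes> r \<in> addspan R {b \<otimes> x |b x. b \<in> B \<and> x \<in> E}" using E w by auto
    then have m: "w \<otimes> r \<in> ?S" using addspan_mono[of "{b \<otimes> x |b x. b \<in> B \<and> x \<in> E}" "{b \<otimes> x |b x. b \<in> carrier
        R \<and> x \<in> E}" R] BR by auto
    have "inv w \<otimes> (w \<otimes> r) \<in> ?S"
    proof (rule addspan_map[OF abelian_group_axioms ScR m ScR])
      fix x assume "x \<in> {b \<otimes> x |b x. b \<in> carrier R \<and> x \<in> E}"
      then obtain b e where x: "x = b \<otimes> e" "b \<in> carrier R" "e \<in> E" by auto
      have "inv w \<otimes> x = (inv w \<otimes> b) \<otimes> e" using x w E J by (auto simp: m_assoc subset_iff)
      then show "inv w \<otimes> x \<in> ?S" using x w by (intro addspan_incl[OF _ ScR]) auto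
    qed (use w in \<open>auto simp: r_distr\<close>)
    moreover have "inv w \<otimes> (w \<otimes> r) = r" using w(1) subsetD[OF J(1) r] Units_closed[OF w(1)]
        Units_inv_closed[OF w(1)]
      by (metis Units_l_inv l_one m_assoc)
    ultimately show "r \<in> ?S" by simp
  qed
  then show "\<exists>E. finite E \<and> E \<subseteq> J \<and> J \<subseteq> addspan R {b \<otimes> x |b x. b \<in> carrier R \<and> x \<in> E}" using E by auto
qed

text \<open>The coefficient set \<open>B\<close> is a parameter because three kinds occur: all of
  \<open>R\<close>, a subalgebra, and the single terms with bounded exponents that define
  gauges.\<close>

definition mspan :: "('a, 'b, 'y) module_scheme \<Rightarrow> 'a set \<Rightarrow> 'b set \<Rightarrow> 'b set" where
  "mspan M B E = addspan M {b \<odot>\<^bsub>M\<^esub> x | b x. b \<in> B \<and> x \<in> E}"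

section \<open>Spans, noetherian modules, and descending chains at a prime\<close>

context module begin

abbreviation rspan where "rspan \<equiv> mspan M (carrier R)"

lemma mspan_gens_closed: "\<lbrakk>B \<subseteq> carrier R; E \<subseteq> carrier M\<rbrakk> \<Longrightarrow> {b \<odot>\<^bsub>M\<^esub> x | b x. b \<in> B \<and> x \<in> E} \<subseteq> carrier M"
  by auto

lemma mspan_closed: "\<lbrakk>B \<subseteq> carrier R; E \<subseteq> carrier M\<rbrakk> \<Longrightarrow> mspan M B E \<subseteq> carrier M"
  unfolding mspan_def by (rule M.addspan_closed[OF mspan_gens_closed])

lemma mspan_zero: "\<zero>\<^bsub>M\<^esub> \<in> mspan M B E"
  unfolding mspan_def by (rule addspan_zero)

lemma mspan_plus: "\<lbrakk>B \<subseteq> carrier R; E \<subseteq> carrier M; x \<in> mspan M B E; y \<in> mspan M B E\<rbrakk> \<Longrightarrow> x \<oplus>\<^bsub>M\<^esub> y \<in> mspan M B E"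
  unfolding mspan_def by (rule M.addspan_plus[OF mspan_gens_closed])

lemma mspan_smult_incl: "\<lbrakk>B \<subseteq> carrier R; E \<subseteq> carrier M; b \<in> B; x \<in> E\<rbrakk> \<Longrightarrow> b \<odot>\<^bsub>M\<^esub> x \<in> mspan M B E"
  unfolding mspan_def by (rule M.addspan_incl) auto

lemma mspan_smult:
  assumes B: "subring B R" and E: "E \<subseteq> carrier M" and a: "a \<in> B" and x: "x \<in> mspan M B E"
  shows "a \<odot>\<^bsub>M\<^esub> x \<in> mspan M B E"
proof -
  have BR: "B \<subseteq> carrier R" using subringE(1)[OF B] .
  show ?thesis unfolding mspan_def
  proof (rule M.addspan_map[OF M.abelian_group_axioms mspan_gens_closed[OF BR E] x[unfolded mspan_def]
      mspan_gens_closed[OF BR E]])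
    fix x assume "x \<in> {b \<odot>\<^bsub>M\<^esub> x | b x. b \<in> B \<and> x \<in> E}"
    then obtain b e where be: "x = b \<odot>\<^bsub>M\<^esub> e" "b \<in> B" "e \<in> E" by auto
    have "a \<odot>\<^bsub>M\<^esub> x = (a \<otimes>\<^bsub>R\<^esub> b) \<odot>\<^bsub>M\<^esub> e" using be a BR E by (simp add: smult_assoc1 subset_iff)
    then show "a \<odot>\<^bsub>M\<^esub> x \<in> addspan M {b \<odot>\<^bsub>M\<^esub> x | b x. b \<in> B \<and> x \<in> E}"
      using mspan_smult_incl[OF BR E subringE(6)[OF B a be(2)] be(3)] unfolding mspan_def by simp
  qed (use a BR in \<open>auto simp: smult_r_distr subset_iff\<close>)
qed

lemma mspan_incl: "\<lbrakk>B \<subseteq> carrier R; \<one>\<^bsub>R\<^esub> \<in> B; E \<subseteq> carrier M; x \<in> E\<rbrakk> \<Longrightarrow> x \<in> mspan M B E"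
  using mspan_smult_incl[of B E "\<one>\<^bsub>R\<^esub>" x] by (auto simp: subset_iff)

lemma mspan_mono: "\<lbrakk>B \<subseteq> C; E \<subseteq> F\<rbrakk> \<Longrightarrow> mspan M B E \<subseteq> mspan M C F"
  unfolding mspan_def by (rule addspan_mono) auto

lemma mspan_least:
  "\<lbrakk>\<And>b x. \<lbrakk>b \<in> B; x \<in> E\<rbrakk> \<Longrightarrow> b \<odot>\<^bsub>M\<^esub> x \<in> H; \<zero>\<^bsub>M\<^esub> \<in> H; \<And>x y. \<lbrakk>x \<in> H; y \<in> H\<rbrakk> \<Longrightarrow> x \<oplus>\<^bsub>M\<^esub> y \<in> H\<rbrakk> \<Longrightarrow> mspan M B E \<subseteq> H"
  unfolding mspan_def by (rule addspan_least) auto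

lemma submodule_zero: "submodule H R M \<Longrightarrow> \<zero>\<^bsub>M\<^esub> \<in> H"
  using subgroup.one_closed[OF submodule.axioms(1)] by force

lemma submodule_if_closed:
  assumes "H \<subseteq> carrier M" "\<zero>\<^bsub>M\<^esub> \<in> H" "\<And>a b. \<lbrakk>a \<in> H; b \<in> H\<rbrakk> \<Longrightarrow> a \<oplus>\<^bsub>M\<^esub> b \<in> H"
    "\<And>a x. \<lbrakk>a \<in> carrier R; x \<in> H\<rbrakk> \<Longrightarrow> a \<odot>\<^bsub>M\<^esub> x \<in> H"
  shows "submodule H R M"
proof (rule submoduleI)
  fix a assume a: "a \<in> H"
  have "(\<ominus>\<^bsub>R\<^esub> \<one>\<^bsub>R\<^esub>) \<odot>\<^bsub>M\<^esub> a = \<ominus>\<^bsub>M\<^esub> a" using a assms(1) by (subst smult_l_minus) auto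
  then show "\<ominus>\<^bsub>M\<^esub> a \<in> H" using assms(4)[of "\<ominus>\<^bsub>R\<^esub> \<one>\<^bsub>R\<^esub>" a] a by simp
qed (use assms in auto)

lemma submodule_mspan: "E \<subseteq> carrier M \<Longrightarrow> submodule (rspan E) R M"
  by (rule submodule_if_closed) (use mspan_closed mspan_zero mspan_plus mspan_smult[OF carrier_is_subring]
      in auto)

lemma mspan_subset_submodule: "\<lbrakk>submodule H R M; E \<subseteq> H\<rbrakk> \<Longrightarrow> rspan E \<subseteq> H"
  by (rule mspan_least) (auto simp: submoduleE submodule_zero)

lemma submodule_Int: "\<lbrakk>submodule H R M; submodule K R M\<rbrakk> \<Longrightarrow> submodule (H \<inter> K) R M"
  by (rule submodule_if_closed) (auto simp: submoduleE submodule_zero dest: subsetD[OF submoduleE(1)])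

lemma submodule_diff: "\<lbrakk>submodule H R M; x \<in> H; y \<in> H\<rbrakk> \<Longrightarrow> x \<oplus>\<^bsub>M\<^esub> \<ominus>\<^bsub>M\<^esub> y \<in> H"
  using submoduleE(3,5)[of H] by blast

lemma mspan_insertE:
  assumes "insert g E \<subseteq> carrier M" "x \<in> rspan (insert g E)"
  obtains a y where "a \<in> carrier R" "y \<in> rspan E" "x = a \<odot>\<^bsub>M\<^esub> g \<oplus>\<^bsub>M\<^esub> y"
proof -
  let ?H = "{a \<odot>\<^bsub>M\<^esub> g \<oplus>\<^bsub>M\<^esub> y | a y. a \<in> carrier R \<and> y \<in> rspan E}"
  have g: "g \<in> carrier M" and E: "E \<subseteq> carrier M" using assms(1) by auto
  note c = subsetD[OF mspan_closed[OF order_refl E]]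
  have "rspan (insert g E) \<subseteq> ?H"
  proof (rule mspan_least)
    fix b x assume b: "b \<in> carrier R" "x \<in> insert g E"
    show "b \<odot>\<^bsub>M\<^esub> x \<in> ?H"
    proof (cases "x = g")
      case True
      then have "b \<odot>\<^bsub>M\<^esub> x = b \<odot>\<^bsub>M\<^esub> g \<oplus>\<^bsub>M\<^esub> \<zero>\<^bsub>M\<^esub>" using b g by simp
      then show ?thesis using b mspan_zero by blast
    next
      case False
      then have xE: "x \<in> E" using b by simp
      then have "b \<odot>\<^bsub>M\<^esub> x = \<zero>\<^bsub>R\<^esub> \<odot>\<^bsub>M\<^esub> g \<oplus>\<^bsub>M\<^esub> b \<odot>\<^bsub>M\<^esub> x" using b g E by (simp add: subset_iff)
      then show ?thesis using R.zero_closed mspan_smult_incl[OF order_refl E b(1) xE] by blast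
    qed
  next
    have "\<zero>\<^bsub>M\<^esub> = \<zero>\<^bsub>R\<^esub> \<odot>\<^bsub>M\<^esub> g \<oplus>\<^bsub>M\<^esub> \<zero>\<^bsub>M\<^esub>" using g by simp
    then show "\<zero>\<^bsub>M\<^esub> \<in> ?H" using R.zero_closed mspan_zero by blast
  next
    fix x y assume "x \<in> ?H" "y \<in> ?H"
    then obtain a u b v where h: "x = a \<odot>\<^bsub>M\<^esub> g \<oplus>\<^bsub>M\<^esub> u" "y = b \<odot>\<^bsub>M\<^esub> g \<oplus>\<^bsub>M\<^esub> v" "a \<in> carrier R" "b \<in> carrier R"
      "u \<in> rspan E" "v \<in> rspan E" by auto
    have "x \<oplus>\<^bsub>M\<^esub> y = (a \<oplus>\<^bsub>R\<^esub> b) \<odot>\<^bsub>M\<^esub> g \<oplus>\<^bsub>M\<^esub> (u \<oplus>\<^bsub>M\<^esub> v)"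
      using h g c by (simp add: smult_l_distr M.a_ac)
    then show "x \<oplus>\<^bsub>M\<^esub> y \<in> ?H" using mspan_plus[OF order_refl E h(5,6)] h by blast
  qed
  then show ?thesis using assms(2) that by blast
qed

text \<open>Induction on the number of generators. The coefficients of \<open>g\<close> in elements
  of \<open>H\<close> form an ideal \<open>J\<close>; lifts of its generators together with
  generators of the part of \<open>H\<close> inside the span of the other generators generate
  \<open>H\<close>.\<close>

lemma noetherian_submodule:
  assumes n: "noeth_in R (carrier R)" and "finite E" "E \<subseteq> carrier M"
    and "submodule H R M" "H \<subseteq> rspan E"
  shows "\<exists>F. finite F \<and> F \<subseteq> H \<and> H = rspan F"
  using assms(2-)
proof (induction E arbitrary: H rule: finite_induct)
  case empty
  have "rspan {} \<subseteq> {\<zero>\<^bsub>M\<^esub>}" by (rule mspan_least) auto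
  then have "H = {\<zero>\<^bsub>M\<^esub>}" using empty submodule_zero[of H] by blast
  moreover have "rspan {} = {\<zero>\<^bsub>M\<^esub>}"
    using \<open>rspan {} \<subseteq> {\<zero>\<^bsub>M\<^esub>}\<close> mspan_zero by blast
  ultimately show ?case by (intro exI[of _ "{}"]) auto
next
  case (insert g E)
  have g: "g \<in> carrier M" and E: "E \<subseteq> carrier M" using insert.prems by auto
  let ?S = "rspan E"
  note c = subsetD[OF mspan_closed[OF order_refl E]]
  have S: "submodule ?S R M" using submodule_mspan[OF E] .
  note H = submoduleE[OF insert.prems(2)]
  define J where "J = {a \<in> carrier R. \<exists>y\<in>?S. a \<odot>\<^bsub>M\<^esub> g \<oplus>\<^bsub>M\<^esub> y \<in> H}"
  have "\<exists>E. finite E \<and> E \<subseteq> J \<and> J \<subseteq> addspan R {b \<otimes>\<^bsub>R\<^esub> x |b x. b \<in> carrier R \<and> x \<in> E}"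
  proof (rule n[unfolded noeth_in_def, rule_format])
    show "J \<subseteq> carrier R" unfolding J_def by auto
    show "\<zero>\<^bsub>R\<^esub> \<in> J" unfolding J_def using g mspan_zero submodule_zero[OF insert.prems(2)]
      by (auto intro!: bexI[of _ "\<zero>\<^bsub>M\<^esub>"])
  next
    fix x y assume xy: "x \<in> J" "y \<in> J"
    then obtain u v where uv: "u \<in> ?S" "x \<odot>\<^bsub>M\<^esub> g \<oplus>\<^bsub>M\<^esub> u \<in> H" "v \<in> ?S" "y \<odot>\<^bsub>M\<^esub> g \<oplus>\<^bsub>M\<^esub> v \<in> H"
      "x \<in> carrier R" "y \<in> carrier R" unfolding J_def by auto
    have "(x \<oplus>\<^bsub>R\<^esub> y) \<odot>\<^bsub>M\<^esub> g \<oplus>\<^bsub>M\<^esub> (u \<oplus>\<^bsub>M\<^esub> v) = (x \<odot>\<^bsub>M\<^esub> g \<oplus>\<^bsub>M\<^esub> u) \<oplus>\<^bsub>M\<^esub> (y \<odot>\<^bsub>M\<^esub> g \<oplus>\<^bsub>M\<^esub> v)"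
      using uv g c by (simp add: smult_l_distr M.a_ac)
    then show "x \<oplus>\<^bsub>R\<^esub> y \<in> J" unfolding J_def
      using uv H(5)[OF uv(2,4)] submoduleE(5)[OF S uv(1,3)] by (auto intro!: bexI[of _ "u \<oplus>\<^bsub>M\<^esub> v"])
  next
    fix b x assume b: "b \<in> carrier R" and x: "x \<in> J"
    then obtain u where u: "u \<in> ?S" "x \<odot>\<^bsub>M\<^esub> g \<oplus>\<^bsub>M\<^esub> u \<in> H" "x \<in> carrier R" unfolding J_def by auto
    have "(b \<otimes>\<^bsub>R\<^esub> x) \<odot>\<^bsub>M\<^esub> g \<oplus>\<^bsub>M\<^esub> b \<odot>\<^bsub>M\<^esub> u = b \<odot>\<^bsub>M\<^esub> (x \<odot>\<^bsub>M\<^esub> g \<oplus>\<^bsub>M\<^esub> u)"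
      using u g c b by (simp add: smult_r_distr smult_assoc1)
    then show "b \<otimes>\<^bsub>R\<^esub> x \<in> J" unfolding J_def
      using u H(4)[OF b u(2)] submoduleE(4)[OF S b u(1)] b by (auto intro!: bexI[of _ "b \<odot>\<^bsub>M\<^esub> u"])
  qed
  then obtain E0 where E0: "finite E0" "E0 \<subseteq> J" "J \<subseteq> addspan R {b \<otimes>\<^bsub>R\<^esub> x |b x. b \<in> carrier R \<and> x \<in> E0}" by auto
  have "\<forall>x\<in>J. \<exists>y\<in>?S. x \<odot>\<^bsub>M\<^esub> g \<oplus>\<^bsub>M\<^esub> y \<in> H" unfolding J_def by auto
  then obtain z where z: "\<And>x. x \<in> J \<Longrightarrow> z x \<in> ?S \<and> x \<odot>\<^bsub>M\<^esub> g \<oplus>\<^bsub>M\<^esub> z x \<in> H" by metis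
  have "\<exists>F. finite F \<and> F \<subseteq> H \<inter> ?S \<and> H \<inter> ?S = rspan F"
    using insert.IH[OF E submodule_Int[OF insert.prems(2) S]] by auto
  then obtain F where F: "finite F" "F \<subseteq> H \<inter> ?S" "H \<inter> ?S = rspan F" by auto
  define E1 where "E1 = (\<lambda>x. x \<odot>\<^bsub>M\<^esub> g \<oplus>\<^bsub>M\<^esub> z x) ` E0 \<union> F"
  have E1: "finite E1" "E1 \<subseteq> H" using F E0 z unfolding E1_def by auto
  have E1c: "E1 \<subseteq> carrier M" using E1 H(1) by auto
  have T: "submodule (rspan E1) R M" using submodule_mspan[OF E1c] .
  have J: "\<exists>y\<in>?S. a \<odot>\<^bsub>M\<^esub> g \<oplus>\<^bsub>M\<^esub> y \<in> rspan E1" if "a \<in> J" for a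
  proof -
    have E0R: "{b \<otimes>\<^bsub>R\<^esub> x |b x. b \<in> carrier R \<and> x \<in> E0} \<subseteq> carrier R" using E0 unfolding J_def by auto
    have "a \<in> addspan R {b \<otimes>\<^bsub>R\<^esub> x |b x. b \<in> carrier R \<and> x \<in> E0}" using that E0 by auto
    then show ?thesis
    proof induction
      case addspan_zero then show ?case using g mspan_zero by (auto intro!: bexI[of _ "\<zero>\<^bsub>M\<^esub>"])
    next
      case (addspan_add v w)
      obtain b e where be: "v = b \<otimes>\<^bsub>R\<^esub> e" "b \<in> carrier R" "e \<in> E0" using addspan_add by auto
      obtain y where y: "y \<in> ?S" "w \<odot>\<^bsub>M\<^esub> g \<oplus>\<^bsub>M\<^esub> y \<in> rspan E1" using addspan_add by auto
      have w: "w \<in> carrier R" using addspan_add(2) R.addspan_closed[OF E0R] by auto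
      have "e \<in> J" using be E0 by auto
      then have ze: "z e \<in> ?S" "e \<in> carrier R" using z unfolding J_def by auto
      have "e \<odot>\<^bsub>M\<^esub> g \<oplus>\<^bsub>M\<^esub> z e \<in> rspan E1"
        by (rule mspan_incl[OF _ _ E1c]) (use be in \<open>auto simp: E1_def\<close>)
      then have "b \<odot>\<^bsub>M\<^esub> (e \<odot>\<^bsub>M\<^esub> g \<oplus>\<^bsub>M\<^esub> z e) \<oplus>\<^bsub>M\<^esub> (w \<odot>\<^bsub>M\<^esub> g \<oplus>\<^bsub>M\<^esub> y) \<in> rspan E1"
        using submoduleE(4,5)[OF T] be y by blast
      moreover have "b \<odot>\<^bsub>M\<^esub> (e \<odot>\<^bsub>M\<^esub> g \<oplus>\<^bsub>M\<^esub> z e) \<oplus>\<^bsub>M\<^esub> (w \<odot>\<^bsub>M\<^esub> g \<oplus>\<^bsub>M\<^esub> y) = (v \<oplus>\<^bsub>R\<^esub> w) \<odot>\<^bsub>M\<^esub> g \<oplus>\<^bsub>M\<^esub> (b \<odot>\<^bsub>M\<^esub> z e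
          \<oplus>\<^bsub>M\<^esub> y)"
        using be w ze y g c by (simp add: smult_r_distr smult_assoc1 smult_l_distr M.a_ac)
      moreover have "b \<odot>\<^bsub>M\<^esub> z e \<oplus>\<^bsub>M\<^esub> y \<in> ?S" using submoduleE(4,5)[OF S] be ze y by blast
      ultimately show ?case by metis
    qed
  qed
  have "H \<subseteq> rspan E1"
  proof
    fix x assume x: "x \<in> H"
    then have "x \<in> rspan (insert g E)" using insert.prems by auto
    then obtain a y where ay: "a \<in> carrier R" "y \<in> ?S" "x = a \<odot>\<^bsub>M\<^esub> g \<oplus>\<^bsub>M\<^esub> y"
      using mspan_insertE[OF insert.prems(1)] by blast
    then have "a \<in> J" unfolding J_def using x by auto
    then obtain y' where y': "y' \<in> ?S" "a \<odot>\<^bsub>M\<^esub> g \<oplus>\<^bsub>M\<^esub> y' \<in> rspan E1" using J by blast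
    have y'H: "a \<odot>\<^bsub>M\<^esub> g \<oplus>\<^bsub>M\<^esub> y' \<in> H" using y'(2) mspan_subset_submodule[OF insert.prems(2) E1(2)] by auto
    have cc: "a \<odot>\<^bsub>M\<^esub> g \<in> carrier M" "y \<in> carrier M" "y' \<in> carrier M" using ay g y' c by auto
    have eq: "y \<oplus>\<^bsub>M\<^esub> \<ominus>\<^bsub>M\<^esub> y' = x \<oplus>\<^bsub>M\<^esub> \<ominus>\<^bsub>M\<^esub> (a \<odot>\<^bsub>M\<^esub> g \<oplus>\<^bsub>M\<^esub> y')"
      unfolding ay(3) using cc by (simp add: M.minus_add M.a_ac M.r_neg_mid M.r_neg)
    have "y \<oplus>\<^bsub>M\<^esub> \<ominus>\<^bsub>M\<^esub> y' \<in> H \<inter> ?S"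
      using submodule_diff[OF insert.prems(2) x y'H] submodule_diff[OF S ay(2) y'(1)] eq by auto
    then have "y \<oplus>\<^bsub>M\<^esub> \<ominus>\<^bsub>M\<^esub> y' \<in> rspan F" using F by auto
    then have d: "y \<oplus>\<^bsub>M\<^esub> \<ominus>\<^bsub>M\<^esub> y' \<in> rspan E1"
      using mspan_mono[of "carrier R" "carrier R" F E1] unfolding E1_def by auto
    have "x = (y \<oplus>\<^bsub>M\<^esub> \<ominus>\<^bsub>M\<^esub> y') \<oplus>\<^bsub>M\<^esub> (a \<odot>\<^bsub>M\<^esub> g \<oplus>\<^bsub>M\<^esub> y')" unfolding ay(3) using M.diff_add_swap[OF cc] by simp
    then show "x \<in> rspan E1" using submoduleE(5)[OF T d y'(2)] by simp
  qed
  then show ?case using E1 mspan_subset_submodule[OF insert.prems(2) E1(2)] by blast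
qed

text \<open>At \<open>P\<close> the element \<open>y\<close> is invertible and, by the last
  hypothesis, \<open>P\<close> sends the whole span into every \<open>G n\<close>. Modulo the
  intersection of the chain one is therefore in a finite-dimensional vector space over the residue
  field, where descending chains stop. It is applied to an associated prime in the stabilization of
  \<open>cp t\<close>, and to the zero ideal of \<open>k\<close> for gauges.\<close>

lemma chain_generically_stable:
  assumes P: "primeideal P R" and y: "y \<in> carrier R" "y \<notin> P" and "finite E" "E \<subseteq> carrier M"
    and "\<And>n. submodule (G n) R M" "\<And>n. G (Suc n) \<subseteq> G n" "\<And>n. G n \<subseteq> rspan E"
    and "\<And>a x n. \<lbrakk>a \<in> P; x \<in> rspan E\<rbrakk> \<Longrightarrow> (y \<otimes>\<^bsub>R\<^esub> a) \<odot>\<^bsub>M\<^esub> x \<in> G n"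
  shows "\<exists>n0. \<forall>n\<ge>n0. \<exists>s\<in>carrier R - P. \<forall>x\<in>G n. s \<odot>\<^bsub>M\<^esub> x \<in> G (Suc n)"
  using assms(4-)
proof (induction E arbitrary: G rule: finite_induct)
  case empty
  interpret primeideal P R by fact
  have "\<one>\<^bsub>R\<^esub> \<notin> P" using I_notcarr one_imp_carrier by auto
  have "rspan {} \<subseteq> {\<zero>\<^bsub>M\<^esub>}" by (rule mspan_least) auto
  then have "\<one>\<^bsub>R\<^esub> \<odot>\<^bsub>M\<^esub> x \<in> G (Suc n)" if "x \<in> G n" for x n
    using that empty(4)[of n] submodule_zero[OF empty(2)[of "Suc n"]] by auto
  then show ?case using \<open>\<one>\<^bsub>R\<^esub> \<notin> P\<close> by blast
next
  case (insert g E)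
  interpret P: primeideal P R by fact
  have g: "g \<in> carrier M" and E: "E \<subseteq> carrier M" using insert.prems by auto
  let ?S = "rspan E"
  have S: "submodule ?S R M" using submodule_mspan[OF E] .
  note c = subsetD[OF mspan_closed[OF order_refl E]]
  note G = submoduleE[OF insert.prems(2)]
  have mono: "?S \<subseteq> rspan (insert g E)" by (rule mspan_mono) auto
  have "\<exists>n0. \<forall>n\<ge>n0. \<exists>s\<in>carrier R - P. \<forall>x\<in>G n \<inter> ?S. s \<odot>\<^bsub>M\<^esub> x \<in> G (Suc n) \<inter> ?S"
  proof (rule insert.IH[OF E])
    show "submodule (G n \<inter> ?S) R M" for n by (rule submodule_Int[OF insert.prems(2) S])
    show "G (Suc n) \<inter> ?S \<subseteq> G n \<inter> ?S" for n using insert.prems(3) by blast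
    show "G n \<inter> ?S \<subseteq> ?S" for n by blast
    show "(y \<otimes>\<^bsub>R\<^esub> a) \<odot>\<^bsub>M\<^esub> x \<in> G n \<inter> ?S" if "a \<in> P" "x \<in> ?S" for a x n
      using insert.prems(5)[OF that(1) subsetD[OF mono that(2)]] submoduleE(4)[OF S _ that(2), of "y \<otimes>\<^bsub>R\<^esub>
          a"] y P.Icarr[OF that(1)] by auto
  qed
  then obtain n1 where n1: "\<And>n. n \<ge> n1 \<Longrightarrow> \<exists>s\<in>carrier R - P. \<forall>x\<in>G n \<inter> ?S. s \<odot>\<^bsub>M\<^esub> x \<in> G (Suc n) \<inter> ?S" by auto
  define J where "J n = {a \<in> carrier R. \<exists>u\<in>?S. a \<odot>\<^bsub>M\<^esub> g \<oplus>\<^bsub>M\<^esub> u \<in> G n}" for n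
  have Jdec: "J (Suc n) \<subseteq> J n" for n unfolding J_def using insert.prems(3) by blast
  \<comment> \<open>Over the residue field the possible coefficients of \<open>g\<close> form a
    subspace of a line: either zero from some stage on, or the whole line at every stage.\<close>
  show ?case
  proof (cases "\<exists>n. J n \<subseteq> P")
    case True
    then obtain n2 where n2: "J n2 \<subseteq> P" by auto
    have Jle: "J n \<subseteq> P" if "n \<ge> n2" for n
      using lift_Suc_antimono_le[of J n2 n] Jdec that n2 by auto
    show ?thesis
    proof (intro exI[of _ "max n1 n2"] allI impI)
      fix n assume n: "max n1 n2 \<le> n"
      obtain s where s: "s \<in> carrier R - P" "\<forall>x\<in>G n \<inter> ?S. s \<odot>\<^bsub>M\<^esub> x \<in> G (Suc n) \<inter> ?S" using n1 n by auto
      have "(s \<otimes>\<^bsub>R\<^esub> y) \<odot>\<^bsub>M\<^esub> x \<in> G (Suc n)" if x: "x \<in> G n" for x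
      proof -
        have "x \<in> rspan (insert g E)" using insert.prems(4) x by auto
        then obtain a u where au: "a \<in> carrier R" "u \<in> ?S" "x = a \<odot>\<^bsub>M\<^esub> g \<oplus>\<^bsub>M\<^esub> u"
          using mspan_insertE[OF insert.prems(1)] by blast
        then have aP: "a \<in> P" using Jle n x unfolding J_def by auto
        have gs: "g \<in> rspan (insert g E)" by (rule mspan_incl) (use insert.prems in auto)
        have cc: "a \<odot>\<^bsub>M\<^esub> g \<in> carrier M" "u \<in> carrier M" "s \<in> carrier R" using au g c s by auto
        have ya: "y \<odot>\<^bsub>M\<^esub> (a \<odot>\<^bsub>M\<^esub> g) \<in> G m" for m
          using insert.prems(5)[OF aP gs, of m] y au g by (simp add: smult_assoc1)
        have "y \<odot>\<^bsub>M\<^esub> u = y \<odot>\<^bsub>M\<^esub> x \<oplus>\<^bsub>M\<^esub> \<ominus>\<^bsub>M\<^esub> (y \<odot>\<^bsub>M\<^esub> (a \<odot>\<^bsub>M\<^esub> g))"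
          unfolding au(3) using cc y by (simp add: smult_r_distr M.a_ac M.r_neg M.r_neg1 M.r_neg2)
        then have "y \<odot>\<^bsub>M\<^esub> u \<in> G n \<inter> ?S"
          using submodule_diff[OF insert.prems(2) G(4)[OF y(1) x] ya] submoduleE(4)[OF S y(1) au(2)] by simp
        then have "s \<odot>\<^bsub>M\<^esub> (y \<odot>\<^bsub>M\<^esub> u) \<in> G (Suc n)" using s by auto
        moreover have "s \<odot>\<^bsub>M\<^esub> (y \<odot>\<^bsub>M\<^esub> (a \<odot>\<^bsub>M\<^esub> g)) \<in> G (Suc n)" using G(4)[OF cc(3) ya] .
        ultimately have "s \<odot>\<^bsub>M\<^esub> (y \<odot>\<^bsub>M\<^esub> (a \<odot>\<^bsub>M\<^esub> g)) \<oplus>\<^bsub>M\<^esub> s \<odot>\<^bsub>M\<^esub> (y \<odot>\<^bsub>M\<^esub> u) \<in> G (Suc n)" using G(5) by blast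
        then show ?thesis unfolding au(3) using cc y by (simp add: smult_r_distr smult_assoc1)
      qed
      moreover have "s \<otimes>\<^bsub>R\<^esub> y \<in> carrier R - P" using s y P.I_prime by auto
      ultimately show "\<exists>s\<in>carrier R - P. \<forall>x\<in>G n. s \<odot>\<^bsub>M\<^esub> x \<in> G (Suc n)" by blast
    qed
  next
    case False
    show ?thesis
    proof (intro exI[of _ n1] allI impI)
      fix n assume n: "n1 \<le> n"
      obtain s where s: "s \<in> carrier R - P" "\<forall>x\<in>G n \<inter> ?S. s \<odot>\<^bsub>M\<^esub> x \<in> G (Suc n) \<inter> ?S" using n1 n by auto
      obtain b where b: "b \<in> J (Suc n)" "b \<notin> P" using False by blast
      then obtain v where v: "v \<in> ?S" "b \<odot>\<^bsub>M\<^esub> g \<oplus>\<^bsub>M\<^esub> v \<in> G (Suc n)" and bc: "b \<in> carrier R" unfolding J_def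
          by auto
      have "(s \<otimes>\<^bsub>R\<^esub> b) \<odot>\<^bsub>M\<^esub> x \<in> G (Suc n)" if x: "x \<in> G n" for x
      proof -
        have "x \<in> rspan (insert g E)" using insert.prems(4) x by auto
        then obtain a u where au: "a \<in> carrier R" "u \<in> ?S" "x = a \<odot>\<^bsub>M\<^esub> g \<oplus>\<^bsub>M\<^esub> u"
          using mspan_insertE[OF insert.prems(1)] by blast
        have cc: "u \<in> carrier M" "v \<in> carrier M" "s \<in> carrier R" using au g c s v by auto
        define h where "h = b \<odot>\<^bsub>M\<^esub> g \<oplus>\<^bsub>M\<^esub> v"
        have hc: "h \<in> carrier M" using cc bc g unfolding h_def by simp
        have hG: "h \<in> G (Suc n)" using v unfolding h_def by simp
        \<comment> \<open>Cross-multiplication: \<open>b x - a h\<close> has no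
          \<open>g\<close>-component and equals \<open>?w\<close>, so it falls under the induction
          hypothesis for the remaining generators.\<close>
        let ?w = "b \<odot>\<^bsub>M\<^esub> u \<oplus>\<^bsub>M\<^esub> \<ominus>\<^bsub>M\<^esub> (a \<odot>\<^bsub>M\<^esub> v)"
        have wS: "?w \<in> ?S" using submodule_diff[OF S] submoduleE(4)[OF S] bc au v by blast
        have swap: "b \<odot>\<^bsub>M\<^esub> (a \<odot>\<^bsub>M\<^esub> g) = a \<odot>\<^bsub>M\<^esub> (b \<odot>\<^bsub>M\<^esub> g)" using bc au g by (simp add:
            smult_assoc1[symmetric] R.m_comm)
        have eq: "b \<odot>\<^bsub>M\<^esub> x = a \<odot>\<^bsub>M\<^esub> h \<oplus>\<^bsub>M\<^esub> ?w"
          unfolding au(3) h_def using cc bc au(1) g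
          by (simp add: smult_r_distr swap M.a_ac M.r_neg_mid)
        then have "?w = b \<odot>\<^bsub>M\<^esub> x \<oplus>\<^bsub>M\<^esub> \<ominus>\<^bsub>M\<^esub> (a \<odot>\<^bsub>M\<^esub> h)" using hc cc bc au(1) g by (simp add: M.a_ac M.r_neg_mid)
        moreover have "h \<in> G n" using hG insert.prems(3) by auto
        ultimately have "?w \<in> G n" using submodule_diff[OF insert.prems(2) G(4)[OF bc x] G(4)[OF au(1)]] by simp
        then have "s \<odot>\<^bsub>M\<^esub> ?w \<in> G (Suc n)" using s wS by auto
        moreover have "s \<odot>\<^bsub>M\<^esub> (a \<odot>\<^bsub>M\<^esub> h) \<in> G (Suc n)" using G(4)[OF cc(3) G(4)[OF au(1) hG]] .
        ultimately have "s \<odot>\<^bsub>M\<^esub> (a \<odot>\<^bsub>M\<^esub> h) \<oplus>\<^bsub>M\<^esub> s \<odot>\<^bsub>M\<^esub> ?w \<in> G (Suc n)" using G(5) by blast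
        then have "s \<odot>\<^bsub>M\<^esub> (b \<odot>\<^bsub>M\<^esub> x) \<in> G (Suc n)" unfolding eq using cc bc au(1) hc by (simp add: smult_r_distr)
        then show ?thesis using cc bc x G(1) by (simp add: smult_assoc1 subset_iff)
      qed
      moreover have "s \<otimes>\<^bsub>R\<^esub> b \<in> carrier R - P" using s b bc P.I_prime by auto
      ultimately show "\<exists>s\<in>carrier R - P. \<forall>x\<in>G n. s \<odot>\<^bsub>M\<^esub> x \<in> G (Suc n)" by blast
    qed
  qed
qed

lemma fin_gen_mspan:
  assumes "fin_gen R M"
  obtains E where "finite E" "E \<subseteq> carrier M" "rspan E = carrier M"
proof -
  obtain B where B: "finite B" "B \<subseteq> carrier M" "\<And>N. \<lbrakk>submodule N R M; B \<subseteq> N\<rbrakk> \<Longrightarrow> N = carrier M"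
    using assms unfolding fin_gen_def by auto
  have "rspan B = carrier M"
    by (rule B(3)[OF submodule_mspan[OF B(2)]]) (use B mspan_incl[OF order_refl] in auto)
  then show ?thesis using that B by blast
qed

end

section \<open>Cartier submodules and stabilization\<close>

context cring begin

lemma ideal_if_closed:
  assumes "I \<subseteq> carrier R" "\<zero> \<in> I" "\<And>x y. \<lbrakk>x \<in> I; y \<in> I\<rbrakk> \<Longrightarrow> x \<oplus> y \<in> I"
    "\<And>a x. \<lbrakk>a \<in> carrier R; x \<in> I\<rbrakk> \<Longrightarrow> a \<otimes> x \<in> I"
  shows "ideal I R"
proof (rule idealI)
  show "ring R" by (rule ring_axioms)
  show "subgroup I (add_monoid R)"
  proof (rule add.subgroupI)
    show "\<ominus> a \<in> I" if "a \<in> I" for a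
      using assms(4)[of "\<ominus> \<one>" a] that assms(1) by (auto simp: l_minus subset_iff)
  qed (use assms in auto)
  show "x \<otimes> a \<in> I" if "a \<in> I" "x \<in> carrier R" for a x using assms(4) that by blast
  then show "a \<otimes> x \<in> I" if "a \<in> I" "x \<in> carrier R" for a x
    using that assms(1) m_comm[of a x] by (auto simp: subset_iff)
qed

lemma noeth_ideal_chain:
  assumes n: "noeth_in R (carrier R)" and I: "\<And>n. ideal (I n) R" and inc: "\<And>n. I n \<subseteq> I (Suc n)"
  shows "\<exists>n0. \<forall>n\<ge>n0. I n = I n0"
proof -
  have mono: "m \<le> n \<Longrightarrow> I m \<subseteq> I n" for m n
    by (rule lift_Suc_mono_le[of I]) (use inc in auto)
  have Icl: "I n \<subseteq> carrier R" for n using ideal.Icarr[OF I] by blast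
  have "\<exists>E. finite E \<and> E \<subseteq> (\<Union>n. I n) \<and> (\<Union>n. I n) \<subseteq> addspan R {b \<otimes> x |b x. b \<in> carrier R \<and> x \<in> E}"
  proof (rule n[unfolded noeth_in_def, rule_format])
    show "(\<Union>n. I n) \<subseteq> carrier R" using Icl by blast
    show "\<zero> \<in> (\<Union>n. I n)" using additive_subgroup.zero_closed[OF ideal.axioms(1)[OF I]] by blast
  next
    fix x y assume "x \<in> (\<Union>n. I n)" "y \<in> (\<Union>n. I n)"
    then obtain m n where "x \<in> I m" "y \<in> I n" by blast
    then have "x \<in> I (max m n)" "y \<in> I (max m n)" using mono[of m "max m n"] mono[of n "max m n"] by auto
    then show "x \<oplus> y \<in> (\<Union>n. I n)" using additive_subgroup.a_closed[OF ideal.axioms(1)[OF I]] by blast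
  next
    fix b x assume "b \<in> carrier R" "x \<in> (\<Union>n. I n)"
    then show "b \<otimes> x \<in> (\<Union>n. I n)" using ideal.I_l_closed[OF I] by blast
  qed
  then obtain E where E: "finite E" "E \<subseteq> (\<Union>n. I n)" "(\<Union>n. I n) \<subseteq> addspan R {b \<otimes> x |b x. b \<in> carrier R \<and> x \<in>
      E}" by blast
  have "\<exists>N. E \<subseteq> I N" using E(1,2)
  proof (induction E rule: finite_induct)
    case (insert x F)
    then obtain m n where "x \<in> I m" "F \<subseteq> I n" by auto
    then show ?case using mono[of m "max m n"] mono[of n "max m n"] by (intro exI[of _ "max m n"]) auto
  qed auto
  then obtain N where N: "E \<subseteq> I N" by blast
  have "addspan R {b \<otimes> x |b x. b \<in> carrier R \<and> x \<in> E} \<subseteq> I N"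
    by (rule addspan_least)
       (use N ideal.I_l_closed[OF I[of N]] additive_subgroup.zero_closed[OF ideal.axioms(1)[OF I[of N]]]
            additive_subgroup.a_closed[OF ideal.axioms(1)[OF I[of N]]] in blast)+
  then have "I n \<subseteq> I N" for n using E(3) by blast
  then show ?thesis using mono by (intro exI[of _ N]) blast
qed

lemma noeth_maximal_ideal:
  assumes n: "noeth_in R (carrier R)" and S: "\<And>I. I \<in> S \<Longrightarrow> ideal I R" and I0: "I0 \<in> S"
  shows "\<exists>I\<in>S. \<forall>J\<in>S. I \<subseteq> J \<longrightarrow> J = I"
proof (rule ccontr)
  assume "\<not> ?thesis"
  then have ex: "\<forall>I\<in>S. \<exists>J\<in>S. I \<subset> J" by blast
  have "\<exists>g. \<forall>n. (g n \<in> S) \<and> (g n \<subset> g (Suc n))"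
    by (rule dependent_nat_choice) (use I0 ex in auto)
  then obtain g where g: "\<And>n. g n \<in> S" "\<And>n. g n \<subset> g (Suc n)" by blast
  obtain n0 where n0: "\<And>n. n \<ge> n0 \<Longrightarrow> g n = g n0"
    using noeth_ideal_chain[OF n, of g] S g by blast
  show False using g(2)[of n0] n0[of "Suc n0"] by auto
qed

end

definition fexp :: "nat \<Rightarrow> rat \<Rightarrow> nat \<Rightarrow> nat" where
  "fexp p t e = nat \<lceil>t * of_nat (p ^ e)\<rceil>"

text \<open>The right-hand side is the exponent of \<open>f\<close> in a composite of operators of
  degrees \<open>e\<close> and \<open>e'\<close>; since it is large enough, the surplus can be moved
  into the ring coefficient and the operators are closed under composition.\<close>

lemma fexp_add: "fexp p t (e + e') \<le> fexp p t e * p ^ e' + fexp p t e'"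
proof -
  have "t * of_nat (p ^ (e + e')) = (t * of_nat (p ^ e)) * of_nat (p ^ e')" by (simp add: power_add)
  also have "\<dots> \<le> of_int \<lceil>t * of_nat (p ^ e)\<rceil> * of_nat (p ^ e')"
    by (intro mult_right_mono le_of_int_ceiling) auto
  also have "\<dots> = of_int (\<lceil>t * of_nat (p ^ e)\<rceil> * int (p ^ e'))" by simp
  finally have "\<lceil>t * of_nat (p ^ (e + e'))\<rceil> \<le> \<lceil>t * of_nat (p ^ e)\<rceil> * int (p ^ e')"
    by (simp only: ceiling_le_iff)
  then have "nat \<lceil>t * of_nat (p ^ (e + e'))\<rceil> \<le> nat (\<lceil>t * of_nat (p ^ e)\<rceil> * int (p ^ e'))"
    by (rule nat_mono)
  also have "\<dots> = fexp p t e * p ^ e'"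
    by (subst mult.commute, subst nat_mult_distrib) (auto simp: fexp_def mult.commute nat_power_eq)
  finally show ?thesis unfolding fexp_def by simp
qed

section \<open>Operators of the Cartier algebra and the submodules stable under them\<close>

locale cartier = module R M for R (structure) and M (structure) +
  fixes p :: nat and \<kappa> and f
  assumes p2: "p \<ge> 2" and f_closed [simp, intro]: "f \<in> carrier R"
    and \<kappa>_closed: "m \<in> carrier M \<Longrightarrow> \<kappa> m \<in> carrier M"
    and \<kappa>_add: "\<lbrakk>m \<in> carrier M; n \<in> carrier M\<rbrakk> \<Longrightarrow> \<kappa> (m \<oplus>\<^bsub>M\<^esub> n) = \<kappa> m \<oplus>\<^bsub>M\<^esub> \<kappa> n"
    and \<kappa>_smult: "\<lbrakk>r \<in> carrier R; m \<in> carrier M\<rbrakk> \<Longrightarrow> \<kappa> (r [^] p \<odot>\<^bsub>M\<^esub> m) = r \<odot>\<^bsub>M\<^esub> \<kappa> m"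
begin

text \<open>Represents elements of \<open>cartier_ops\<close> for \<open>e \<ge> 1\<close> only. At
  \<open>e = 0\<close> the factor \<open>f^ceil(t)\<close> would remain, so degree zero is always
  handled as linearity over \<open>R\<close>.\<close>

definition cop :: "rat \<Rightarrow> nat \<Rightarrow> 'a \<Rightarrow> 'c \<Rightarrow> 'c" where
  "cop t e r m = (\<kappa> ^^ e) ((f [^] fexp p t e \<otimes> r) \<odot>\<^bsub>M\<^esub> m)"

abbreviation cgens where
  "cgens t k H \<equiv> {cop t e r n | e r n. e \<ge> k \<and> r \<in> carrier R \<and> n \<in> H}"
abbreviation cp where "cp t \<equiv> c_plus R p M \<kappa> f t"
abbreviation csub where "csub t \<equiv> c_submodule R p M \<kappa> f t"

lemma p_pow_ge2: "e \<ge> 1 \<Longrightarrow> p ^ e \<ge> 2"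
  using p2 by (cases e) (auto intro: order_trans[of 2 p] simp: mult_le_cancel1)

lemma \<kappa>_pow_closed: "m \<in> carrier M \<Longrightarrow> (\<kappa> ^^ e) m \<in> carrier M"
  by (induction e) (auto simp: \<kappa>_closed)

lemma \<kappa>_pow_add: "\<lbrakk>m \<in> carrier M; n \<in> carrier M\<rbrakk> \<Longrightarrow> (\<kappa> ^^ e) (m \<oplus>\<^bsub>M\<^esub> n) = (\<kappa> ^^ e) m \<oplus>\<^bsub>M\<^esub> (\<kappa> ^^ e) n"
  by (induction e) (auto simp: \<kappa>_add \<kappa>_pow_closed)

lemma \<kappa>_pow_smult: "\<lbrakk>r \<in> carrier R; m \<in> carrier M\<rbrakk> \<Longrightarrow> (\<kappa> ^^ e) (r [^] (p ^ e) \<odot>\<^bsub>M\<^esub> m) = r \<odot>\<^bsub>M\<^esub> (\<kappa> ^^ e) m"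
proof (induction e arbitrary: r)
  case (Suc e)
  have "r [^] (p ^ Suc e) = (r [^] p) [^] (p ^ e)" using Suc by (simp add: nat_pow_pow)
  then have "(\<kappa> ^^ Suc e) (r [^] (p ^ Suc e) \<odot>\<^bsub>M\<^esub> m) = \<kappa> (r [^] p \<odot>\<^bsub>M\<^esub> (\<kappa> ^^ e) m)"
    using Suc by simp
  then show ?case using Suc by (simp add: \<kappa>_smult \<kappa>_pow_closed)
qed simp

lemma \<kappa>_pow_zero: "(\<kappa> ^^ e) \<zero>\<^bsub>M\<^esub> = \<zero>\<^bsub>M\<^esub>"
  using \<kappa>_pow_smult[of \<zero> "\<zero>\<^bsub>M\<^esub>" e] \<kappa>_pow_closed[of "\<zero>\<^bsub>M\<^esub>" e] by simp

lemma cop_closed: "\<lbrakk>r \<in> carrier R; m \<in> carrier M\<rbrakk> \<Longrightarrow> cop t e r m \<in> carrier M"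
  unfolding cop_def by (simp add: \<kappa>_pow_closed)

lemma cop_add: "\<lbrakk>r \<in> carrier R; m \<in> carrier M; n \<in> carrier M\<rbrakk> \<Longrightarrow> cop t e r (m \<oplus>\<^bsub>M\<^esub> n) = cop t e r m \<oplus>\<^bsub>M\<^esub> cop
    t e r n"
  unfolding cop_def by (simp add: smult_r_distr \<kappa>_pow_add)

lemma cop_zero: "r \<in> carrier R \<Longrightarrow> cop t e r \<zero>\<^bsub>M\<^esub> = \<zero>\<^bsub>M\<^esub>"
  unfolding cop_def by (simp add: \<kappa>_pow_zero)

lemma smult_cop:
  assumes "r \<in> carrier R" "m \<in> carrier M" "s \<in> carrier R"
  shows "s \<odot>\<^bsub>M\<^esub> cop t e r m = cop t e r (s [^] (p ^ e) \<odot>\<^bsub>M\<^esub> m)"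
  unfolding cop_def using assms
  by (simp add: \<kappa>_pow_smult[symmetric] smult_assoc1[symmetric] m_ac)

lemma cop_smult:
  assumes "r \<in> carrier R" "m \<in> carrier M" "s \<in> carrier R"
  shows "cop t e r (s \<odot>\<^bsub>M\<^esub> m) = cop t e (r \<otimes> s) m"
  unfolding cop_def using assms by (simp add: smult_assoc1[symmetric] m_ac)

lemma cop_cop:
  assumes "r \<in> carrier R" "r' \<in> carrier R"
  shows "\<exists>r''\<in>carrier R. \<forall>m\<in>carrier M. cop t e r (cop t e' r' m) = cop t (e + e') r'' m"
proof -
  let ?a = "fexp p t e * p ^ e' + fexp p t e'"
  let ?d = "?a - fexp p t (e + e')"
  let ?r = "f [^] ?d \<otimes> (r [^] (p ^ e') \<otimes> r')"
  have eq: "?a = fexp p t (e + e') + ?d" using fexp_add[of p t e e'] by simp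
  have fa: "f [^] fexp p t (e + e') \<otimes> f [^] ?d = f [^] (fexp p t e * p ^ e') \<otimes> f [^] fexp p t e'"
    by (simp add: nat_pow_mult fexp_add)
  have "cop t e r (cop t e' r' m) = cop t (e + e') ?r m" if m: "m \<in> carrier M" for m
  proof -
    have "cop t e r (cop t e' r' m) = (\<kappa> ^^ e) ((\<kappa> ^^ e') ((f [^] fexp p t e \<otimes> r) [^] (p ^ e') \<odot>\<^bsub>M\<^esub> ((f [^]
        fexp p t e' \<otimes> r') \<odot>\<^bsub>M\<^esub> m)))"
      unfolding cop_def using assms m by (subst \<kappa>_pow_smult) auto
    also have "\<dots> = (\<kappa> ^^ (e + e')) (((f [^] fexp p t e \<otimes> r) [^] (p ^ e') \<otimes> (f [^] fexp p t e' \<otimes> r')) \<odot>\<^bsub>M\<^esub> m)"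
      using assms m by (simp add: funpow_add smult_assoc1)
    also have "(f [^] fexp p t e \<otimes> r) [^] (p ^ e') \<otimes> (f [^] fexp p t e' \<otimes> r') = 
        (f [^] (fexp p t e * p ^ e') \<otimes> f [^] fexp p t e') \<otimes> (r [^] (p ^ e') \<otimes> r')"
      using assms by (simp add: nat_pow_distrib nat_pow_pow m_ac)
    also have "\<dots> = f [^] fexp p t (e + e') \<otimes> ?r" unfolding fa[symmetric] using assms by (simp add: m_assoc)
    finally show ?thesis unfolding cop_def .
  qed
  moreover have "?r \<in> carrier R" using assms by simp
  ultimately show ?thesis by blast
qed

lemma cp_eq_addspan:
  assumes "H \<subseteq> carrier M"
  shows "cp t H = addspan M (cgens t 1 H)"
proof -
  have eq: "{c n | c n e. e \<ge> 1 \<and> c \<in> cartier_ops R p M \<kappa> f t e \<and> n \<in> H}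
    = (cgens t 1 H)" (is "?A = ?B")
  proof
    show "?A \<subseteq> ?B"
    proof
      fix x assume "x \<in> ?A"
      then obtain c n e where x: "x = c n" "e \<ge> 1" "c \<in> cartier_ops R p M \<kappa> f t e" "n \<in> H" by blast
      then obtain r where "r \<in> carrier R" "c = (\<lambda>m. (\<kappa> ^^ e) ((f [^] nat \<lceil>t * of_nat (p ^ e)\<rceil> \<otimes> r) \<odot>\<^bsub>M\<^esub> m))"
        unfolding cartier_ops_def by auto
      then show "x \<in> ?B" using x unfolding cop_def fexp_def by auto
    qed
    show "?B \<subseteq> ?A"
    proof
      fix x assume "x \<in> ?B"
      then obtain e r n where x: "x = cop t e r n" "e \<ge> 1" "r \<in> carrier R" "n \<in> H" by blast
      then have "cop t e r \<in> cartier_ops R p M \<kappa> f t e"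
        unfolding cartier_ops_def cop_def fexp_def by auto
      then show "x \<in> ?A" using x by blast
    qed
  qed
  show ?thesis unfolding c_plus_def eq
  proof (rule M.generate_eq_addspan)
    show "?B \<subseteq> carrier M" using assms cop_closed by auto
    fix x assume "x \<in> ?B"
    then obtain e r n where x: "x = cop t e r n" "e \<ge> 1" "r \<in> carrier R" "n \<in> H" by blast
    have n: "n \<in> carrier M" using x assms by auto
    have "\<ominus>\<^bsub>M\<^esub> x = (\<ominus> \<one>) \<odot>\<^bsub>M\<^esub> cop t e r n" using x n by (simp add: smult_l_minus cop_closed)
    also have "\<dots> = cop t e (r \<otimes> (\<ominus> \<one>) [^] (p ^ e)) n" using x n by (simp add: smult_cop cop_smult)
    finally show "\<ominus>\<^bsub>M\<^esub> x \<in> ?B" using x by blast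
  qed
qed

lemma cp_gens_closed: "H \<subseteq> carrier M \<Longrightarrow> (cgens t k H) \<subseteq> carrier M"
  using cop_closed by auto

lemma cop_in_cp: "\<lbrakk>H \<subseteq> carrier M; e \<ge> 1; r \<in> carrier R; n \<in> H\<rbrakk> \<Longrightarrow> cop t e r n \<in> cp t H"
  unfolding cp_eq_addspan by (rule M.addspan_incl[OF _ cp_gens_closed]) auto

lemma cop_span_smult:
  assumes H: "H \<subseteq> carrier M" and s: "s \<in> carrier R"
    and x: "x \<in> addspan M (cgens t k H)" (is "x \<in> addspan M ?A")
  shows "s \<odot>\<^bsub>M\<^esub> x \<in> addspan M (cgens t k H)"
proof (rule M.addspan_map[OF M.abelian_group_axioms cp_gens_closed[OF H] x cp_gens_closed[OF H]])
  fix x assume "x \<in> ?A"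
  then obtain e r n where x: "x = cop t e r n" "e \<ge> k" "r \<in> carrier R" "n \<in> H" by blast
  then have "s \<odot>\<^bsub>M\<^esub> x = cop t e (r \<otimes> s [^] (p ^ e)) n"
    using s H by (simp add: smult_cop cop_smult subset_iff)
  moreover have "r \<otimes> s [^] (p ^ e) \<in> carrier R" using x s by simp
  ultimately have "s \<odot>\<^bsub>M\<^esub> x \<in> ?A" using x by blast
  then show "s \<odot>\<^bsub>M\<^esub> x \<in> addspan M ?A" by (rule M.addspan_incl[OF _ cp_gens_closed[OF H]])
qed (use s in \<open>auto simp: smult_r_distr\<close>)

lemma cp_closed: "H \<subseteq> carrier M \<Longrightarrow> cp t H \<subseteq> carrier M"
  unfolding cp_eq_addspan by (rule M.addspan_closed[OF cp_gens_closed])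

lemma cp_submodule: "H \<subseteq> carrier M \<Longrightarrow> submodule (cp t H) R M"
proof (rule submodule_if_closed)
  assume H: "H \<subseteq> carrier M"
  show "cp t H \<subseteq> carrier M" by (rule cp_closed[OF H])
  show "\<zero>\<^bsub>M\<^esub> \<in> cp t H" unfolding cp_eq_addspan[OF H] by (rule addspan_zero)
  show "a \<oplus>\<^bsub>M\<^esub> b \<in> cp t H" if "a \<in> cp t H" "b \<in> cp t H" for a b
    using that unfolding cp_eq_addspan[OF H] by (rule M.addspan_plus[OF cp_gens_closed[OF H]])
  show "a \<odot>\<^bsub>M\<^esub> x \<in> cp t H" if "a \<in> carrier R" "x \<in> cp t H" for a x
    using that unfolding cp_eq_addspan[OF H] by (rule cop_span_smult[OF H])
qed

lemma cp_mono: "\<lbrakk>H \<subseteq> K; K \<subseteq> carrier M\<rbrakk> \<Longrightarrow> cp t H \<subseteq> cp t K"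
  by (subst (1 2) cp_eq_addspan) (auto intro!: addspan_mono)

lemma cp_least:
  assumes "submodule K R M" "H \<subseteq> carrier M"
    and "\<And>e r n. \<lbrakk>e \<ge> 1; r \<in> carrier R; n \<in> H\<rbrakk> \<Longrightarrow> cop t e r n \<in> K"
  shows "cp t H \<subseteq> K"
  unfolding cp_eq_addspan[OF assms(2)]
  by (rule addspan_least) (use assms submoduleE(5)[OF assms(1)] submodule_zero in auto)

lemma csub_iff: "csub t H \<longleftrightarrow> submodule H R M \<and> (\<forall>e r n. e \<ge> 1 \<longrightarrow> r \<in> carrier R \<longrightarrow> n \<in> H \<longrightarrow> cop t e r n \<in> H)"
  (is "_ \<longleftrightarrow> ?R")
proof
  assume c: "csub t H"
  have "cop t e r n \<in> H" if "e \<ge> 1" "r \<in> carrier R" "n \<in> H" for e r n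
  proof -
    have "cop t e r \<in> cartier_ops R p M \<kappa> f t e"
      unfolding cartier_ops_def cop_def fexp_def using that by auto
    then show ?thesis using c that unfolding c_submodule_def by blast
  qed
  then show ?R using c unfolding c_submodule_def by blast
next
  assume r: ?R
  have "c n \<in> H" if "c \<in> cartier_ops R p M \<kappa> f t e" "n \<in> H" for c n e
  proof (cases "e = 0")
    case True
    then show ?thesis using that r submoduleE(4)[of H] unfolding cartier_ops_def by auto
  next
    case False
    then have "c \<in> {\<lambda>m. (\<kappa> ^^ e) ((f [^] nat \<lceil>t * of_nat (p ^ e)\<rceil> \<otimes> r) \<odot>\<^bsub>M\<^esub> m) | r. r \<in> carrier R}"
      using that(1) unfolding cartier_ops_def by simp
    then obtain r' where r': "r' \<in> carrier R"
      "c = (\<lambda>m. (\<kappa> ^^ e) ((f [^] nat \<lceil>t * of_nat (p ^ e)\<rceil> \<otimes> r') \<odot>\<^bsub>M\<^esub> m))" by blast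
    have "c n = cop t e r' n" unfolding r'(2) cop_def fexp_def by simp
    then show ?thesis using that(2) r r'(1) False by simp
  qed
  then show "csub t H" using r unfolding c_submodule_def by blast
qed

lemma csub_submodule: "csub t H \<Longrightarrow> submodule H R M" by (simp add: csub_iff)
lemma csub_closed: "csub t H \<Longrightarrow> H \<subseteq> carrier M" using submoduleE(1)[OF csub_submodule] .
lemma csub_cop: "\<lbrakk>csub t H; e \<ge> 1; r \<in> carrier R; n \<in> H\<rbrakk> \<Longrightarrow> cop t e r n \<in> H" by (simp add: csub_iff)

lemma csub_carrier: "csub t (carrier M)"
  unfolding csub_iff using carrier_is_submodule cop_closed by auto

lemma csub_Int: "\<lbrakk>csub t H; csub t K\<rbrakk> \<Longrightarrow> csub t (H \<inter> K)"
  unfolding csub_iff using submodule_Int by auto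

lemma cp_subset: "csub t H \<Longrightarrow> cp t H \<subseteq> H"
  by (rule cp_least) (auto simp: csub_submodule csub_closed csub_cop)

lemma csub_cp: "csub t H \<Longrightarrow> csub t (cp t H)"
  using cp_submodule[OF csub_closed] cop_in_cp[OF csub_closed] cp_subset unfolding csub_iff[of t "cp t H"]
      by blast

lemma csub_cp_pow: "csub t H \<Longrightarrow> csub t ((cp t ^^ h) H)"
  by (induction h) (auto intro: csub_cp)

lemma cp_pow_Suc_subset: "csub t H \<Longrightarrow> (cp t ^^ Suc h) H \<subseteq> (cp t ^^ h) H"
  using cp_subset[OF csub_cp_pow] by simp

lemma cp_pow_antimono: "\<lbrakk>csub t H; h \<le> h'\<rbrakk> \<Longrightarrow> (cp t ^^ h') H \<subseteq> (cp t ^^ h) H"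
  using lift_Suc_antimono_le[of "\<lambda>h. (cp t ^^ h) H" h h'] cp_pow_Suc_subset by auto

lemma cp_pow_closed: "csub t H \<Longrightarrow> (cp t ^^ h) H \<subseteq> carrier M"
  using csub_closed[OF csub_cp_pow] .

lemma cp_pow_mono: "\<lbrakk>csub t H; csub t K; H \<subseteq> K\<rbrakk> \<Longrightarrow> (cp t ^^ h) H \<subseteq> (cp t ^^ h) K"
  by (induction h) (auto intro!: cp_mono cp_pow_closed del: subsetI)

text \<open>A product of \<open>h + 1\<close> operators of positive degree is an operator of degree
  at least \<open>h + 1\<close>. This is the passage from iterates of \<open>cp t\<close> to single
  operators with large \<open>e\<close>.\<close>

lemma cp_pow_span:
  assumes H: "csub t H"
  shows "(cp t ^^ Suc h) H \<subseteq> addspan M (cgens t (Suc h) H)"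
proof (induction h)
  case 0 show ?case using cp_eq_addspan[OF csub_closed[OF H]] by simp
next
  case (Suc h)
  let ?A = "\<lambda>h. (cgens t (Suc h) H)"
  note Ac = cp_gens_closed[OF csub_closed[OF H]]
  have "(cp t ^^ Suc (Suc h)) H = cp t ((cp t ^^ Suc h) H)" by simp
  also have "\<dots> = addspan M (cgens t 1 ((cp t ^^ Suc h) H))"
    by (rule cp_eq_addspan[OF cp_pow_closed[OF H]])
  also have "\<dots> \<subseteq> addspan M (?A (Suc h))"
  proof (rule M.addspan_subset_addspan[OF Ac], rule subsetI)
    fix x assume "x \<in> (cgens t 1 ((cp t ^^ Suc h) H))"
    then obtain e r n where x: "x = cop t e r n" "e \<ge> 1" "r \<in> carrier R" "n \<in> (cp t ^^ Suc h) H" by blast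
    have n: "n \<in> addspan M (?A h)" using x Suc.IH by blast
    show "x \<in> addspan M (?A (Suc h))" unfolding x(1)
    proof (rule M.addspan_map[OF M.abelian_group_axioms Ac n Ac])
      fix y assume "y \<in> ?A h"
      then obtain e' r' n' where y: "y = cop t e' r' n'" "e' \<ge> Suc h" "r' \<in> carrier R" "n' \<in> H" by blast
      have n'c: "n' \<in> carrier M" using y csub_closed[OF H] by auto
      obtain r'' where r'': "r'' \<in> carrier R" "cop t e r y = cop t (e + e') r'' n'"
        using cop_cop[OF x(3) y(3)] n'c y by blast
      have "Suc (Suc h) \<le> e + e'" using x y by auto
      then show "cop t e r y \<in> addspan M (?A (Suc h))"
        using r'' y by (intro M.addspan_incl[OF _ Ac]) blast
    qed (use x cop_zero cop_add in auto)
  qed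
  finally show ?case .
qed

text \<open>Hartshorne--Speiser--Lyubeznik--Gabber stabilization: the annihilators of the successive quotients
  increase, so they are eventually a radical ideal \<open>I\<close>, and \<open>I\<close> then multiplies one term of the chain into
  all later ones.  At an associated prime of \<open>I\<close> the chain lives in a finite-dimensional vector space.\<close>

lemma cp_pow_stable:
  assumes noeth: "noeth_in R (carrier R)" and H: "csub t H"
    and E: "finite E" "E \<subseteq> carrier M" "H \<subseteq> rspan E"
  shows "\<exists>h0. \<forall>h\<ge>h0. (cp t ^^ h) H = (cp t ^^ h0) H"
proof -
  define G where "G n = (cp t ^^ n) H" for n
  have Gc: "csub t (G n)" for n unfolding G_def by (rule csub_cp_pow[OF H])
  have Gm: "G n \<subseteq> carrier M" for n using csub_closed[OF Gc] .
  have Gs: "submodule (G n) R M" for n using csub_submodule[OF Gc] .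
  have GS: "G (Suc n) = cp t (G n)" for n unfolding G_def by simp
  have Gdec: "G (Suc n) \<subseteq> G n" for n unfolding GS by (rule cp_subset[OF Gc])
  have Ganti: "m \<le> n \<Longrightarrow> G n \<subseteq> G m" for m n
    unfolding G_def by (rule cp_pow_antimono[OF H])
  define I where "I n = {x \<in> carrier R. \<forall>m\<in>G n. x \<odot>\<^bsub>M\<^esub> m \<in> G (Suc n)}" for n
  have Iid: "ideal (I n) R" for n
  proof (rule ideal_if_closed)
    show "I n \<subseteq> carrier R" unfolding I_def by auto
    show "\<zero> \<in> I n" unfolding I_def using submodule_zero[OF Gs] Gm by (auto simp: subset_iff)
    show "x \<oplus> y \<in> I n" if "x \<in> I n" "y \<in> I n" for x y
      using that submoduleE(5)[OF Gs] Gm[of n] unfolding I_def by (auto simp: smult_l_distr subset_iff)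
    show "a \<otimes> x \<in> I n" if "a \<in> carrier R" "x \<in> I n" for a x
      using that submoduleE(4)[OF Gs] Gm[of n] unfolding I_def by (auto simp: smult_assoc1 subset_iff)
  qed
  have pow_split: "x [^] (p ^ e) = x [^] (p ^ e - 2) \<otimes> (x \<otimes> x)" if "x \<in> carrier R" "e \<ge> 1" for x e
  proof -
    have "x [^] (p ^ e - 2) \<otimes> x [^] (2::nat) = x [^] (p ^ e - 2 + 2)"
      using that by (intro nat_pow_mult) auto
    moreover have "p ^ e - 2 + 2 = p ^ e" using p_pow_ge2[OF that(2)] by simp
    moreover have "x [^] (2::nat) = x \<otimes> x" using that by (simp add: numeral_2_eq_2)
    ultimately show ?thesis by metis
  qed
  \<comment> \<open>On \<open>cop t e r n\<close> the element \<open>x\<close> acts as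
    \<open>x^(p^e)\<close> does on \<open>n\<close>, and this is a multiple of \<open>x^2\<close>
    because \<open>p^e \<ge> 2\<close>. So one application of \<open>cp t\<close> extracts a square
    root.\<close>
  have radical: "x \<in> I (Suc n)" if "x \<in> carrier R" "x \<otimes> x \<in> I n" for x n
  proof -
    have "x \<odot>\<^bsub>M\<^esub> m \<in> G (Suc (Suc n))" if m: "m \<in> G (Suc n)" for m
    proof -
      have m': "m \<in> addspan M (cgens t 1 (G n))"
        using m unfolding GS cp_eq_addspan[OF Gm] .
      have cl: "(cgens t 1 (G (Suc n))) \<subseteq> carrier M" by (rule cp_gens_closed[OF Gm])
      show ?thesis unfolding GS[of "Suc n"] cp_eq_addspan[OF Gm]
      proof (rule M.addspan_map[OF M.abelian_group_axioms cp_gens_closed[OF Gm] m' cl])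
        fix y assume "y \<in> (cgens t 1 (G n))"
        then obtain e r n' where y: "y = cop t e r n'" "e \<ge> 1" "r \<in> carrier R" "n' \<in> G n" by blast
        have "x [^] (p ^ e) \<in> I n" unfolding pow_split[OF \<open>x \<in> carrier R\<close> y(2)]
          using ideal.I_l_closed[OF Iid \<open>x \<otimes> x \<in> I n\<close>] \<open>x \<in> carrier R\<close> by simp
        then have "x [^] (p ^ e) \<odot>\<^bsub>M\<^esub> n' \<in> G (Suc n)" using y unfolding I_def by auto
        moreover have "x \<odot>\<^bsub>M\<^esub> y = cop t e r (x [^] (p ^ e) \<odot>\<^bsub>M\<^esub> n')" unfolding y(1)
          using y Gm \<open>x \<in> carrier R\<close> by (intro smult_cop) auto
        ultimately show "x \<odot>\<^bsub>M\<^esub> y \<in> addspan M (cgens t 1 (G (Suc n)))"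
          using y by (intro M.addspan_incl[OF _ cl]) auto
      qed (use \<open>x \<in> carrier R\<close> in \<open>auto simp: smult_r_distr\<close>)
    qed
    then show ?thesis using that(1) unfolding I_def by auto
  qed
  have "I n \<subseteq> I (Suc n)" for n
  proof
    fix x assume x: "x \<in> I n"
    then have xc: "x \<in> carrier R" unfolding I_def by auto
    show "x \<in> I (Suc n)" by (rule radical[OF xc ideal.I_l_closed[OF Iid x xc]])
  qed
  then have "\<exists>n0. \<forall>n\<ge>n0. I n = I n0" by (rule noeth_ideal_chain[OF noeth Iid])
  then obtain n0 where n0: "\<And>n. n \<ge> n0 \<Longrightarrow> I n = I n0" by auto
  \<comment> \<open>Again two factors \<open>x\<close> are available in \<open>x^(p^e)\<close>: one
    sends \<open>n'\<close> into \<open>G (Suc n0)\<close>, the other sends the result as deep as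
    the induction hypothesis allows, and the operator adds one more level.\<close>
  have absorb: "x \<odot>\<^bsub>M\<^esub> m \<in> G (Suc n0 + j)" if x: "x \<in> I n0" and "m \<in> G (Suc n0)" for x m j
    using that(2)
  proof (induction j arbitrary: m)
    case 0
    have "x \<in> carrier R" using x unfolding I_def by auto
    then show ?case using submoduleE(4)[OF Gs _ 0] by simp
  next
    case (Suc j)
    have xc: "x \<in> carrier R" using x unfolding I_def by auto
    have m': "m \<in> addspan M (cgens t 1 (G n0))"
      using Suc.prems unfolding GS cp_eq_addspan[OF Gm] .
    have cl: "(cgens t 1 (G (Suc n0 + j))) \<subseteq> carrier M" by (rule cp_gens_closed[OF Gm])
    have "x \<odot>\<^bsub>M\<^esub> m \<in> cp t (G (Suc n0 + j))" unfolding cp_eq_addspan[OF Gm]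
    proof (rule M.addspan_map[OF M.abelian_group_axioms cp_gens_closed[OF Gm] m' cl])
      fix y assume "y \<in> (cgens t 1 (G n0))"
      then obtain e r n' where y: "y = cop t e r n'" "e \<ge> 1" "r \<in> carrier R" "n' \<in> G n0" by blast
      have n'c: "n' \<in> carrier M" using y Gm by auto
      have "x \<odot>\<^bsub>M\<^esub> n' \<in> G (Suc n0)" using x y unfolding I_def by auto
      then have z: "x [^] (p ^ e - 2) \<odot>\<^bsub>M\<^esub> (x \<odot>\<^bsub>M\<^esub> n') \<in> G (Suc n0)" using submoduleE(4)[OF Gs] xc by auto
      have "x [^] (p ^ e) \<odot>\<^bsub>M\<^esub> n' = x \<odot>\<^bsub>M\<^esub> (x [^] (p ^ e - 2) \<odot>\<^bsub>M\<^esub> (x \<odot>\<^bsub>M\<^esub> n'))"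
        unfolding pow_split[OF xc y(2)] using xc n'c by (simp add: smult_assoc1[symmetric] m_ac)
      then have "x [^] (p ^ e) \<odot>\<^bsub>M\<^esub> n' \<in> G (Suc n0 + j)" using Suc.IH[OF z] by simp
      moreover have "x \<odot>\<^bsub>M\<^esub> y = cop t e r (x [^] (p ^ e) \<odot>\<^bsub>M\<^esub> n')" unfolding y(1)
        using y n'c xc by (intro smult_cop) auto
      ultimately show "x \<odot>\<^bsub>M\<^esub> y \<in> addspan M (cgens t 1 (G (Suc n0 + j)))"
        using y by (intro M.addspan_incl[OF _ cl]) auto
    qed (use xc in \<open>auto simp: smult_r_distr\<close>)
    then show ?case using GS by simp
  qed
  have "\<one> \<in> I n0"
  proof (rule ccontr)
    assume one: "\<one> \<notin> I n0"
    interpret I: ideal "I n0" R by (rule Iid)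
    define colon where "colon y = {a \<in> carrier R. a \<otimes> y \<in> I n0}" for y
    have colon: "ideal (colon y) R" if "y \<in> carrier R" for y
      by (rule ideal_if_closed)
         (use that I.zero_closed I.a_closed I.I_l_closed in \<open>auto simp: colon_def l_distr m_assoc\<close>)
    \<comment> \<open>A maximal member among these colon ideals, taken at elements outside
      \<open>I n0\<close>, is an associated prime of \<open>I n0\<close>.\<close>
    have "\<exists>P\<in>colon ` (carrier R - I n0). \<forall>J\<in>colon ` (carrier R - I n0). P \<subseteq> J \<longrightarrow> J = P"
      by (rule noeth_maximal_ideal[OF noeth, of _ "colon \<one>"]) (use colon one in auto)
    then obtain y where y: "y \<in> carrier R" "y \<notin> I n0"
      and max: "\<And>z. \<lbrakk>z \<in> carrier R; z \<notin> I n0; colon y \<subseteq> colon z\<rbrakk> \<Longrightarrow> colon z = colon y" by auto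
    let ?P = "colon y"
    have P: "primeideal ?P R"
    proof (rule primeidealI[OF colon[OF y(1)]])
      show "cring R" by (rule is_cring)
      have "\<one> \<notin> ?P" unfolding colon_def using y by auto
      then show "carrier R \<noteq> ?P" by auto
      fix a b assume ab: "a \<in> carrier R" "b \<in> carrier R" "a \<otimes> b \<in> ?P"
      show "a \<in> ?P \<or> b \<in> ?P"
      proof (rule disjCI)
        assume b: "b \<notin> ?P"
        have c: "b \<otimes> y \<in> carrier R" "b \<otimes> y \<notin> I n0" using ab b y unfolding colon_def by auto
        have "colon y \<subseteq> colon (b \<otimes> y)"
        proof
          fix z assume "z \<in> colon y"
          then have z: "z \<in> carrier R" "z \<otimes> y \<in> I n0" unfolding colon_def by auto
          have "z \<otimes> (b \<otimes> y) = b \<otimes> (z \<otimes> y)" using z ab y by (simp add: m_ac)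
          then show "z \<in> colon (b \<otimes> y)" using z I.I_l_closed[OF z(2) ab(2)] unfolding colon_def by simp
        qed
        then have "colon (b \<otimes> y) = colon y" using max c by blast
        moreover have "a \<in> colon (b \<otimes> y)" using ab y unfolding colon_def by (simp add: m_assoc)
        ultimately show "a \<in> ?P" by simp
      qed
    qed
    \<comment> \<open>Here radicality enters: \<open>y^2\<close> in \<open>I n0\<close> would give
      \<open>y\<close> in \<open>I n0\<close>. Thus \<open>y\<close> becomes invertible at
      \<open>?P\<close>, as the chain lemma demands.\<close>
    have yP: "y \<notin> ?P"
    proof
      assume "y \<in> ?P"
      then have "y \<otimes> y \<in> I n0" unfolding colon_def by auto
      then show False using radical[OF y(1)] n0[of "Suc n0"] y by auto
    qed
    have "G (Suc n0) \<subseteq> H" using Ganti[of 0 "Suc n0"] unfolding G_def by simp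
    then have "G (Suc n0) \<subseteq> rspan E" using E(3) by blast
    then obtain F where F: "finite F" "F \<subseteq> G (Suc n0)" "G (Suc n0) = rspan F"
      using noetherian_submodule[OF noeth E(1,2) Gs] by metis
    have "\<exists>n1. \<forall>n\<ge>n1. \<exists>s\<in>carrier R - ?P. \<forall>x\<in>G (Suc n0 + n). s \<odot>\<^bsub>M\<^esub> x \<in> G (Suc n0 + Suc n)"
    proof (rule chain_generically_stable[OF P y(1) yP F(1)])
      show "F \<subseteq> carrier M" using F Gm by blast
      show "submodule (G (Suc n0 + n)) R M" for n by (rule Gs)
      show "G (Suc n0 + Suc n) \<subseteq> G (Suc n0 + n)" for n using Gdec by simp
      show "G (Suc n0 + n) \<subseteq> rspan F" for n unfolding F(3)[symmetric] by (rule Ganti) simp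
      show "(y \<otimes> a) \<odot>\<^bsub>M\<^esub> x \<in> G (Suc n0 + n)" if "a \<in> ?P" "x \<in> rspan F" for a x n
      proof -
        have "y \<otimes> a \<in> I n0" using that(1) y m_comm[of y a] unfolding colon_def by auto
        then show ?thesis using absorb that(2) F(3) by blast
      qed
    qed
    then obtain n1 s where s: "s \<in> carrier R" "s \<notin> ?P" "\<forall>x\<in>G (Suc n0 + n1). s \<odot>\<^bsub>M\<^esub> x \<in> G (Suc n0 + Suc n1)"
        by blast
    then have "s \<in> I (Suc n0 + n1)" unfolding I_def by simp
    then have "s \<in> I n0" using n0[of "Suc n0 + n1"] by simp
    then have "s \<otimes> y \<in> I n0" using y I.I_r_closed by blast
    then show False using s unfolding colon_def by auto
  qed
  then have "G n0 \<subseteq> G (Suc n0)" unfolding I_def using Gm by (force simp: subset_iff)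
  then have eq: "cp t (G n0) = G n0" using Gdec GS by auto
  have "G (n0 + j) = G n0" for j by (induction j) (auto simp: GS eq)
  then have "\<forall>h\<ge>n0. G h = G n0" by (metis le_add_diff_inverse)
  then show ?thesis unfolding G_def by blast
qed

end

section \<open>Gauges\<close>

text \<open>\<open>fexp p t 0\<close> is the ceiling of \<open>t\<close>. The estimate makes the
  gauge of the power of \<open>f\<close>, divided by \<open>p^e\<close>, bounded independently of
  \<open>e\<close>.\<close>

lemma fexp_le: "fexp p t e \<le> fexp p t 0 * p ^ e"
proof -
  have "t * of_nat (p ^ e) \<le> of_int \<lceil>t\<rceil> * of_nat (p ^ e)"
    by (intro mult_right_mono le_of_int_ceiling) auto
  also have "\<dots> = of_int (\<lceil>t\<rceil> * int (p ^ e))" by simp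
  finally have "\<lceil>t * of_nat (p ^ e)\<rceil> \<le> \<lceil>t\<rceil> * int (p ^ e)" by (simp only: ceiling_le_iff)
  then have "nat \<lceil>t * of_nat (p ^ e)\<rceil> \<le> nat (\<lceil>t\<rceil> * int (p ^ e))" by (rule nat_mono)
  also have "\<dots> = fexp p t 0 * p ^ e"
    by (subst mult.commute, subst nat_mult_distrib) (auto simp: fexp_def mult.commute nat_power_eq)
  finally show ?thesis unfolding fexp_def by simp
qed

text \<open>The subalgebra is built by adjoining one element at a time, so that the basis theorem
  and the bounds on exponents follow by induction on the list.\<close>

primrec gen_alg :: "('a, 'x) ring_scheme \<Rightarrow> 'a set \<Rightarrow> 'a list \<Rightarrow> 'a set" where
  "gen_alg R C [] = C"
| "gen_alg R C (s # xs) = adjoin R (gen_alg R C xs) s"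

text \<open>Each exponent is bounded separately, not the total degree. Division with remainder by
  \<open>q\<close> in every exponent then splits a monomial into a \<open>q\<close>-th power from
  the box \<open>d div q\<close> and a remainder from the box \<open>q - 1\<close>.\<close>

primrec box :: "('a, 'x) ring_scheme \<Rightarrow> 'a list \<Rightarrow> nat \<Rightarrow> 'a set" where
  "box R [] d = {\<one>\<^bsub>R\<^esub>}"
| "box R (s # xs) d = {s [^]\<^bsub>R\<^esub> i \<otimes>\<^bsub>R\<^esub> m | i m. i \<le> d \<and> m \<in> box R xs d}"

definition terms :: "('a, 'x) ring_scheme \<Rightarrow> 'a set \<Rightarrow> 'a list \<Rightarrow> nat \<Rightarrow> 'a set" where
  "terms R C xs d = {c \<otimes>\<^bsub>R\<^esub> m | c m. c \<in> C \<and> m \<in> box R xs d}"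

section \<open>Monomials with bounded exponents\<close>

context cring begin

lemma gen_alg_subring: "\<lbrakk>subring C R; set xs \<subseteq> carrier R\<rbrakk> \<Longrightarrow> subring (gen_alg R C xs) R"
  by (induction xs) (auto simp: adjoin_subring)

lemma gen_alg_base: "\<lbrakk>subring C R; set xs \<subseteq> carrier R\<rbrakk> \<Longrightarrow> C \<subseteq> gen_alg R C xs"
  by (induction xs) (auto dest: adjoin_incl[OF gen_alg_subring] simp: subset_iff)

lemma gen_alg_mem: "\<lbrakk>subring C R; set xs \<subseteq> carrier R\<rbrakk> \<Longrightarrow> set xs \<subseteq> gen_alg R C xs"
proof (induction xs)
  case (Cons s xs)
  then show ?case
    using adjoin_incl[of "gen_alg R C xs" s] adjoin_mem[of "gen_alg R C xs" s] gen_alg_subring[of C xs] by auto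
qed auto

lemma gen_alg_noeth: "\<lbrakk>subring C R; set xs \<subseteq> carrier R; noeth_in R C\<rbrakk> \<Longrightarrow> noeth_in R (gen_alg R C xs)"
  by (induction xs) (auto simp: gen_alg_subring hilbert_basis)

lemma box_closed: "set xs \<subseteq> carrier R \<Longrightarrow> box R xs d \<subseteq> carrier R"
  by (induction xs) auto

lemma finite_box: "finite (box R xs d)"
proof (induction xs)
  case (Cons s xs)
  have "box R (s # xs) d = (\<lambda>(i, m). s [^] i \<otimes> m) ` ({..d} \<times> box R xs d)" by auto
  then show ?case using Cons by simp
qed auto

lemma box_mono: "d \<le> d' \<Longrightarrow> box R xs d \<subseteq> box R xs d'"
proof (induction xs)
  case (Cons s xs)
  then show ?case by (auto intro: order_trans)
qed auto

lemma box_one: "set xs \<subseteq> carrier R \<Longrightarrow> \<one> \<in> box R xs d"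
proof (induction xs)
  case (Cons s xs)
  then show ?case by (auto intro!: exI[of _ "0::nat"] exI[of _ \<one>])
qed auto

lemma box_mult: "\<lbrakk>set xs \<subseteq> carrier R; m \<in> box R xs d; m' \<in> box R xs d'\<rbrakk> \<Longrightarrow> m \<otimes> m' \<in> box R xs (d + d')"
proof (induction xs arbitrary: m m')
  case (Cons s xs)
  obtain i n where m: "m = s [^] i \<otimes> n" "i \<le> d" "n \<in> box R xs d" using Cons.prems by auto
  obtain j n' where m': "m' = s [^] j \<otimes> n'" "j \<le> d'" "n' \<in> box R xs d'" using Cons.prems by auto
  have c: "s \<in> carrier R" "n \<in> carrier R" "n' \<in> carrier R" using Cons.prems box_closed[of xs] m m' by auto
  have "m \<otimes> m' = (s [^] i \<otimes> s [^] j) \<otimes> (n \<otimes> n')" unfolding m m' using c by (simp add: m_ac)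
  also have "s [^] i \<otimes> s [^] j = s [^] (i + j)" using c by (simp add: nat_pow_mult)
  finally show ?case using Cons.IH[OF _ m(3) m'(3)] Cons.prems m m'
    by (auto intro!: exI[of _ "i + j"] exI[of _ "n \<otimes> n'"])
qed auto

lemma box_div:
  "\<lbrakk>set xs \<subseteq> carrier R; q \<ge> 1; m \<in> box R xs d\<rbrakk> \<Longrightarrow> \<exists>u\<in>box R xs (d div q). \<exists>v\<in>box R xs (q - 1). m = u [^] q \<otimes> v"
proof (induction xs arbitrary: m)
  case (Cons s xs)
  obtain i n where m: "m = s [^] i \<otimes> n" "i \<le> d" "n \<in> box R xs d" using Cons.prems by auto
  obtain u v where uv: "u \<in> box R xs (d div q)" "v \<in> box R xs (q - 1)" "n = u [^] q \<otimes> v"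
    using Cons.IH[OF _ Cons.prems(2) m(3)] Cons.prems by auto
  have c: "s \<in> carrier R" "u \<in> carrier R" "v \<in> carrier R"
    using Cons.prems box_closed[of xs] uv by auto
  have "s [^] i = s [^] ((i div q) * q) \<otimes> s [^] (i mod q)" using c by (simp add: nat_pow_mult)
  also have "s [^] ((i div q) * q) = (s [^] (i div q)) [^] q" using c by (simp add: nat_pow_pow)
  finally have si: "s [^] i = (s [^] (i div q)) [^] q \<otimes> s [^] (i mod q)" .
  have eq: "m = (s [^] (i div q) \<otimes> u) [^] q \<otimes> (s [^] (i mod q) \<otimes> v)"
    unfolding m si uv(3) using c by (simp add: nat_pow_distrib m_ac)
  have "i mod q < q" using Cons.prems(2) by (intro mod_less_divisor) auto
  then have imod: "i mod q \<le> q - 1" by linarith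
  have "s [^] (i div q) \<otimes> u \<in> box R (s # xs) (d div q)" using uv m(2) by (auto intro: div_le_mono)
  moreover have "s [^] (i mod q) \<otimes> v \<in> box R (s # xs) (q - 1)" using uv imod by auto
  ultimately show ?case using eq by blast
qed auto

lemma terms_closed: "\<lbrakk>C \<subseteq> carrier R; set xs \<subseteq> carrier R\<rbrakk> \<Longrightarrow> terms R C xs d \<subseteq> carrier R"
  using box_closed[of xs d] unfolding terms_def by auto

lemma terms_mono: "d \<le> d' \<Longrightarrow> terms R C xs d \<subseteq> terms R C xs d'"
  using box_mono[of d d' xs] unfolding terms_def by auto

lemma terms_mult:
  assumes "subring C R" "set xs \<subseteq> carrier R" "a \<in> terms R C xs d" "b \<in> terms R C xs d'"
  shows "a \<otimes> b \<in> terms R C xs (d + d')"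
proof -
  obtain c m where a: "a = c \<otimes> m" "c \<in> C" "m \<in> box R xs d" using assms unfolding terms_def by auto
  obtain c' m' where b: "b = c' \<otimes> m'" "c' \<in> C" "m' \<in> box R xs d'" using assms unfolding terms_def by auto
  have cc: "c \<in> carrier R" "c' \<in> carrier R" "m \<in> carrier R" "m' \<in> carrier R"
    using a b subringE(1)[OF assms(1)] box_closed[OF assms(2)] by auto
  have "a \<otimes> b = (c \<otimes> c') \<otimes> (m \<otimes> m')" unfolding a b using cc by (simp add: m_ac)
  then show ?thesis unfolding terms_def
    using box_mult[OF assms(2) a(3) b(3)] subringE(6)[OF assms(1) a(2) b(2)] by blast
qed

lemma box_terms: "\<lbrakk>subring C R; set xs \<subseteq> carrier R; m \<in> box R xs d\<rbrakk> \<Longrightarrow> m \<in> terms R C xs d"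
proof -
  assume a: "subring C R" "set xs \<subseteq> carrier R" "m \<in> box R xs d"
  then have "m = \<one> \<otimes> m" using box_closed[of xs d] by auto
  then show ?thesis using subringE(3)[OF a(1)] a(3) unfolding terms_def by blast
qed

lemma gen_alg_bounded:
  assumes C: "subring C R" and "set xs \<subseteq> carrier R" "y \<in> gen_alg R C xs"
  shows "\<exists>d. y \<in> addspan R (terms R C xs d)"
  using assms(2,3)
proof (induction xs arbitrary: y)
  case Nil
  have cl: "terms R C [] 0 \<subseteq> carrier R" using terms_closed subringE(1)[OF C] by auto
  have "y \<in> carrier R" using subringE(1)[OF C] Nil by auto
  then have "y = y \<otimes> \<one>" by simp
  then have "y \<in> terms R C [] 0" using Nil unfolding terms_def by auto
  then show ?case using addspan_incl cl by blast
next
  case (Cons s xs)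
  have s: "s \<in> carrier R" and xs: "set xs \<subseteq> carrier R" using Cons.prems by auto
  let ?A = "gen_alg R C xs"
  have A: "subring ?A R" using gen_alg_subring[OF C xs] .
  obtain n where "y \<in> pols R ?A s n" using Cons.prems by (auto simp: adjoin_def)
  then show ?case
  proof (induction n arbitrary: y)
    case 0 then show ?case by (auto intro: addspan_zero)
  next
    case (Suc n)
    obtain b z where y: "y = b \<otimes> s [^] n \<oplus> z" "b \<in> ?A" "z \<in> pols R ?A s n" using Suc.prems by auto
    obtain d where d: "z \<in> addspan R (terms R C (s # xs) d)" using Suc.IH[OF y(3)] by blast
    obtain d' where d': "b \<in> addspan R (terms R C xs d')" using Cons.IH[OF xs y(2)] by blast
    define e where "e = max d (max d' n)"
    have cl: "terms R C (s # xs) e \<subseteq> carrier R" "terms R C xs d' \<subseteq> carrier R"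
      using terms_closed[OF subringE(1)[OF C]] Cons.prems by auto
    have "s [^] n \<otimes> b \<in> addspan R (terms R C (s # xs) e)"
    proof (rule addspan_map[OF abelian_group_axioms cl(2) d' cl(1)])
      fix x assume "x \<in> terms R C xs d'"
      then obtain c m where x: "x = c \<otimes> m" "c \<in> C" "m \<in> box R xs d'" unfolding terms_def by auto
      have cc: "c \<in> carrier R" "m \<in> carrier R" using x subringE(1)[OF C] box_closed[OF xs] by auto
      have "s [^] n \<otimes> x = c \<otimes> (s [^] n \<otimes> m)" unfolding x using cc s by (simp add: m_ac)
      moreover have "d' \<le> e" "n \<le> e" unfolding e_def by auto
      then have "m \<in> box R xs e" "n \<le> e" using x(3) box_mono[of d' e xs] by auto
      then have "s [^] n \<otimes> m \<in> box R (s # xs) e" by auto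
      ultimately have "s [^] n \<otimes> x \<in> terms R C (s # xs) e" using x(2) unfolding terms_def by blast
      then show "s [^] n \<otimes> x \<in> addspan R (terms R C (s # xs) e)" using addspan_incl cl by blast
    qed (use s in \<open>auto simp: r_distr\<close>)
    moreover have "z \<in> addspan R (terms R C (s # xs) e)"
      using addspan_mono[OF terms_mono[of d e C "s # xs"], of R] d unfolding e_def by (auto simp:
          le_max_iff_disj)
    moreover have "b \<otimes> s [^] n = s [^] n \<otimes> b" using y s subringE(1)[OF A] by (intro m_comm) auto
    ultimately have "y \<in> addspan R (terms R C (s # xs) e)" unfolding y(1)
      using addspan_plus[OF cl(1)] by simp
    then show ?case ..
  qed
qed

lemma addspan_terms_mult:
  assumes C: "subring C R" and xs: "set xs \<subseteq> carrier R"
    and a: "a \<in> addspan R (terms R C xs d)" and b: "b \<in> addspan R (terms R C xs d')"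
  shows "a \<otimes> b \<in> addspan R (terms R C xs (d + d'))"
proof -
  note cl = terms_closed[OF subringE(1)[OF C] xs]
  have bc: "b \<in> carrier R" using b addspan_closed[OF cl] by auto
  show ?thesis
  proof (rule addspan_map[OF abelian_group_axioms cl a cl, where h = "\<lambda>a. a \<otimes> b"])
    fix x assume x: "x \<in> terms R C xs d"
    then have xc: "x \<in> carrier R" using cl by auto
    show "x \<otimes> b \<in> addspan R (terms R C xs (d + d'))"
    proof (rule addspan_map[OF abelian_group_axioms cl b cl])
      fix y assume y: "y \<in> terms R C xs d'"
      show "x \<otimes> y \<in> addspan R (terms R C xs (d + d'))"
        by (rule addspan_incl[OF terms_mult[OF C xs x y] cl])
    qed (use xc in \<open>auto simp: r_distr\<close>)
  qed (use bc in \<open>auto simp: l_distr\<close>)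
qed

lemma addspan_terms_pow:
  assumes C: "subring C R" and xs: "set xs \<subseteq> carrier R" and a: "a \<in> addspan R (terms R C xs d)"
  shows "a [^] (n::nat) \<in> addspan R (terms R C xs (n * d))"
proof (induction n)
  case 0
  note cl = terms_closed[OF subringE(1)[OF C] xs]
  show ?case using addspan_incl[OF box_terms[OF C xs box_one[OF xs]] cl] by simp
next
  case (Suc n)
  then show ?case using addspan_terms_mult[OF C xs Suc a] by (simp add: add.commute)
qed

end

text \<open>What is kept of the presentation of \<open>R\<close>: \<open>B\<close> spans
  \<open>k\<close> over its \<open>p\<close>-th powers, \<open>xs\<close> lists algebra generators,
  and denominators can be found among the units of \<open>R\<close> that lie in the
  subalgebra.\<close>

locale gauged = cartier R M p \<kappa> f + k: field k
  for R (structure) and M (structure) and p \<kappa> f and k (structure) +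
  fixes g xs B
  assumes g_hom: "g \<in> ring_hom k R" and xs_closed: "set xs \<subseteq> carrier R"
    and B: "finite B" "B \<subseteq> carrier k"
    and B_span: "c \<in> carrier k \<Longrightarrow> c \<in> addspan k {l [^]\<^bsub>k\<^esub> p \<otimes>\<^bsub>k\<^esub> b | l b. l \<in> carrier k \<and> b \<in> B}"
    and loc: "r \<in> carrier R \<Longrightarrow> \<exists>w\<in>Units R \<inter> gen_alg R (g ` carrier k) xs. w \<otimes> r \<in> gen_alg R (g ` carrier k) xs"
begin

abbreviation "\<CC> \<equiv> g ` carrier k"
abbreviation "\<AA> \<equiv> gen_alg R \<CC> xs"

sublocale g: ring_hom_ring k R g
  by (simp add: g_hom k.ring_axioms ring_axioms ring_hom_ringI2)

lemma C_subring: "subring \<CC> R"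
  using g.img_is_subring[OF k.carrier_is_subring] .

lemma A_subring: "subring \<AA> R" by (rule gen_alg_subring[OF C_subring xs_closed])
lemma A_closed: "\<AA> \<subseteq> carrier R" using subringE(1)[OF A_subring] .
lemma C_closed: "\<CC> \<subseteq> carrier R" using subringE(1)[OF C_subring] .

lemma noeth: "noeth_in R (carrier R)"
proof (rule noeth_in_localization[OF A_subring])
  show "noeth_in R \<AA>"
    by (rule gen_alg_noeth[OF C_subring xs_closed noeth_in_field_image[OF k.field_axioms g_hom]])
  show "\<exists>w\<in>Units R. w \<otimes> r \<in> \<AA>" if "r \<in> carrier R" for r using loc[OF that] by blast
qed

lemma A_pow: "a \<in> \<AA> \<Longrightarrow> a [^] (n::nat) \<in> \<AA>"
  by (induction n) (auto simp: subringE(3,6)[OF A_subring])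

lemma clear_denominator:
  assumes E: "E \<subseteq> carrier M" and x: "x \<in> rspan E"
  shows "\<exists>w\<in>Units R \<inter> \<AA>. w \<odot>\<^bsub>M\<^esub> x \<in> mspan M \<AA> E"
  using x unfolding mspan_def[of M "carrier R"]
proof induction
  case addspan_zero
  then show ?case using subringE(3)[OF A_subring] mspan_zero by (intro bexI[of _ \<one>]) auto
next
  case (addspan_add v y)
  obtain r e where v: "v = r \<odot>\<^bsub>M\<^esub> e" "r \<in> carrier R" "e \<in> E" using addspan_add by auto
  obtain w where w: "w \<in> Units R" "w \<in> \<AA>" "w \<odot>\<^bsub>M\<^esub> y \<in> mspan M \<AA> E" using addspan_add by blast
  obtain u where u: "u \<in> Units R" "u \<in> \<AA>" "u \<otimes> r \<in> \<AA>" using loc[OF v(2)] by blast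
  have yc: "y \<in> carrier M" using addspan_add(2) mspan_closed[OF order_refl E] unfolding mspan_def by auto
  have ec: "e \<in> carrier M" using v E by auto
  have uc: "u \<in> carrier R" and wc: "w \<in> carrier R" using u w by auto
  have "(u \<otimes> w) \<odot>\<^bsub>M\<^esub> (v \<oplus>\<^bsub>M\<^esub> y) = (w \<otimes> (u \<otimes> r)) \<odot>\<^bsub>M\<^esub> e \<oplus>\<^bsub>M\<^esub> u \<odot>\<^bsub>M\<^esub> (w \<odot>\<^bsub>M\<^esub> y)"
    unfolding v(1) using yc ec v(2) uc wc by (simp add: smult_r_distr smult_assoc1[symmetric] m_ac)
  moreover have "(w \<otimes> (u \<otimes> r)) \<odot>\<^bsub>M\<^esub> e \<in> mspan M \<AA> E"
    using mspan_smult_incl[OF A_closed E subringE(6)[OF A_subring w(2) u(3)] v(3)] .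
  moreover have "u \<odot>\<^bsub>M\<^esub> (w \<odot>\<^bsub>M\<^esub> y) \<in> mspan M \<AA> E" using mspan_smult[OF A_subring E u(2) w(3)] .
  ultimately have "(u \<otimes> w) \<odot>\<^bsub>M\<^esub> (v \<oplus>\<^bsub>M\<^esub> y) \<in> mspan M \<AA> E" using mspan_plus[OF A_closed E] by simp
  moreover have "u \<otimes> w \<in> Units R \<inter> \<AA>" using u w subringE(6)[OF A_subring] by auto
  ultimately show ?case by blast
qed

lemma clear_denominators:
  assumes E: "E \<subseteq> carrier M" and S: "finite S" "S \<subseteq> rspan E"
  shows "\<exists>w\<in>Units R \<inter> \<AA>. \<forall>x\<in>S. w \<odot>\<^bsub>M\<^esub> x \<in> mspan M \<AA> E"
  using S
proof (induction S rule: finite_induct)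
  case empty
  then show ?case using subringE(3)[OF A_subring] by (intro bexI[of _ \<one>]) auto
next
  case (insert x S)
  obtain w where w: "w \<in> Units R" "w \<in> \<AA>" "\<forall>x\<in>S. w \<odot>\<^bsub>M\<^esub> x \<in> mspan M \<AA> E" using insert by blast
  obtain u where u: "u \<in> Units R" "u \<in> \<AA>" "u \<odot>\<^bsub>M\<^esub> x \<in> mspan M \<AA> E"
    using clear_denominator[OF E, of x] insert.prems by blast
  have uc: "u \<in> carrier R" and wc: "w \<in> carrier R" using u w by auto
  have Sc: "insert x S \<subseteq> carrier M" using insert.prems mspan_closed[OF order_refl E] by blast
  have "(u \<otimes> w) \<odot>\<^bsub>M\<^esub> z \<in> mspan M \<AA> E" if z: "z \<in> insert x S" for z
  proof (cases "z = x")
    case True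
    have "(u \<otimes> w) \<odot>\<^bsub>M\<^esub> z = w \<odot>\<^bsub>M\<^esub> (u \<odot>\<^bsub>M\<^esub> x)" unfolding True
      using uc wc Sc by (simp add: smult_assoc1[symmetric] m_comm)
    then show ?thesis using mspan_smult[OF A_subring E w(2) u(3)] by simp
  next
    case False
    then have zS: "z \<in> S" using z by simp
    have "(u \<otimes> w) \<odot>\<^bsub>M\<^esub> z = u \<odot>\<^bsub>M\<^esub> (w \<odot>\<^bsub>M\<^esub> z)"
      using uc wc Sc zS by (intro smult_assoc1) auto
    then show ?thesis using mspan_smult[OF A_subring E u(2)] w(3) zS by simp
  qed
  moreover have "u \<otimes> w \<in> Units R \<inter> \<AA>" using u w subringE(6)[OF A_subring] by auto
  ultimately show ?case by blast
qed

text \<open>Replacing generators \<open>w\<close> by \<open>u\<^sup>-\<^sup>p w\<close> turns a denominator \<open>u\<close> of \<open>\<kappa>\<close> into the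
  factor \<open>u\<^sup>p\<^sup>-\<^sup>2\<close>.\<close>

lemma adapted_generators:
  assumes "fin_gen R M"
  shows "\<exists>E. finite E \<and> E \<subseteq> carrier M \<and> rspan E = carrier M \<and>
    (\<forall>b\<in>B. \<forall>v\<in>box R xs (p - 1). \<forall>w\<in>E. \<kappa> ((g b \<otimes> v) \<odot>\<^bsub>M\<^esub> w) \<in> mspan M \<AA> E)"
proof -
  obtain E where E: "finite E" "E \<subseteq> carrier M" "rspan E = carrier M"
    using fin_gen_mspan[OF assms] .
  let ?S = "(\<lambda>(b, v, w). \<kappa> ((g b \<otimes> v) \<odot>\<^bsub>M\<^esub> w)) ` (B \<times> box R xs (p - 1) \<times> E)"
  have fS: "finite ?S" using E(1) B(1) finite_box by simp
  have bc: "g b \<otimes> v \<in> carrier R" if "b \<in> B" "v \<in> box R xs (p - 1)" for b v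
    using that B(2) box_closed[OF xs_closed] by (auto simp: subset_iff)
  have "?S \<subseteq> carrier M" using bc E(2) by (auto intro!: \<kappa>_closed)
  then have "?S \<subseteq> rspan E" using E(3) by simp
  then obtain u where u: "u \<in> Units R" "u \<in> \<AA>" "\<forall>x\<in>?S. u \<odot>\<^bsub>M\<^esub> x \<in> mspan M \<AA> E"
    using clear_denominators[OF E(2) fS] by blast
  have uc: "u \<in> carrier R" and ic: "inv u \<in> carrier R" using u(1) by auto
  define i where "i = inv u [^] p"
  have i: "i \<in> carrier R" unfolding i_def using ic by simp
  define E' where "E' = (\<lambda>w. i \<odot>\<^bsub>M\<^esub> w) ` E"
  have E'c: "E' \<subseteq> carrier M" unfolding E'_def using E(2) i by auto
  have up: "u [^] n \<otimes> inv u [^] n = \<one>" for n :: nat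
    using u(1) uc ic by (simp add: nat_pow_distrib[symmetric])
  have scale: "i \<odot>\<^bsub>M\<^esub> x \<in> mspan M D E'" if D: "D \<subseteq> carrier R" and x: "x \<in> mspan M D E" for x D
    unfolding mspan_def
  proof (rule M.addspan_map[OF M.abelian_group_axioms mspan_gens_closed[OF D E(2)] x[unfolded mspan_def]
      mspan_gens_closed[OF D E'c]])
    fix z assume "z \<in> {b \<odot>\<^bsub>M\<^esub> x |b x. b \<in> D \<and> x \<in> E}"
    then obtain b w where z: "z = b \<odot>\<^bsub>M\<^esub> w" "b \<in> D" "w \<in> E" by blast
    have "i \<odot>\<^bsub>M\<^esub> z = b \<odot>\<^bsub>M\<^esub> (i \<odot>\<^bsub>M\<^esub> w)" unfolding z using z D E(2) i
      by (auto simp: smult_assoc1[symmetric] m_comm subset_iff)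
    then have "i \<odot>\<^bsub>M\<^esub> z \<in> {b \<odot>\<^bsub>M\<^esub> x |b x. b \<in> D \<and> x \<in> E'}" using z unfolding E'_def by blast
    then show "i \<odot>\<^bsub>M\<^esub> z \<in> addspan M {b \<odot>\<^bsub>M\<^esub> x |b x. b \<in> D \<and> x \<in> E'}"
      by (rule M.addspan_incl[OF _ mspan_gens_closed[OF D E'c]])
  qed (use i in \<open>auto simp: smult_r_distr\<close>)
  have "rspan E' = carrier M"
  proof
    show "rspan E' \<subseteq> carrier M" using mspan_closed[OF order_refl E'c] .
    show "carrier M \<subseteq> rspan E'"
    proof
      fix x assume x: "x \<in> carrier M"
      have "i \<odot>\<^bsub>M\<^esub> (u [^] p \<odot>\<^bsub>M\<^esub> x) \<in> rspan E'"
        by (rule scale) (use E(3) x uc in auto)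
      moreover have "i \<odot>\<^bsub>M\<^esub> (u [^] p \<odot>\<^bsub>M\<^esub> x) = (u [^] p \<otimes> i) \<odot>\<^bsub>M\<^esub> x"
        using x uc i by (simp add: smult_assoc1[symmetric] m_comm)
      ultimately show "x \<in> rspan E'" using x up[of p] unfolding i_def by simp
    qed
  qed
  moreover have "\<kappa> ((g b \<otimes> v) \<odot>\<^bsub>M\<^esub> w') \<in> mspan M \<AA> E'" if bv: "b \<in> B" "v \<in> box R xs (p - 1)" and w': "w' \<in>
      E'" for b v w'
  proof -
    obtain w where w: "w' = i \<odot>\<^bsub>M\<^esub> w" "w \<in> E" using w' unfolding E'_def by auto
    have wc: "w \<in> carrier M" using w E(2) by auto
    let ?y = "\<kappa> ((g b \<otimes> v) \<odot>\<^bsub>M\<^esub> w)"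
    have yc: "?y \<in> carrier M" using bc[OF bv] wc by (auto intro: \<kappa>_closed)
    have "?y \<in> ?S" using bv w(2) by force
    then have uy: "u \<odot>\<^bsub>M\<^esub> ?y \<in> mspan M \<AA> E" using u(3) by blast
    have "(g b \<otimes> v) \<odot>\<^bsub>M\<^esub> w' = inv u [^] p \<odot>\<^bsub>M\<^esub> ((g b \<otimes> v) \<odot>\<^bsub>M\<^esub> w)"
      unfolding w(1) i_def using bc[OF bv] wc ic by (simp add: smult_assoc1[symmetric] m_comm)
    then have "\<kappa> ((g b \<otimes> v) \<odot>\<^bsub>M\<^esub> w') = inv u \<odot>\<^bsub>M\<^esub> ?y"
      using bc[OF bv] wc ic by (simp add: \<kappa>_smult)
    \<comment> \<open>\<open>\<kappa>\<close> has turned \<open>u^-p\<close> into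
      \<open>u^-1\<close>, which is rewritten as \<open>u^(p-2) u^-p u\<close>. The last factor
      clears the denominator of the value, \<open>u^-p\<close> moves it to the new generators, and
      \<open>u^(p-2)\<close> lies in the subalgebra.\<close>
    also have "inv u = u [^] (p - 2) \<otimes> (i \<otimes> u)"
    proof -
      have "inv u [^] p = inv u [^] (p - 2) \<otimes> (inv u \<otimes> inv u)"
      proof -
        have "inv u [^] (p - 2) \<otimes> inv u [^] (2::nat) = inv u [^] (p - 2 + 2)" using ic by (intro
            nat_pow_mult) auto
        moreover have "p - 2 + 2 = p" using p2 by simp
        moreover have "inv u [^] (2::nat) = inv u \<otimes> inv u" using ic by (simp add: numeral_2_eq_2)
        ultimately show ?thesis by metis
      qed
      then have "u [^] (p - 2) \<otimes> (i \<otimes> u) = (u [^] (p - 2) \<otimes> inv u [^] (p - 2)) \<otimes> (inv u \<otimes> (inv u \<otimes> u))"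
        unfolding i_def using uc ic by (simp add: m_ac)
      then show ?thesis using up[of "p - 2"] u(1) ic by simp
    qed
    also have "\<dots> \<odot>\<^bsub>M\<^esub> ?y = u [^] (p - 2) \<odot>\<^bsub>M\<^esub> (i \<odot>\<^bsub>M\<^esub> (u \<odot>\<^bsub>M\<^esub> ?y))"
      using uc i yc by (simp add: smult_assoc1)
    also have "\<dots> \<in> mspan M \<AA> E'"
      by (rule mspan_smult[OF A_subring E'c A_pow[OF u(2)] scale[OF A_closed uy]])
    finally show ?thesis .
  qed
  moreover have "finite E'" unfolding E'_def using E(1) by simp
  ultimately show ?thesis using E'c by (intro exI[of _ E']) simp
qed

end

section \<open>Gauges of module elements and a bound common to all fixed submodules\<close>

locale gauged_gens = gauged +
  fixes E
  assumes E: "finite E" "E \<subseteq> carrier M" "rspan E = carrier M"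
    and E_adapted: "\<lbrakk>b \<in> B; v \<in> box R xs (p - 1); w \<in> E\<rbrakk> \<Longrightarrow> \<kappa> ((g b \<otimes> v) \<odot>\<^bsub>M\<^esub> w) \<in> mspan M \<AA> E"
begin

text \<open>The elements of gauge at most \<open>d\<close>.\<close>

definition G where "G d = mspan M (terms R \<CC> xs d) E"

lemma terms_carr: "terms R \<CC> xs d \<subseteq> carrier R"
  by (rule terms_closed[OF C_closed xs_closed])

lemma G_closed: "G d \<subseteq> carrier M" unfolding G_def by (rule mspan_closed[OF terms_carr E(2)])

lemma G_zero: "\<zero>\<^bsub>M\<^esub> \<in> G d" unfolding G_def by (rule mspan_zero)

lemma G_plus: "\<lbrakk>x \<in> G d; y \<in> G d\<rbrakk> \<Longrightarrow> x \<oplus>\<^bsub>M\<^esub> y \<in> G d"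
  unfolding G_def by (rule mspan_plus[OF terms_carr E(2)])

lemma G_mono: "d \<le> d' \<Longrightarrow> G d \<subseteq> G d'"
  unfolding G_def by (rule mspan_mono[OF terms_mono]) auto

lemma G_addspan: "addspan M (G d) \<subseteq> G d"
  by (rule addspan_least) (auto intro: G_zero G_plus)

lemma terms_G:
  assumes a: "a \<in> terms R \<CC> xs d" and x: "x \<in> G d'"
  shows "a \<odot>\<^bsub>M\<^esub> x \<in> G (d + d')"
proof -
  have ac: "a \<in> carrier R" using a terms_carr by blast
  show ?thesis unfolding G_def mspan_def
  proof (rule M.addspan_map[OF M.abelian_group_axioms mspan_gens_closed[OF terms_carr E(2)] x[unfolded
      G_def mspan_def] mspan_gens_closed[OF terms_carr E(2)]])
    fix z assume "z \<in> {b \<odot>\<^bsub>M\<^esub> x |b x. b \<in> terms R \<CC> xs d' \<and> x \<in> E}"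
    then obtain b w where z: "z = b \<odot>\<^bsub>M\<^esub> w" "b \<in> terms R \<CC> xs d'" "w \<in> E" by blast
    have "a \<odot>\<^bsub>M\<^esub> z = (a \<otimes> b) \<odot>\<^bsub>M\<^esub> w" unfolding z(1)
      using ac z terms_carr E(2) by (intro smult_assoc1[symmetric]) auto
    moreover have "a \<otimes> b \<in> terms R \<CC> xs (d + d')" by (rule terms_mult[OF C_subring xs_closed a z(2)])
    ultimately have "a \<odot>\<^bsub>M\<^esub> z \<in> {b \<odot>\<^bsub>M\<^esub> x |b x. b \<in> terms R \<CC> xs (d + d') \<and> x \<in> E}" using z(3) by blast
    then show "a \<odot>\<^bsub>M\<^esub> z \<in> addspan M {b \<odot>\<^bsub>M\<^esub> x |b x. b \<in> terms R \<CC> xs (d + d') \<and> x \<in> E}"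
      by (rule M.addspan_incl[OF _ mspan_gens_closed[OF terms_carr E(2)]])
  qed (use ac in \<open>auto simp: smult_r_distr\<close>)
qed

lemma addspan_terms_G:
  assumes a: "a \<in> addspan R (terms R \<CC> xs d)" and x: "x \<in> G d'"
  shows "a \<odot>\<^bsub>M\<^esub> x \<in> G (d + d')"
proof -
  have xc: "x \<in> carrier M" using x G_closed by blast
  have "a \<odot>\<^bsub>M\<^esub> x \<in> addspan M (G (d + d'))"
  proof (rule R.addspan_map[OF M.abelian_group_axioms terms_carr a G_closed, where h = "\<lambda>a. a \<odot>\<^bsub>M\<^esub> x"])
    show "b \<odot>\<^bsub>M\<^esub> x \<in> addspan M (G (d + d'))" if "b \<in> terms R \<CC> xs d" for b
      by (rule M.addspan_incl[OF terms_G[OF that x] G_closed])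
  qed (use xc in \<open>auto simp: smult_l_distr\<close>)
  then show ?thesis using G_addspan by blast
qed

lemma A_span_G:
  assumes "x \<in> mspan M \<AA> E"
  shows "\<exists>d. x \<in> G d"
  using assms unfolding mspan_def[of M \<AA>]
proof induction
  case addspan_zero then show ?case using G_zero by blast
next
  case (addspan_add v y)
  obtain a w where v: "v = a \<odot>\<^bsub>M\<^esub> w" "a \<in> \<AA>" "w \<in> E" using addspan_add by blast
  obtain d where d: "y \<in> G d" using addspan_add by blast
  obtain d' where d': "a \<in> addspan R (terms R \<CC> xs d')"
    using gen_alg_bounded[OF C_subring xs_closed v(2)] by blast
  have "w \<in> E \<Longrightarrow> w \<in> G 0" unfolding G_def
    using mspan_smult_incl[OF terms_carr E(2) box_terms[OF C_subring xs_closed box_one[OF xs_closed]], of w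
        0] E(2) by auto
  then have "v \<in> G (d' + 0)" unfolding v(1) using addspan_terms_G[OF d'] v(3) by blast
  then have "v \<in> G (max d d')" "y \<in> G (max d d')" using d G_mono[of d' "max d d'"] G_mono[of d "max d d'"]
      by auto
  then show ?case using G_plus by blast
qed

lemma G_bound_finite:
  assumes "finite S" "\<And>x. x \<in> S \<Longrightarrow> \<exists>d. x \<in> G d"
  shows "\<exists>d. S \<subseteq> G d"
  using assms
proof (induction S rule: finite_induct)
  case (insert x S)
  obtain d where "x \<in> G d" using insert by blast
  moreover obtain d' where "S \<subseteq> G d'" using insert by blast
  ultimately show ?case using G_mono[of d "max d d'"] G_mono[of d' "max d d'"] by (intro exI[of _ "max d
      d'"]) auto
qed auto

text \<open>Write a coefficient as a sum of \<open>l^p b\<close> with \<open>b\<close> in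
  \<open>B\<close>, and a monomial as \<open>u^p v\<close> with \<open>v\<close> in the box
  \<open>p - 1\<close>. Then \<open>g l\<close> and \<open>u\<close> leave \<open>\<kappa>\<close>,
  contributing gauge \<open>d div p\<close>, and only finitely many values
  \<open>\<kappa> (b v w)\<close> remain; \<open>D\<close> bounds their gauges.\<close>

lemma \<kappa>_gauge: "\<exists>D. \<forall>d. \<forall>x\<in>G d. \<kappa> x \<in> G (d div p + D)"
proof -
  let ?S = "(\<lambda>(b, v, w). \<kappa> ((g b \<otimes> v) \<odot>\<^bsub>M\<^esub> w)) ` (B \<times> box R xs (p - 1) \<times> E)"
  have "finite ?S" using E(1) B(1) finite_box by simp
  moreover have "\<exists>d. x \<in> G d" if "x \<in> ?S" for x using that E_adapted A_span_G by auto
  ultimately obtain D where D: "?S \<subseteq> G D" using G_bound_finite[of ?S] by blast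
  have bc: "v \<in> carrier R" if "v \<in> box R xs d" for v d using box_closed[OF xs_closed] that by blast
  have main: "\<kappa> ((g c \<otimes> m) \<odot>\<^bsub>M\<^esub> w) \<in> G (d div p + D)" if c: "c \<in> carrier k" and m: "m \<in> box R xs d" and w:
      "w \<in> E" for c m w d
  proof -
    have wc: "w \<in> carrier M" using w E(2) by blast
    obtain u v where uv: "u \<in> box R xs (d div p)" "v \<in> box R xs (p - 1)" "m = u [^] p \<otimes> v"
      using box_div[OF xs_closed _ m, of p] p2 by auto
    note uc = bc[OF uv(1)] and vc = bc[OF uv(2)]
    have Bc: "{l [^]\<^bsub>k\<^esub> p \<otimes>\<^bsub>k\<^esub> b | l b. l \<in> carrier k \<and> b \<in> B} \<subseteq> carrier k" using B(2) by auto
    have "\<kappa> ((g c \<otimes> m) \<odot>\<^bsub>M\<^esub> w) \<in> addspan M (G (d div p + D))"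
    proof (rule k.addspan_map[OF M.abelian_group_axioms Bc B_span[OF c] G_closed, where h = "\<lambda>c. \<kappa> ((g c \<otimes>
        m) \<odot>\<^bsub>M\<^esub> w)"])
      show "\<kappa> ((g \<zero>\<^bsub>k\<^esub> \<otimes> m) \<odot>\<^bsub>M\<^esub> w) = \<zero>\<^bsub>M\<^esub>" using bc[OF m] wc \<kappa>_pow_zero[of 1] by simp
      show "\<kappa> ((g (x \<oplus>\<^bsub>k\<^esub> y) \<otimes> m) \<odot>\<^bsub>M\<^esub> w) = \<kappa> ((g x \<otimes> m) \<odot>\<^bsub>M\<^esub> w) \<oplus>\<^bsub>M\<^esub> \<kappa> ((g y \<otimes> m) \<odot>\<^bsub>M\<^esub> w)"
        if "x \<in> carrier k" "y \<in> carrier k" for x y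
        using that bc[OF m] wc by (simp add: l_distr smult_l_distr \<kappa>_add)
      fix x assume "x \<in> {l [^]\<^bsub>k\<^esub> p \<otimes>\<^bsub>k\<^esub> b | l b. l \<in> carrier k \<and> b \<in> B}"
      then obtain l b where x: "x = l [^]\<^bsub>k\<^esub> p \<otimes>\<^bsub>k\<^esub> b" "l \<in> carrier k" "b \<in> B" by blast
      have bk: "b \<in> carrier k" using x(3) B(2) by blast
      have "g x = g l [^] p \<otimes> g b" unfolding x(1) using x(2) bk by (simp add: g.hom_nat_pow)
      then have "(g x \<otimes> m) \<odot>\<^bsub>M\<^esub> w = (g l \<otimes> u) [^] p \<odot>\<^bsub>M\<^esub> ((g b \<otimes> v) \<odot>\<^bsub>M\<^esub> w)"
        unfolding uv(3) using x(2) bk uc vc wc by (simp add: smult_assoc1[symmetric] nat_pow_distrib m_ac)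
      then have eq: "\<kappa> ((g x \<otimes> m) \<odot>\<^bsub>M\<^esub> w) = (g l \<otimes> u) \<odot>\<^bsub>M\<^esub> \<kappa> ((g b \<otimes> v) \<odot>\<^bsub>M\<^esub> w)"
        using x(2) bk uc vc wc by (simp add: \<kappa>_smult)
      have "\<kappa> ((g b \<otimes> v) \<odot>\<^bsub>M\<^esub> w) \<in> ?S" using x(3) uv(2) w by force
      then have "\<kappa> ((g b \<otimes> v) \<odot>\<^bsub>M\<^esub> w) \<in> G D" using D by blast
      moreover have "g l \<otimes> u \<in> terms R \<CC> xs (d div p)" using x(2) uv(1) unfolding terms_def by blast
      ultimately have "\<kappa> ((g x \<otimes> m) \<odot>\<^bsub>M\<^esub> w) \<in> G (d div p + D)" unfolding eq using terms_G by blast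
      then show "\<kappa> ((g x \<otimes> m) \<odot>\<^bsub>M\<^esub> w) \<in> addspan M (G (d div p + D))" by (rule M.addspan_incl[OF _ G_closed])
    qed
    then show ?thesis using G_addspan by blast
  qed
  have "\<kappa> x \<in> G (d div p + D)" if x: "x \<in> G d" for x d
  proof -
    have "\<kappa> x \<in> addspan M (G (d div p + D))"
    proof (rule M.addspan_map[OF M.abelian_group_axioms mspan_gens_closed[OF terms_carr E(2)] x[unfolded
        G_def mspan_def] G_closed])
      fix z assume "z \<in> {b \<odot>\<^bsub>M\<^esub> x |b x. b \<in> terms R \<CC> xs d \<and> x \<in> E}"
      then obtain b w where z: "z = b \<odot>\<^bsub>M\<^esub> w" "b \<in> terms R \<CC> xs d" "w \<in> E" by blast
      then obtain c m where "b = g c \<otimes> m" "c \<in> carrier k" "m \<in> box R xs d" unfolding terms_def by blast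
      then have "\<kappa> z \<in> G (d div p + D)" using main z by blast
      then show "\<kappa> z \<in> addspan M (G (d div p + D))" by (rule M.addspan_incl[OF _ G_closed])
    qed (use \<kappa>_pow_zero[of 1] in \<open>auto simp: \<kappa>_add\<close>)
    then show ?thesis using G_addspan by blast
  qed
  then show ?thesis by blast
qed

text \<open>The errors made in successive steps are themselves divided by \<open>p\<close>, so they
  add up like a geometric series; \<open>2 * D\<close> suffices because
  \<open>p \<ge> 2\<close>.\<close>

lemma \<kappa>_pow_gauge: "\<exists>D. \<forall>e d. \<forall>x\<in>G d. (\<kappa> ^^ e) x \<in> G (d div p ^ e + 2 * D)"
proof -
  obtain D where D: "\<And>d x. x \<in> G d \<Longrightarrow> \<kappa> x \<in> G (d div p + D)" using \<kappa>_gauge by blast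
  have "(\<kappa> ^^ e) x \<in> G (d div p ^ e + 2 * D)" if "x \<in> G d" for e d x
  proof (induction e)
    case 0 show ?case using that G_mono[of d "d + 2 * D"] by auto
  next
    case (Suc e)
    have "(\<kappa> ^^ Suc e) x \<in> G ((d div p ^ e + 2 * D) div p + D)" using D[OF Suc] by simp
    moreover have "(d div p ^ e + 2 * D) div p + D \<le> d div p ^ Suc e + 2 * D"
    proof -
      have "(d div p ^ e + 2 * D) div p \<le> (d div p ^ e + D * p) div p"
        using p2 by (intro div_le_mono) (simp add: mult.commute)
      also have "\<dots> = d div p ^ e div p + D" using p2 by simp
      also have "d div p ^ e div p = d div p ^ Suc e" by (simp add: div_mult2_eq[symmetric] mult.commute)
      finally show ?thesis by simp
    qed
    ultimately show ?case using G_mono by blast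
  qed
  then show ?thesis by blast
qed

lemma f_bounded: "\<exists>w\<in>Units R. \<exists>\<delta>. w \<otimes> f \<in> addspan R (terms R \<CC> xs \<delta>)"
  using loc[OF f_closed] gen_alg_bounded[OF C_subring xs_closed] by blast

text \<open>Since \<open>N = \<C>\<^sub>+\<^sup>h N\<close> for all \<open>h\<close>, only large \<open>e\<close> matter, and \<open>\<kappa>\<^sup>e\<close> then divides away the gauge of the
  generators of \<open>N\<close>; what survives comes from \<open>f\<^bsup>\<lceil>t p\<^sup>e\<rceil>\<^esup>\<close> and is, up to a constant, at most
  \<open>\<lceil>t\<rceil>\<close> times the gauge of \<open>f\<close>.\<close>

lemma fpure_gauge_bound:
  "\<exists>K. \<forall>N. csub t N \<longrightarrow> cp t N = N \<longrightarrow> N \<subseteq> rspan (N \<inter> G K)"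
proof -
  obtain D where D: "\<And>e d x. x \<in> G d \<Longrightarrow> (\<kappa> ^^ e) x \<in> G (d div p ^ e + 2 * D)" using \<kappa>_pow_gauge by blast
  obtain wf \<delta> where wf: "wf \<in> Units R" "wf \<otimes> f \<in> addspan R (terms R \<CC> xs \<delta>)" using f_bounded by blast
  define f0 where "f0 = wf \<otimes> f"
  have wfc: "wf \<in> carrier R" "inv wf \<in> carrier R" using wf(1) by auto
  have f0c: "f0 \<in> carrier R" unfolding f0_def using wfc by simp
  have f_f0: "f = inv wf \<otimes> f0" unfolding f0_def using wf(1) wfc by (simp add: m_assoc[symmetric])
  define T where "T = fexp p t 0"
  \<comment> \<open>After division by \<open>p^e\<close>: \<open>T * \<delta>\<close> comes from the
    power of \<open>f\<close>, one unit from the remainder monomial in the box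
    \<open>p^e - 1\<close>, one from \<open>d \<le> p^e\<close>, and \<open>2 * D\<close> from
    \<open>\<kappa>^e\<close> itself.\<close>
  define K where "K = T * \<delta> + 2 + 2 * D"
  have "N \<subseteq> rspan (N \<inter> G K)" if N: "csub t N" "cp t N = N" for N
  proof -
    note Ns = csub_submodule[OF N(1)] and Nc = csub_closed[OF N(1)]
    obtain F where F: "finite F" "F \<subseteq> N" "N = rspan F"
      using noetherian_submodule[OF noeth E(1,2) Ns] E(3) Nc by auto
    obtain w where w: "w \<in> Units R" "\<forall>x\<in>F. w \<odot>\<^bsub>M\<^esub> x \<in> mspan M \<AA> E"
      using clear_denominators[OF E(2) F(1)] F(2) Nc E(3) by blast
    have wc: "w \<in> carrier R" "inv w \<in> carrier R" using w(1) by auto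
    define F' where "F' = (\<lambda>x. w \<odot>\<^bsub>M\<^esub> x) ` F"
    have "\<exists>d. F' \<subseteq> G d"
      by (rule G_bound_finite) (use F(1) w(2) A_span_G in \<open>auto simp: F'_def\<close>)
    then obtain d where d: "F' \<subseteq> G d" by blast
    have F'N: "F' \<subseteq> N" unfolding F'_def using F(2) submoduleE(4)[OF Ns wc(1)] by auto
    define L where "L = N \<inter> G d"
    have Lc: "L \<subseteq> carrier M" unfolding L_def using Nc by auto
    have "F \<subseteq> rspan L"
    proof
      fix x assume x: "x \<in> F"
      then have xc: "x \<in> carrier M" using F(2) Nc by auto
      have "w \<odot>\<^bsub>M\<^esub> x \<in> L" using x d F'N unfolding L_def F'_def by auto
      then have "inv w \<odot>\<^bsub>M\<^esub> (w \<odot>\<^bsub>M\<^esub> x) \<in> rspan L" by (rule mspan_smult_incl[OF order_refl Lc wc(2)])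
      then show "x \<in> rspan L" using w(1) wc xc by (simp add: smult_assoc1[symmetric])
    qed
    then have NL: "N \<subseteq> rspan L" unfolding F(3) by (rule mspan_subset_submodule[OF submodule_mspan[OF Lc]])
    define Q where "Q = N \<inter> G K"
    have Qc: "Q \<subseteq> carrier M" unfolding Q_def using Nc by auto
    note Qs = submodule_mspan[OF Qc]
    \<comment> \<open>The part \<open>u\<close> of the monomial leaves \<open>\<kappa>^e\<close> as
      a ring coefficient and costs nothing, since only the \<open>R\<close>-span of \<open>Q\<close>
      has to be reached; the remainder \<open>v\<close> is all that is measured.\<close>
    have key: "(\<kappa> ^^ e) ((f0 [^] fexp p t e \<otimes> (c \<otimes> m)) \<odot>\<^bsub>M\<^esub> n) \<in> rspan Q"
      if e: "e \<ge> 1" "d \<le> p ^ e" and c: "c \<in> \<CC>" and m: "m \<in> box R xs j" and n: "n \<in> L" for e c m j n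
    proof -
      let ?q = "p ^ e" and ?N = "fexp p t e"
      have q1: "?q \<ge> 1" using p2 by simp
      obtain u v where uv: "u \<in> box R xs (j div ?q)" "v \<in> box R xs (?q - 1)" "m = u [^] ?q \<otimes> v"
        using box_div[OF xs_closed q1 m] by blast
      have cc: "c \<in> carrier R" "u \<in> carrier R" "v \<in> carrier R" "n \<in> carrier M"
        using c C_closed uv box_closed[OF xs_closed] n Lc by auto
      let ?z = "(\<kappa> ^^ e) ((f0 [^] ?N \<otimes> (c \<otimes> v)) \<odot>\<^bsub>M\<^esub> n)"
      have "(f0 [^] ?N \<otimes> (c \<otimes> m)) \<odot>\<^bsub>M\<^esub> n = u [^] ?q \<odot>\<^bsub>M\<^esub> ((f0 [^] ?N \<otimes> (c \<otimes> v)) \<odot>\<^bsub>M\<^esub> n)"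
        unfolding uv(3) using cc f0c by (simp add: smult_assoc1[symmetric] m_ac)
      then have eq: "(\<kappa> ^^ e) ((f0 [^] ?N \<otimes> (c \<otimes> m)) \<odot>\<^bsub>M\<^esub> n) = u \<odot>\<^bsub>M\<^esub> ?z"
        using cc f0c by (simp add: \<kappa>_pow_smult)
      have cv: "c \<otimes> v \<in> terms R \<CC> xs (?q - 1)" using c uv(2) unfolding terms_def by blast
      have "f0 [^] ?N \<odot>\<^bsub>M\<^esub> ((c \<otimes> v) \<odot>\<^bsub>M\<^esub> n) \<in> G (?N * \<delta> + ((?q - 1) + d))"
        using addspan_terms_G[OF addspan_terms_pow[OF C_subring xs_closed wf(2)] terms_G[OF cv]] n
        unfolding L_def f0_def by blast
      then have "(f0 [^] ?N \<otimes> (c \<otimes> v)) \<odot>\<^bsub>M\<^esub> n \<in> G (?N * \<delta> + ((?q - 1) + d))"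
        using f0c cc by (simp add: smult_assoc1)
      then have "?z \<in> G ((?N * \<delta> + ((?q - 1) + d)) div ?q + 2 * D)" by (rule D)
      moreover have "(?N * \<delta> + ((?q - 1) + d)) div ?q + 2 * D \<le> K"
      proof -
        have "?N * \<delta> \<le> T * ?q * \<delta>" unfolding T_def by (intro mult_right_mono fexp_le) auto
        then have "?N * \<delta> + ((?q - 1) + d) \<le> T * ?q * \<delta> + (?q + ?q)" using e(2) by linarith
        also have "\<dots> = (T * \<delta> + 2) * ?q" by (simp add: algebra_simps)
        finally have "?N * \<delta> + ((?q - 1) + d) \<le> (T * \<delta> + 2) * ?q" .
        then have "(?N * \<delta> + ((?q - 1) + d)) div ?q \<le> (T * \<delta> + 2) * ?q div ?q" by (rule div_le_mono)
        also have "\<dots> = T * \<delta> + 2" by (rule nonzero_mult_div_cancel_right) (use q1 in linarith)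
        finally show ?thesis unfolding K_def by simp
      qed
      ultimately have zG: "?z \<in> G K" using G_mono by blast
      have "f [^] ?N \<otimes> wf [^] ?N = f0 [^] ?N" unfolding f0_def using wfc by (simp add: nat_pow_distrib m_comm)
      then have "?z = cop t e (wf [^] ?N \<otimes> (c \<otimes> v)) n"
        unfolding cop_def using wfc cc f0c by (simp add: m_assoc[symmetric])
      moreover have "\<dots> \<in> N" by (rule csub_cop[OF N(1) e(1)]) (use wfc cc n in \<open>auto simp: L_def\<close>)
      ultimately have "?z \<in> Q" using zG unfolding Q_def by simp
      then show ?thesis unfolding eq by (rule mspan_smult_incl[OF order_refl Qc cc(2)])
    qed
    have gen: "cop t e r n \<in> rspan Q" if e: "e \<ge> 1" "d \<le> p ^ e" and r: "r \<in> carrier R" and n: "n \<in> L" for e r n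
    proof -
      let ?q = "p ^ e" and ?N = "fexp p t e"
      have nc: "n \<in> carrier M" using n Lc by auto
      have q1: "?q \<ge> 1" using p2 by simp
      let ?r = "inv wf [^] ?N \<otimes> r"
      have rc: "?r \<in> carrier R" using wfc r by simp
      obtain u where u: "u \<in> Units R" "u \<in> \<AA>" "u \<otimes> ?r \<in> \<AA>" using loc[OF rc] by blast
      have uc: "u \<in> carrier R" "inv u \<in> carrier R" using u(1) by auto
      \<comment> \<open>\<open>u\<close> alone would already clear the denominator of
        \<open>?r\<close>. Its \<open>p^e\<close>-th power is taken because that passes through
        \<open>\<kappa>^e\<close> and can be cancelled by \<open>inv u\<close> outside.\<close>
      let ?a = "u [^] ?q \<otimes> ?r"
      obtain n' where "?q = Suc n'" using q1 by (cases ?q) auto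
      then have "u [^] ?q = u [^] (?q - 1) \<otimes> u" by simp
      then have "?a = u [^] (?q - 1) \<otimes> (u \<otimes> ?r)" using uc rc by (simp add: m_assoc)
      then have aA: "?a \<in> \<AA>" using subringE(6)[OF A_subring A_pow[OF u(2)] u(3)] by simp
      obtain j where j: "?a \<in> addspan R (terms R \<CC> xs j)" using gen_alg_bounded[OF C_subring xs_closed aA]
          by blast
      have "(\<kappa> ^^ e) ((f0 [^] ?N \<otimes> ?a) \<odot>\<^bsub>M\<^esub> n) \<in> addspan M (rspan Q)"
      proof (rule R.addspan_map[OF M.abelian_group_axioms terms_carr j mspan_closed[OF order_refl Qc],
          where h = "\<lambda>a. (\<kappa> ^^ e) ((f0 [^] ?N \<otimes> a) \<odot>\<^bsub>M\<^esub> n)"])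
        fix x assume "x \<in> terms R \<CC> xs j"
        then obtain c m where x: "x = c \<otimes> m" "c \<in> \<CC>" "m \<in> box R xs j" unfolding terms_def by blast
        show "(\<kappa> ^^ e) ((f0 [^] ?N \<otimes> x) \<odot>\<^bsub>M\<^esub> n) \<in> addspan M (rspan Q)"
          unfolding x(1) by (rule M.addspan_incl[OF key[OF e x(2,3) n] mspan_closed[OF order_refl Qc]])
      qed (use f0c nc in \<open>auto simp: r_distr smult_l_distr \<kappa>_pow_add \<kappa>_pow_zero\<close>)
      moreover have "addspan M (rspan Q) \<subseteq> rspan Q"
        by (rule addspan_least) (use mspan_zero mspan_plus[OF order_refl Qc] in auto)
      ultimately have y: "(\<kappa> ^^ e) ((f0 [^] ?N \<otimes> ?a) \<odot>\<^bsub>M\<^esub> n) \<in> rspan Q" by blast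
      have fN: "f [^] ?N = inv wf [^] ?N \<otimes> f0 [^] ?N" by (subst f_f0) (use wfc f0c in \<open>simp add:
          nat_pow_distrib\<close>)
      have "inv u \<odot>\<^bsub>M\<^esub> (\<kappa> ^^ e) ((f0 [^] ?N \<otimes> ?a) \<odot>\<^bsub>M\<^esub> n) = (\<kappa> ^^ e) ((inv u [^] ?q \<otimes> (f0 [^] ?N \<otimes> ?a)) \<odot>\<^bsub>M\<^esub> n)"
        using uc f0c rc nc by (simp add: \<kappa>_pow_smult[symmetric] smult_assoc1)
      also have "inv u [^] ?q \<otimes> (f0 [^] ?N \<otimes> ?a) = (inv u [^] ?q \<otimes> u [^] ?q) \<otimes> (f0 [^] ?N \<otimes> ?r)"
        using uc f0c rc by (simp add: m_ac)
      also have "inv u [^] ?q \<otimes> u [^] ?q = \<one>" using uc u(1) by (simp add: nat_pow_distrib[symmetric])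
      also have "\<one> \<otimes> (f0 [^] ?N \<otimes> ?r) = f [^] ?N \<otimes> r" unfolding fN using wfc f0c r by (simp add: m_ac)
      finally have "cop t e r n = inv u \<odot>\<^bsub>M\<^esub> (\<kappa> ^^ e) ((f0 [^] ?N \<otimes> ?a) \<odot>\<^bsub>M\<^esub> n)" unfolding cop_def by simp
      then show ?thesis using submoduleE(4)[OF Qs uc(2) y] by simp
    qed
    have pw: "(cp t ^^ n) N = N" for n by (induction n) (auto simp: N(2))
    \<comment> \<open>Only degrees above \<open>d\<close> occur, hence \<open>d \<le> p^e\<close>.
      This removes the gauge \<open>d\<close> of the chosen generators of \<open>N\<close> from the
      bound.\<close>
    have "N \<subseteq> addspan M (cgens t (Suc d) N)"
      using cp_pow_span[OF N(1), of d] unfolding pw .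
    also have "\<dots> \<subseteq> rspan Q"
    proof (rule addspan_least)
      show "(cgens t (Suc d) N) \<subseteq> rspan Q"
      proof
        fix x assume "x \<in> (cgens t (Suc d) N)"
        then obtain e r n where x: "x = cop t e r n" "e \<ge> Suc d" "r \<in> carrier R" "n \<in> N" by blast
        have "e < p ^ e" using p2 by (intro power_gt_expt) auto
        then have e: "e \<ge> 1" "d \<le> p ^ e" using x(2) by auto
        have n: "n \<in> addspan M {b \<odot>\<^bsub>M\<^esub> y | b y. b \<in> carrier R \<and> y \<in> L}" using x(4) NL unfolding mspan_def
            by blast
        have "cop t e r n \<in> addspan M (rspan Q)"
        proof (rule M.addspan_map[OF M.abelian_group_axioms mspan_gens_closed[OF order_refl Lc] n
            mspan_closed[OF order_refl Qc]])
          fix y assume "y \<in> {b \<odot>\<^bsub>M\<^esub> y | b y. b \<in> carrier R \<and> y \<in> L}"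
          then obtain b l where y: "y = b \<odot>\<^bsub>M\<^esub> l" "b \<in> carrier R" "l \<in> L" by blast
          have "cop t e r y = cop t e (r \<otimes> b) l" unfolding y(1) using x(3) y Lc by (intro cop_smult) auto
          then have "cop t e r y \<in> rspan Q" using gen[OF e _ y(3), of "r \<otimes> b"] x(3) y(2) by simp
          then show "cop t e r y \<in> addspan M (rspan Q)"
            by (rule M.addspan_incl[OF _ mspan_closed[OF order_refl Qc]])
        qed (use x(3) in \<open>auto simp: cop_zero cop_add\<close>)
        moreover have "addspan M (rspan Q) \<subseteq> rspan Q"
          by (rule addspan_least) (use mspan_zero mspan_plus[OF order_refl Qc] in auto)
        ultimately show "x \<in> rspan Q" unfolding x(1) by blast
      qed
    qed (use mspan_zero mspan_plus[OF order_refl Qc] in auto)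
    finally show ?thesis unfolding Q_def .
  qed
  then show ?thesis by blast
qed

text \<open>\<open>M\<close> with scalars restricted along \<open>g\<close>. Over the field
  \<open>k\<close> the chain lemma can be used at the zero ideal, where its multiplier is invertible
  and generic stability becomes stability.\<close>

definition kM where
  "kM = \<lparr>carrier = carrier M, monoid.mult = undefined, monoid.one = undefined,
     ring.zero = \<zero>\<^bsub>M\<^esub>, ring.add = (\<oplus>\<^bsub>M\<^esub>), smult = (\<lambda>c x. g c \<odot>\<^bsub>M\<^esub> x)\<rparr>"

lemma kM_sel [simp]: "carrier kM = carrier M" "\<zero>\<^bsub>kM\<^esub> = \<zero>\<^bsub>M\<^esub>" "x \<oplus>\<^bsub>kM\<^esub> y = x \<oplus>\<^bsub>M\<^esub> y" "c \<odot>\<^bsub>kM\<^esub> x = g c \<odot>\<^bsub>M\<^esub> x"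
  unfolding kM_def by auto

lemma kM_module: "module k kM"
proof (rule moduleI)
  show "cring k" by (rule k.is_cring)
  show "abelian_group kM"
    by (rule abelian_groupI) (auto simp: M.a_ac intro: M.l_neg)
qed (auto simp: smult_l_distr smult_r_distr smult_assoc1)

text \<open>\<open>G K\<close> lies in the \<open>k\<close>-span of the finite set \<open>F\<close>
  of monomials in the box \<open>K\<close> applied to \<open>E\<close>, and the traces
  \<open>V n \<inter> G K\<close> are \<open>k\<close>-subspaces of it.\<close>

lemma gauge_dcc:
  assumes V: "\<And>n. submodule (V n) R M" and dec: "\<And>n. V (Suc n) \<inter> G K \<subseteq> V n"
  shows "\<exists>n. V n \<inter> G K = V (Suc n) \<inter> G K"
proof -
  interpret kM: module k kM by (rule kM_module)
  define F where "F = (\<lambda>(m, w). m \<odot>\<^bsub>M\<^esub> w) ` (box R xs K \<times> E)"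
  have F: "finite F" unfolding F_def using finite_box E(1) by simp
  have Fc: "F \<subseteq> carrier M" unfolding F_def using box_closed[OF xs_closed] E(2) by auto
  have GF: "G K \<subseteq> mspan kM (carrier k) F" unfolding G_def
  proof (rule mspan_least)
    fix b x assume b: "b \<in> terms R \<CC> xs K" and x: "x \<in> E"
    then obtain c m where cm: "b = g c \<otimes> m" "c \<in> carrier k" "m \<in> box R xs K" unfolding terms_def by blast
    have "b \<odot>\<^bsub>M\<^esub> x = c \<odot>\<^bsub>kM\<^esub> (m \<odot>\<^bsub>M\<^esub> x)" unfolding cm(1)
      using cm box_closed[OF xs_closed, of K] x E(2) by (auto intro!: smult_assoc1)
    moreover have "m \<odot>\<^bsub>M\<^esub> x \<in> F" using cm x unfolding F_def by force
    ultimately show "b \<odot>\<^bsub>M\<^esub> x \<in> mspan kM (carrier k) F"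
      using kM.mspan_smult_incl[OF order_refl _ cm(2), of F "m \<odot>\<^bsub>M\<^esub> x"] Fc by simp
  next
    show "\<zero>\<^bsub>M\<^esub> \<in> mspan kM (carrier k) F" using kM.mspan_zero by simp
    show "x \<oplus>\<^bsub>M\<^esub> y \<in> mspan kM (carrier k) F" if "x \<in> mspan kM (carrier k) F" "y \<in> mspan kM (carrier k) F"
        for x y
      using kM.mspan_plus[OF order_refl _ that] Fc by simp
  qed
  have "\<exists>n0. \<forall>n\<ge>n0. \<exists>s\<in>carrier k - {\<zero>\<^bsub>k\<^esub>}. \<forall>x\<in>V n \<inter> G K. s \<odot>\<^bsub>kM\<^esub> x \<in> V (Suc n) \<inter> G K"
  proof (rule kM.chain_generically_stable[OF k.zeroprimeideal k.one_closed _ F])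
    show "\<one>\<^bsub>k\<^esub> \<notin> {\<zero>\<^bsub>k\<^esub>}" by simp
    show "F \<subseteq> carrier kM" using Fc by simp
    show "submodule (V n \<inter> G K) k kM" for n
    proof (rule kM.submodule_if_closed)
      show "V n \<inter> G K \<subseteq> carrier kM" using G_closed by auto
      show "\<zero>\<^bsub>kM\<^esub> \<in> V n \<inter> G K" using submodule_zero[OF V] G_zero by simp
      show "a \<oplus>\<^bsub>kM\<^esub> b \<in> V n \<inter> G K" if "a \<in> V n \<inter> G K" "b \<in> V n \<inter> G K" for a b
        using that G_plus submoduleE(5)[OF V] by auto
      show "a \<odot>\<^bsub>kM\<^esub> x \<in> V n \<inter> G K" if "a \<in> carrier k" "x \<in> V n \<inter> G K" for a x
      proof -
        have "g a = g a \<otimes> \<one>" using that by simp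
        then have "g a \<in> terms R \<CC> xs 0" using that(1) box_one[OF xs_closed] unfolding terms_def by blast
        then have "g a \<odot>\<^bsub>M\<^esub> x \<in> G (0 + K)" using terms_G that(2) by blast
        then show ?thesis using that submoduleE(4)[OF V] by simp
      qed
    qed
    show "V (Suc n) \<inter> G K \<subseteq> V n \<inter> G K" for n using dec by blast
    show "V n \<inter> G K \<subseteq> mspan kM (carrier k) F" for n using GF by blast
    show "(\<one>\<^bsub>k\<^esub> \<otimes>\<^bsub>k\<^esub> a) \<odot>\<^bsub>kM\<^esub> x \<in> V n \<inter> G K" if "a \<in> {\<zero>\<^bsub>k\<^esub>}" "x \<in> mspan kM (carrier k) F" for a x n
    proof -
      have "x \<in> carrier M" using that(2) kM.mspan_closed[OF order_refl, of F] Fc by auto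
      then show ?thesis using that(1) submodule_zero[OF V] G_zero by simp
    qed
  qed
  then obtain n where "\<exists>s\<in>carrier k - {\<zero>\<^bsub>k\<^esub>}. \<forall>x\<in>V n \<inter> G K. s \<odot>\<^bsub>kM\<^esub> x \<in> V (Suc n) \<inter> G K" by blast
  then obtain s where s: "s \<in> carrier k" "s \<noteq> \<zero>\<^bsub>k\<^esub>" "\<And>x. x \<in> V n \<inter> G K \<Longrightarrow> g s \<odot>\<^bsub>M\<^esub> x \<in> V (Suc n) \<inter> G K"
    unfolding kM_sel by blast
  have su: "s \<in> Units k" using s k.field_Units by auto
  then have ic: "inv\<^bsub>k\<^esub> s \<in> carrier k" by simp
  have "V n \<inter> G K \<subseteq> V (Suc n)"
  proof
    fix x assume x: "x \<in> V n \<inter> G K"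
    then have xc: "x \<in> carrier M" using G_closed by auto
    have "g (inv\<^bsub>k\<^esub> s) \<odot>\<^bsub>M\<^esub> (g s \<odot>\<^bsub>M\<^esub> x) \<in> V (Suc n)" using submoduleE(4)[OF V] s(3)[OF x] ic by simp
    moreover have "g (inv\<^bsub>k\<^esub> s) \<odot>\<^bsub>M\<^esub> (g s \<odot>\<^bsub>M\<^esub> x) = g (inv\<^bsub>k\<^esub> s \<otimes>\<^bsub>k\<^esub> s) \<odot>\<^bsub>M\<^esub> x"
      using ic s(1) xc by (simp add: smult_assoc1)
    ultimately show "x \<in> V (Suc n)" using su xc by simp
  qed
  then show ?thesis using dec by blast
qed

end

section \<open>Localization and existence of test modules\<close>

lemma (in primeideal) compl_one: "\<one> \<in> carrier R - I"
  using I_notcarr one_imp_carrier by auto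

lemma (in primeideal) compl_mult: "\<lbrakk>a \<in> carrier R - I; b \<in> carrier R - I\<rbrakk> \<Longrightarrow> a \<otimes> b \<in> carrier R - I"
  using I_prime by auto

lemma (in primeideal) compl_pow: "a \<in> carrier R - I \<Longrightarrow> a [^] (n::nat) \<in> carrier R - I"
proof (induction n)
  case 0 show ?case using compl_one by simp
next
  case (Suc n) then show ?case using compl_mult[OF Suc.IH[OF Suc.prems] Suc.prems] by simp
qed

section \<open>Comparison of submodules at a prime\<close>

context module begin

text \<open>\<open>H\<^sub>P \<subseteq> K\<^sub>P\<close> as submodules of \<open>M\<^sub>P\<close>.\<close>

definition loc_le :: "'a set \<Rightarrow> 'c set \<Rightarrow> 'c set \<Rightarrow> bool" where
  "loc_le P H K \<longleftrightarrow> (\<forall>x\<in>H. \<exists>s\<in>carrier R - P. s \<odot>\<^bsub>M\<^esub> x \<in> K)"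

lemma loc_leD: "\<lbrakk>loc_le P H K; x \<in> H\<rbrakk> \<Longrightarrow> \<exists>s\<in>carrier R - P. s \<odot>\<^bsub>M\<^esub> x \<in> K"
  unfolding loc_le_def by blast

lemma loc_le_subset: "\<lbrakk>primeideal P R; H \<subseteq> K; H \<subseteq> carrier M\<rbrakk> \<Longrightarrow> loc_le P H K"
  unfolding loc_le_def using primeideal.compl_one[of P R] by (auto intro!: bexI[of _ "\<one>"] simp: subset_iff)

lemma loc_frac_scale:
  assumes P: "primeideal P R" and m: "m \<in> carrier M" and s: "s \<in> carrier R - P" and w: "w \<in> carrier R - P"
  shows "loc_frac R M P m s = loc_frac R M P (w \<odot>\<^bsub>M\<^esub> m) (w \<otimes> s)"
proof -
  have "(\<exists>u\<in>carrier R - P. u \<odot>\<^bsub>M\<^esub> (s' \<odot>\<^bsub>M\<^esub> m) = u \<odot>\<^bsub>M\<^esub> (s \<odot>\<^bsub>M\<^esub> m')) \<longleftrightarrow>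
    (\<exists>u\<in>carrier R - P. u \<odot>\<^bsub>M\<^esub> (s' \<odot>\<^bsub>M\<^esub> (w \<odot>\<^bsub>M\<^esub> m)) = u \<odot>\<^bsub>M\<^esub> ((w \<otimes> s) \<odot>\<^bsub>M\<^esub> m'))" (is "?A \<longleftrightarrow> ?B")
    if m': "m' \<in> carrier M" and s': "s' \<in> carrier R - P" for m' s'
  proof -
    have eq: "u \<odot>\<^bsub>M\<^esub> (s' \<odot>\<^bsub>M\<^esub> (w \<odot>\<^bsub>M\<^esub> m)) = w \<odot>\<^bsub>M\<^esub> (u \<odot>\<^bsub>M\<^esub> (s' \<odot>\<^bsub>M\<^esub> m))"
      "u \<odot>\<^bsub>M\<^esub> ((w \<otimes> s) \<odot>\<^bsub>M\<^esub> m') = w \<odot>\<^bsub>M\<^esub> (u \<odot>\<^bsub>M\<^esub> (s \<odot>\<^bsub>M\<^esub> m'))"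
      "(u \<otimes> w) \<odot>\<^bsub>M\<^esub> (s' \<odot>\<^bsub>M\<^esub> m) = w \<odot>\<^bsub>M\<^esub> (u \<odot>\<^bsub>M\<^esub> (s' \<odot>\<^bsub>M\<^esub> m))"
      "(u \<otimes> w) \<odot>\<^bsub>M\<^esub> (s \<odot>\<^bsub>M\<^esub> m') = w \<odot>\<^bsub>M\<^esub> (u \<odot>\<^bsub>M\<^esub> (s \<odot>\<^bsub>M\<^esub> m'))" if "u \<in> carrier R" for u
      using that m m' s s' w by (auto simp: smult_assoc1[symmetric] m_ac)
    show ?thesis
    proof
      assume ?A
      then obtain u where u: "u \<in> carrier R - P" "u \<odot>\<^bsub>M\<^esub> (s' \<odot>\<^bsub>M\<^esub> m) = u \<odot>\<^bsub>M\<^esub> (s \<odot>\<^bsub>M\<^esub> m')" ..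
      then show ?B using eq(1,2)[of u] by (intro bexI[of _ u]) auto
    next
      assume ?B
      then obtain u where u: "u \<in> carrier R - P" "u \<odot>\<^bsub>M\<^esub> (s' \<odot>\<^bsub>M\<^esub> (w \<odot>\<^bsub>M\<^esub> m)) = u \<odot>\<^bsub>M\<^esub> ((w \<otimes> s) \<odot>\<^bsub>M\<^esub> m')"
          by blast
      then have "(u \<otimes> w) \<odot>\<^bsub>M\<^esub> (s' \<odot>\<^bsub>M\<^esub> m) = (u \<otimes> w) \<odot>\<^bsub>M\<^esub> (s \<odot>\<^bsub>M\<^esub> m')" using eq by auto
      then show ?A using primeideal.compl_mult[OF P u(1) w] by blast
    qed
  qed
  then show ?thesis unfolding loc_frac_def by blast
qed

lemma loc_sub_subset:
  assumes P: "primeideal P R" and H: "submodule H R M" and le: "loc_le P H K"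
  shows "loc_sub R M P H \<subseteq> loc_sub R M P K"
proof
  fix z assume "z \<in> loc_sub R M P H"
  then obtain m s where z: "z = loc_frac R M P m s" "m \<in> H" "s \<in> carrier R - P" unfolding loc_sub_def by blast
  obtain w where w: "w \<in> carrier R - P" "w \<odot>\<^bsub>M\<^esub> m \<in> K" using loc_leD[OF le z(2)] by blast
  have mc: "m \<in> carrier M" using z(2) submoduleE(1)[OF H] by blast
  have "z = loc_frac R M P (w \<odot>\<^bsub>M\<^esub> m) (w \<otimes> s)" unfolding z(1) by (rule loc_frac_scale[OF P mc z(3) w(1)])
  then show "z \<in> loc_sub R M P K" unfolding loc_sub_def
    using w(2) primeideal.compl_mult[OF P w(1) z(3)] by blast
qed

lemma loc_sub_imp_loc_le:
  assumes P: "primeideal P R" and H: "submodule H R M" and K: "submodule K R M"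
    and eq: "loc_sub R M P H \<subseteq> loc_sub R M P K"
  shows "loc_le P H K"
  unfolding loc_le_def
proof
  fix x assume x: "x \<in> H"
  have xc: "x \<in> carrier M" using x submoduleE(1)[OF H] by blast
  have one: "\<one> \<in> carrier R - P" by (rule primeideal.compl_one[OF P])
  have "loc_frac R M P x \<one> \<in> loc_sub R M P K" using eq x one unfolding loc_sub_def by blast
  then obtain u s where u: "loc_frac R M P x \<one> = loc_frac R M P u s" "u \<in> K" "s \<in> carrier R - P"
    unfolding loc_sub_def by blast
  have uc: "u \<in> carrier M" using u(2) submoduleE(1)[OF K] by blast
  have "(x, \<one>) \<in> loc_frac R M P x \<one>" using xc one unfolding loc_frac_def by auto
  then have "(x, \<one>) \<in> loc_frac R M P u s" unfolding u(1) .
  then have "\<exists>v\<in>carrier R - P. v \<odot>\<^bsub>M\<^esub> (\<one> \<odot>\<^bsub>M\<^esub> u) = v \<odot>\<^bsub>M\<^esub> (s \<odot>\<^bsub>M\<^esub> x)"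
    unfolding loc_frac_def by (simp only: mem_Collect_eq prod.case)
  then obtain v where v: "v \<in> carrier R - P" "v \<odot>\<^bsub>M\<^esub> (\<one> \<odot>\<^bsub>M\<^esub> u) = v \<odot>\<^bsub>M\<^esub> (s \<odot>\<^bsub>M\<^esub> x)" ..
  have "(v \<otimes> s) \<odot>\<^bsub>M\<^esub> x = v \<odot>\<^bsub>M\<^esub> u" using v u(3) uc xc by (simp add: smult_assoc1)
  moreover have "v \<odot>\<^bsub>M\<^esub> u \<in> K" using submoduleE(4)[OF K _ u(2)] v(1) by blast
  ultimately show "\<exists>s\<in>carrier R - P. s \<odot>\<^bsub>M\<^esub> x \<in> K" using primeideal.compl_mult[OF P v(1) u(3)] by metis
qed

text \<open>Equality of sets of fractions is traded here for multipliers outside \<open>P\<close>;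
  the later arguments about generic points use only this form.\<close>

lemma loc_sub_eq_iff:
  assumes "primeideal P R" "submodule H R M" "submodule K R M"
  shows "loc_sub R M P H = loc_sub R M P K \<longleftrightarrow> loc_le P H K \<and> loc_le P K H"
proof
  assume "loc_sub R M P H = loc_sub R M P K"
  then show "loc_le P H K \<and> loc_le P K H"
    using loc_sub_imp_loc_le[OF assms] loc_sub_imp_loc_le[OF assms(1,3,2)] by simp
next
  assume "loc_le P H K \<and> loc_le P K H"
  then show "loc_sub R M P H = loc_sub R M P K"
    using loc_sub_subset[OF assms(1,2), of K] loc_sub_subset[OF assms(1,3), of H] by blast
qed

lemma submodule_zero_set: "submodule {\<zero>\<^bsub>M\<^esub>} R M"
  by (rule submodule_if_closed) auto

lemma supp_iff:
  assumes "submodule H R M"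
  shows "P \<in> supp R M H \<longleftrightarrow> primeideal P R \<and> (\<exists>x\<in>H. \<forall>s\<in>carrier R - P. s \<odot>\<^bsub>M\<^esub> x \<noteq> \<zero>\<^bsub>M\<^esub>)"
proof -
  have "loc_le P {\<zero>\<^bsub>M\<^esub>} H" if "primeideal P R"
    by (rule loc_le_subset[OF that]) (use submodule_zero[OF assms] in auto)
  then show ?thesis
    unfolding supp_def using loc_sub_eq_iff[OF _ assms submodule_zero_set, of P] unfolding loc_le_def[of P
        H] by auto
qed

lemma generic_points_subset: "generic_points R M H \<subseteq> supp R M H"
  unfolding generic_points_def by auto

lemma generic_points_prime: "P \<in> generic_points R M H \<Longrightarrow> primeideal P R"
  unfolding generic_points_def supp_def by auto

end

context cartier begin

text \<open>The operators respect localization: if \<open>u\<close> multiplies \<open>n\<close> into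
  \<open>H\<close>, so does \<open>u^(p^e)\<close>, and this power inside \<open>cop t e r\<close>
  amounts to multiplying the value by \<open>u\<close>. For sums the multipliers are multiplied
  together.\<close>

lemma cop_loc:
  assumes P: "primeideal P R" and H: "submodule H R M" and Y: "Y \<subseteq> carrier M" and le: "loc_le P Y H"
    and x: "x \<in> addspan M (cgens t k Y)"
  shows "\<exists>s\<in>carrier R - P. s \<odot>\<^bsub>M\<^esub> x \<in> addspan M (cgens t k H)"
  using x
proof induction
  case addspan_zero
  then show ?case using primeideal.compl_one[OF P] by (intro bexI[of _ \<one>]) (auto intro: addspan.addspan_zero)
next
  case (addspan_add v y)
  have Hc: "H \<subseteq> carrier M" using submoduleE(1)[OF H] .
  obtain e r n where v: "v = cop t e r n" "e \<ge> k" "r \<in> carrier R" "n \<in> Y" using addspan_add by blast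
  obtain s where s: "s \<in> carrier R - P" "s \<odot>\<^bsub>M\<^esub> y \<in> addspan M (cgens t k H)"
    using addspan_add by blast
  obtain u where u: "u \<in> carrier R - P" "u \<odot>\<^bsub>M\<^esub> n \<in> H" using loc_leD[OF le v(4)] by blast
  have nc: "n \<in> carrier M" using v(4) Y by blast
  have yc: "y \<in> carrier M" using addspan_add(2) M.addspan_closed[OF cp_gens_closed[OF Y]] by blast
  have c: "u \<in> carrier R" "s \<in> carrier R" using u s by auto
  obtain q where q: "p ^ e = Suc q" using p2 by (cases "p ^ e") auto
  have "u [^] (p ^ e) \<odot>\<^bsub>M\<^esub> n = u [^] q \<odot>\<^bsub>M\<^esub> (u \<odot>\<^bsub>M\<^esub> n)" unfolding q using c nc by (simp add: smult_assoc1)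
  then have "u [^] (p ^ e) \<odot>\<^bsub>M\<^esub> n \<in> H" using submoduleE(4)[OF H _ u(2)] c by simp
  moreover have "u \<odot>\<^bsub>M\<^esub> v = cop t e r (u [^] (p ^ e) \<odot>\<^bsub>M\<^esub> n)" unfolding v(1) by (rule smult_cop[OF v(3) nc
      c(1)])
  ultimately have uv: "u \<odot>\<^bsub>M\<^esub> v \<in> (cgens t k H)" using v(2,3) by blast
  have vc: "v \<in> carrier M" unfolding v(1) by (rule cop_closed[OF v(3) nc])
  have "(s \<otimes> u) \<odot>\<^bsub>M\<^esub> (v \<oplus>\<^bsub>M\<^esub> y) = s \<odot>\<^bsub>M\<^esub> (u \<odot>\<^bsub>M\<^esub> v) \<oplus>\<^bsub>M\<^esub> u \<odot>\<^bsub>M\<^esub> (s \<odot>\<^bsub>M\<^esub> y)"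
    using c vc yc by (simp add: smult_r_distr smult_assoc1[symmetric] m_comm)
  also have "\<dots> \<in> addspan M (cgens t k H)"
    by (rule M.addspan_plus[OF cp_gens_closed[OF Hc] cop_span_smult[OF Hc c(2)] cop_span_smult[OF Hc c(1)
        s(2)]])
       (rule M.addspan_incl[OF uv cp_gens_closed[OF Hc]])
  finally show ?case by (rule bexI[OF _ primeideal.compl_mult[OF P s(1) u(1)]])
qed

lemma cp_loc: "\<lbrakk>primeideal P R; submodule H R M; Y \<subseteq> carrier M; loc_le P Y H\<rbrakk> \<Longrightarrow> loc_le P (cp t Y) (cp t H)"
  using cop_loc[of P H Y _ t 1] submoduleE(1)[of H] unfolding loc_le_def by (simp add: cp_eq_addspan)

abbreviation U where "U t \<equiv> c_stable R p M \<kappa> f t"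
abbreviation gen_csub where "gen_csub t \<equiv> generic_c_submodule R p M \<kappa> f t"
abbreviation tau where "tau t \<equiv> test_module R p M \<kappa> f t"

end

section \<open>The stable submodule and generically full submodules\<close>

locale coh_cartier = cartier +
  assumes noeth: "noeth_in R (carrier R)" and fg: "fin_gen R M"
begin

lemma sub_stable:
  assumes "csub t H"
  shows "\<exists>h0. \<forall>h\<ge>h0. (cp t ^^ h) H = (cp t ^^ h0) H"
proof -
  obtain E where E: "finite E" "E \<subseteq> carrier M" "rspan E = carrier M"
    using fin_gen_mspan[OF fg] .
  show ?thesis by (rule cp_pow_stable[OF noeth assms E(1,2)]) (use E(3) csub_closed[OF assms] in simp)
qed

lemma sub_fg:
  assumes "submodule H R M"
  shows "\<exists>F. finite F \<and> F \<subseteq> H \<and> H = rspan F"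
proof -
  obtain E where E: "finite E" "E \<subseteq> carrier M" "rspan E = carrier M"
    using fin_gen_mspan[OF fg] .
  show ?thesis by (rule noetherian_submodule[OF noeth E(1,2) assms]) (use E(3) submoduleE(1)[OF assms] in simp)
qed

lemma U_eventually: "\<exists>h0. \<forall>h\<ge>h0. (cp t ^^ h) (carrier M) = U t"
proof -
  obtain h0 where h0: "\<And>h. h \<ge> h0 \<Longrightarrow> (cp t ^^ h) (carrier M) = (cp t ^^ h0) (carrier M)"
    using sub_stable[OF csub_carrier] by blast
  have "U t = (cp t ^^ h0) (carrier M)" unfolding c_stable_def
  proof (rule the_equality)
    show "\<forall>\<^sub>F h in sequentially. (cp t ^^ h) (carrier M) = (cp t ^^ h0) (carrier M)"
      unfolding eventually_sequentially using h0 by blast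
    fix V assume "\<forall>\<^sub>F h in sequentially. (cp t ^^ h) (carrier M) = V"
    then obtain h1 where "\<And>h. h \<ge> h1 \<Longrightarrow> (cp t ^^ h) (carrier M) = V" unfolding eventually_sequentially by blast
    then show "V = (cp t ^^ h0) (carrier M)" using h0[of "max h0 h1"] by (metis max.cobounded1 max.cobounded2)
  qed
  then show ?thesis using h0 by metis
qed

lemma U_csub: "csub t (U t)"
proof -
  obtain h0 where "(cp t ^^ h0) (carrier M) = U t" using U_eventually by blast
  then show ?thesis using csub_cp_pow[OF csub_carrier] by metis
qed

lemma cp_U: "cp t (U t) = U t"
proof -
  obtain h0 where h0: "\<forall>h\<ge>h0. (cp t ^^ h) (carrier M) = U t" using U_eventually by blast
  then have "(cp t ^^ Suc h0) (carrier M) = U t" "(cp t ^^ h0) (carrier M) = U t" by (simp_all del: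
      funpow.simps)
  then show ?thesis by simp
qed

lemma cp_pow_U: "(cp t ^^ h) (U t) = U t"
  by (induction h) (auto simp: cp_U)

text \<open>Because \<open>cp t\<close> fixes \<open>U t\<close>, operators of small degree can be
  discarded. The torsion argument at generic points and both nilpotence arguments for
  nil-isomorphisms rest on this.\<close>

lemma U_span: "U t \<subseteq> addspan M (cgens t (Suc h) (U t))"
  using cp_pow_span[OF U_csub] unfolding cp_pow_U .

lemmas U_sub = csub_submodule[OF U_csub]
lemmas U_closed = csub_closed[OF U_csub]

lemma gen_csub_iff: "gen_csub t H \<longleftrightarrow> csub t H \<and>
   (\<forall>\<eta>\<in>generic_points R M (U t). loc_le \<eta> H (U t) \<and> loc_le \<eta> (U t) H)"
  unfolding generic_c_submodule_def
  using loc_sub_eq_iff[OF generic_points_prime csub_submodule U_sub] by blast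

lemma gen_csub_U: "gen_csub t (U t)"
  unfolding gen_csub_iff using U_csub loc_le_subset[OF generic_points_prime order_refl U_closed] by blast

lemma gen_csub_Int:
  assumes H: "gen_csub t H" and K: "gen_csub t K"
  shows "gen_csub t (H \<inter> K)"
proof -
  have c: "csub t H" "csub t K" using assms unfolding gen_csub_iff by auto
  note Hs = csub_submodule[OF c(1)] and Ks = csub_submodule[OF c(2)]
  have "loc_le \<eta> (H \<inter> K) (U t) \<and> loc_le \<eta> (U t) (H \<inter> K)" if \<eta>: "\<eta> \<in> generic_points R M (U t)" for \<eta>
  proof
    show "loc_le \<eta> (H \<inter> K) (U t)" using H \<eta> unfolding gen_csub_iff loc_le_def by blast
    show "loc_le \<eta> (U t) (H \<inter> K)" unfolding loc_le_def
    proof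
      fix x assume x: "x \<in> U t"
      obtain s where s: "s \<in> carrier R - \<eta>" "s \<odot>\<^bsub>M\<^esub> x \<in> H" using H \<eta> x unfolding gen_csub_iff loc_le_def by
          blast
      obtain u where u: "u \<in> carrier R - \<eta>" "u \<odot>\<^bsub>M\<^esub> x \<in> K" using K \<eta> x unfolding gen_csub_iff loc_le_def by
          blast
      have xc: "x \<in> carrier M" using x U_closed by blast
      have "(s \<otimes> u) \<odot>\<^bsub>M\<^esub> x = s \<odot>\<^bsub>M\<^esub> (u \<odot>\<^bsub>M\<^esub> x)" "(s \<otimes> u) \<odot>\<^bsub>M\<^esub> x = u \<odot>\<^bsub>M\<^esub> (s \<odot>\<^bsub>M\<^esub> x)"
        using xc s u by (auto simp: smult_assoc1[symmetric] m_comm)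
      then have "(s \<otimes> u) \<odot>\<^bsub>M\<^esub> x \<in> H \<inter> K" using submoduleE(4)[OF Hs _ s(2), of u] submoduleE(4)[OF Ks _
          u(2), of s] s u by auto
      then show "\<exists>s\<in>carrier R - \<eta>. s \<odot>\<^bsub>M\<^esub> x \<in> H \<inter> K"
        using primeideal.compl_mult[OF generic_points_prime[OF \<eta>] s(1) u(1)] by blast
    qed
  qed
  then show ?thesis unfolding gen_csub_iff using csub_Int[OF c] by blast
qed

lemma gen_csub_cp:
  assumes H: "gen_csub t H"
  shows "gen_csub t (cp t H)"
proof -
  have c: "csub t H" using assms unfolding gen_csub_iff by auto
  have "loc_le \<eta> (cp t H) (U t) \<and> loc_le \<eta> (U t) (cp t H)" if \<eta>: "\<eta> \<in> generic_points R M (U t)" for \<eta>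
  proof
    show "loc_le \<eta> (cp t H) (U t)" using H \<eta> cp_subset[OF c] unfolding gen_csub_iff loc_le_def by blast
    have "loc_le \<eta> (cp t (U t)) (cp t H)"
      by (rule cp_loc[OF generic_points_prime[OF \<eta>] csub_submodule[OF c] U_closed])
         (use H \<eta> in \<open>auto simp: gen_csub_iff\<close>)
    then show "loc_le \<eta> (U t) (cp t H)" unfolding cp_U .
  qed
  then show ?thesis unfolding gen_csub_iff using csub_cp[OF c] by blast
qed

lemma gen_csub_cp_pow: "gen_csub t H \<Longrightarrow> gen_csub t ((cp t ^^ h) H)"
  by (induction h) (auto intro: gen_csub_cp)

end

text \<open>Among the generically full submodules fixed by \<open>cp t\<close>, some
  \<open>N0\<close> has a trace on \<open>G K\<close> that no smaller member can shrink, by the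
  chain condition on traces. As \<open>N0\<close> is recovered from its trace, it lies in every
  generically full submodule.\<close>

lemma (in gauged_gens) test_module_exists:
  assumes "fin_gen R M"
  shows "\<exists>T. gen_csub t T \<and> (\<forall>N. gen_csub t N \<longrightarrow> T \<subseteq> N)"
proof -
  interpret coh_cartier R M p \<kappa> f
    by unfold_locales (rule noeth, rule assms)
  obtain K where K: "\<And>N. \<lbrakk>csub t N; cp t N = N\<rbrakk> \<Longrightarrow> N \<subseteq> rspan (N \<inter> G K)"
    using fpure_gauge_bound by blast
  define S where "S = {N. gen_csub t N \<and> cp t N = N}"
  have csub: "csub t N" if "gen_csub t N" for N using that unfolding gen_csub_iff by blast
  have US: "U t \<in> S" unfolding S_def using gen_csub_U cp_U by blast
  have "\<exists>N0\<in>S. \<forall>N\<in>S. N \<subseteq> N0 \<longrightarrow> N \<inter> G K = N0 \<inter> G K"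
  proof (rule ccontr)
    assume "\<not> ?thesis"
    then have ex: "\<forall>N0\<in>S. \<exists>N\<in>S. N \<subseteq> N0 \<and> N \<inter> G K \<noteq> N0 \<inter> G K" by simp
    have "\<exists>V. \<forall>n. (V n \<in> S) \<and> (V (Suc n) \<subseteq> V n \<and> V (Suc n) \<inter> G K \<noteq> V n \<inter> G K)"
    proof (rule dependent_nat_choice)
      show "\<exists>x. x \<in> S" using US ..
      show "\<exists>y. y \<in> S \<and> (y \<subseteq> x \<and> y \<inter> G K \<noteq> x \<inter> G K)" if "x \<in> S" for x and n :: nat
        using bspec[OF ex that] unfolding Bex_def .
    qed
    then obtain V where "\<forall>n. (V n \<in> S) \<and> (V (Suc n) \<subseteq> V n \<and> V (Suc n) \<inter> G K \<noteq> V n \<inter> G K)" ..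
    then have V: "\<And>n. V n \<in> S" "\<And>n. V (Suc n) \<subseteq> V n" "\<And>n. V (Suc n) \<inter> G K \<noteq> V n \<inter> G K" by simp_all
    have "\<exists>n. V n \<inter> G K = V (Suc n) \<inter> G K"
    proof (rule gauge_dcc)
      show "submodule (V n) R M" for n using V(1)[of n] csub csub_submodule unfolding S_def by blast
      show "V (Suc n) \<inter> G K \<subseteq> V n" for n using V(2) by blast
    qed
    then show False using V(3) by metis
  qed
  then obtain N0 where N0: "N0 \<in> S" "\<forall>N\<in>S. N \<subseteq> N0 \<longrightarrow> N \<inter> G K = N0 \<inter> G K" ..
  have g0: "gen_csub t N0" "cp t N0 = N0" using N0(1) unfolding S_def by auto
  have "N0 \<subseteq> N" if N: "gen_csub t N" for N
  proof -
    have I: "gen_csub t (N \<inter> N0)" by (rule gen_csub_Int[OF N g0(1)])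
    obtain h where h: "\<forall>h'\<ge>h. (cp t ^^ h') (N \<inter> N0) = (cp t ^^ h) (N \<inter> N0)" using sub_stable[OF csub[OF I]]
        by blast
    \<comment> \<open>The intersection is generically full but need not be fixed by
      \<open>cp t\<close>. Iterating until it is stationary repairs this, and generic fullness
      survives each application.\<close>
    define L where "L = (cp t ^^ h) (N \<inter> N0)"
    have "(cp t ^^ Suc h) (N \<inter> N0) = L" unfolding L_def by (rule h[rule_format]) simp
    then have "cp t L = L" unfolding L_def by simp
    then have LS: "L \<in> S" unfolding S_def L_def using gen_csub_cp_pow[OF I] by blast
    have LN: "L \<subseteq> N \<inter> N0" unfolding L_def using cp_pow_antimono[OF csub[OF I], of 0 h] by simp
    have "L \<inter> G K = N0 \<inter> G K" using N0(2) LS LN by simp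
    then have "N0 \<inter> G K \<subseteq> L" by blast
    then have "rspan (N0 \<inter> G K) \<subseteq> L"
      using LS csub csub_submodule mspan_subset_submodule unfolding S_def by blast
    then show ?thesis using K[OF csub[OF g0(1)] g0(2)] LN by blast
  qed
  then show ?thesis using g0(1) by blast
qed

text \<open>Existence is an assumption here: what follows depends on the presentation of
  \<open>R\<close> only through existence and noetherianity.\<close>

locale tau_cartier = coh_cartier +
  assumes tau_exists: "\<exists>T. gen_csub t T \<and> (\<forall>N. gen_csub t N \<longrightarrow> T \<subseteq> N)"
begin

lemma tau: "gen_csub t (tau t) \<and> (\<forall>N. gen_csub t N \<longrightarrow> tau t \<subseteq> N)"
  unfolding test_module_def by (rule theI') (use tau_exists in blast)

lemma tau_gen: "gen_csub t (tau t)" using tau by blast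
lemma tau_least: "gen_csub t H \<Longrightarrow> tau t \<subseteq> H" using tau by blast
lemma tau_csub: "csub t (tau t)" using tau_gen unfolding gen_csub_iff by blast

end

section \<open>Dependence on the exponent and nil-isomorphisms\<close>

lemma fexp_mono: "s \<le> t \<Longrightarrow> fexp p s e \<le> fexp p t e"
  unfolding fexp_def by (intro nat_mono ceiling_mono mult_right_mono) auto

lemma fexp_large:
  assumes "t > 0" "p \<ge> 2"
  shows "\<exists>h. \<forall>e\<ge>h. k \<le> fexp p t e"
proof -
  define h where "h = nat \<lceil>of_nat k / t\<rceil>"
  have "k \<le> fexp p t e" if e: "e \<ge> h" for e
  proof -
    have "of_nat k / t \<le> of_int \<lceil>of_nat k / t\<rceil>" by (rule le_of_int_ceiling)
    also have "\<dots> \<le> of_nat h" unfolding h_def by (simp add: of_nat_nat)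
    also have "\<dots> \<le> of_nat e" using e by simp
    also have "\<dots> \<le> of_nat (p ^ e)" using power_gt_expt[of p e] assms(2) by simp
    finally have "of_nat k \<le> t * of_nat (p ^ e)" using assms(1) by (simp add: field_simps)
    also have "\<dots> \<le> of_int \<lceil>t * of_nat (p ^ e)\<rceil>" by (rule le_of_int_ceiling)
    finally have "int k \<le> \<lceil>t * of_nat (p ^ e)\<rceil>" by linarith
    then show ?thesis unfolding fexp_def by linarith
  qed
  then show ?thesis by blast
qed

section \<open>Comparison of two exponents\<close>

context cartier begin

lemma cop_change_exponent:
  assumes "s \<le> t" "r \<in> carrier R"
  shows "\<exists>r'\<in>carrier R. \<forall>m. cop t e r m = cop s e r' m"
proof -
  have "f [^] fexp p t e = f [^] fexp p s e \<otimes> f [^] (fexp p t e - fexp p s e)"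
    using fexp_mono[OF assms(1)] by (simp add: nat_pow_mult)
  then have "f [^] fexp p t e \<otimes> r = f [^] fexp p s e \<otimes> (f [^] (fexp p t e - fexp p s e) \<otimes> r)"
    using assms(2) by (simp add: m_assoc)
  then show ?thesis unfolding cop_def using assms(2)
    by (intro bexI[of _ "f [^] (fexp p t e - fexp p s e) \<otimes> r"]) auto
qed

lemma csub_antimono: "\<lbrakk>s \<le> t; csub s H\<rbrakk> \<Longrightarrow> csub t H"
  unfolding csub_iff by (metis cop_change_exponent)

lemma cp_antimono:
  assumes "s \<le> t" "H \<subseteq> carrier M"
  shows "cp t H \<subseteq> cp s H"
proof (rule cp_least[OF cp_submodule[OF assms(2)] assms(2)])
  fix e r n assume a: "(1::nat) \<le> e" "r \<in> carrier R" "n \<in> H"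
  obtain r' where "r' \<in> carrier R" "cop t e r n = cop s e r' n" using cop_change_exponent[OF assms(1) a(2)]
      by metis
  then show "cop t e r n \<in> cp s H" using cop_in_cp[OF assms(2) a(1)] a(3) by simp
qed

lemma cp_pow_antimono_exponent: "s \<le> t \<Longrightarrow> (cp t ^^ h) (carrier M) \<subseteq> (cp s ^^ h) (carrier M)"
proof (induction h)
  case (Suc h)
  have c: "(cp s ^^ h) (carrier M) \<subseteq> carrier M" "(cp t ^^ h) (carrier M) \<subseteq> carrier M"
    using cp_pow_closed[OF csub_carrier] by auto
  have "cp t ((cp t ^^ h) (carrier M)) \<subseteq> cp t ((cp s ^^ h) (carrier M))"
    by (rule cp_mono[OF Suc.IH[OF Suc.prems] c(1)])
  also have "\<dots> \<subseteq> cp s ((cp s ^^ h) (carrier M))" by (rule cp_antimono[OF Suc.prems c(1)])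
  finally show ?case by simp
qed simp

text \<open>The exponent \<open>m = 2\<lceil>t\<rceil>\<close> satisfies \<open>m p\<^sup>e \<ge> m + \<lceil>t p\<^sup>e\<rceil>\<close> for all \<open>e \<ge> 1\<close>.\<close>

lemma f_pow_cp_pow:
  "x \<in> (cp s ^^ h) (carrier M) \<Longrightarrow> f [^] (2 * fexp p t 0) \<odot>\<^bsub>M\<^esub> x \<in> (cp t ^^ h) (carrier M)"
proof (induction h arbitrary: x)
  case 0 then show ?case by simp
next
  case (Suc h)
  let ?m = "2 * fexp p t 0"
  have c: "(cp u ^^ h) (carrier M) \<subseteq> carrier M" for u using cp_pow_closed[OF csub_carrier] .
  have x: "x \<in> addspan M (cgens s 1 ((cp s ^^ h) (carrier M)))"
    using Suc.prems cp_eq_addspan[OF c] by simp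
  have "f [^] ?m \<odot>\<^bsub>M\<^esub> x \<in> addspan M (cgens t 1 ((cp t ^^ h) (carrier M)))"
  proof (rule M.addspan_map[OF M.abelian_group_axioms cp_gens_closed[OF c] x cp_gens_closed[OF c]])
    fix y assume "y \<in> (cgens s 1 ((cp s ^^ h) (carrier M)))"
    then obtain e r n where y: "y = cop s e r n" "e \<ge> 1" "r \<in> carrier R" "n \<in> (cp s ^^ h) (carrier M)" by blast
    have nc: "n \<in> carrier M" using y(4) c by blast
    \<comment> \<open>The first summand is bounded by \<open>fexp_le\<close>, the second because
      \<open>p^e \<ge> 2\<close>. Together they need twice the ceiling of \<open>t\<close>, whence
      the factor in \<open>?m\<close>.\<close>
    have "fexp p t e + ?m \<le> fexp p t 0 * p ^ e + fexp p t 0 * p ^ e"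
      using fexp_le[of p t e] p_pow_ge2[OF y(2)] by (intro add_mono) (auto simp: mult.commute)
    then have le: "fexp p t e + ?m \<le> ?m * p ^ e + fexp p s e" by simp
    \<comment> \<open>One copy of \<open>f^?m\<close> is handed on to \<open>n\<close>, so the same
      power works at every depth of the induction; the surplus \<open>f^d\<close> goes into the
      coefficient.\<close>
    define d where "d = ?m * p ^ e + fexp p s e - (fexp p t e + ?m)"
    have d: "?m * p ^ e + fexp p s e = fexp p t e + (d + ?m)" using le unfolding d_def by linarith
    have "f [^] ?m \<odot>\<^bsub>M\<^esub> y = (\<kappa> ^^ e) (((f [^] ?m) [^] (p ^ e) \<otimes> (f [^] fexp p s e \<otimes> r)) \<odot>\<^bsub>M\<^esub> n)"
      unfolding y(1) cop_def using y(3) nc by (simp add: \<kappa>_pow_smult[symmetric] smult_assoc1)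
    also have "(f [^] ?m) [^] (p ^ e) \<otimes> (f [^] fexp p s e \<otimes> r) = f [^] (?m * p ^ e + fexp p s e) \<otimes> r"
      using y(3) by (simp add: nat_pow_pow nat_pow_mult[symmetric] m_assoc)
    also have "\<dots> = f [^] fexp p t e \<otimes> (f [^] d \<otimes> r) \<otimes> f [^] ?m"
      unfolding d using y(3) by (simp only: nat_pow_mult[symmetric] f_closed) (simp add: m_ac)
    also have "(\<kappa> ^^ e) (\<dots> \<odot>\<^bsub>M\<^esub> n) = cop t e (f [^] d \<otimes> r) (f [^] ?m \<odot>\<^bsub>M\<^esub> n)"
      unfolding cop_def using y(3) nc by (simp add: smult_assoc1)
    finally have "f [^] ?m \<odot>\<^bsub>M\<^esub> y = cop t e (f [^] d \<otimes> r) (f [^] ?m \<odot>\<^bsub>M\<^esub> n)" .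
    moreover have "f [^] d \<otimes> r \<in> carrier R" using y(3) by simp
    ultimately have "f [^] ?m \<odot>\<^bsub>M\<^esub> y \<in> (cgens t 1 ((cp t ^^ h) (carrier M)))"
      using y(2) Suc.IH[OF y(4)] by blast
    then show "f [^] ?m \<odot>\<^bsub>M\<^esub> y \<in> addspan M (cgens t 1 ((cp t ^^ h) (carrier M)))"
      by (rule M.addspan_incl[OF _ cp_gens_closed[OF c]])
  qed (auto simp: smult_r_distr)
  then show ?case using cp_eq_addspan[OF c] by simp
qed

end

text \<open>An ideal maximal among those containing \<open>I\<close> and disjoint from
  \<open>S\<close> is prime: two elements outside it would give two elements of \<open>S\<close>
  whose product lies in it. It will supply points of a support that avoid \<open>f\<close>.\<close>

lemma (in cring) prime_avoiding:
  assumes noeth: "noeth_in R (carrier R)" and I: "ideal I R"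
    and S: "\<one> \<in> S" "S \<subseteq> carrier R" "\<And>a b. \<lbrakk>a \<in> S; b \<in> S\<rbrakk> \<Longrightarrow> a \<otimes> b \<in> S" "I \<inter> S = {}"
  shows "\<exists>Q. primeideal Q R \<and> I \<subseteq> Q \<and> Q \<inter> S = {}"
proof -
  have "\<exists>Q\<in>{J. ideal J R \<and> I \<subseteq> J \<and> J \<inter> S = {}}. \<forall>J\<in>{J. ideal J R \<and> I \<subseteq> J \<and> J \<inter> S = {}}. Q \<subseteq> J \<longrightarrow> J = Q"
    by (rule noeth_maximal_ideal[OF noeth, of _ I]) (use I S(4) in auto)
  then obtain Q where Q: "ideal Q R" "I \<subseteq> Q" "Q \<inter> S = {}"
    and max: "\<And>J. \<lbrakk>ideal J R; I \<subseteq> J; J \<inter> S = {}; Q \<subseteq> J\<rbrakk> \<Longrightarrow> J = Q" by auto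
  interpret Q: ideal Q R by (rule Q(1))
  have hit: "\<exists>j\<in>Q. \<exists>r\<in>carrier R. j \<oplus> r \<otimes> a \<in> S" if a: "a \<in> carrier R" "a \<notin> Q" for a
  proof (rule ccontr)
    assume no: "\<not> ?thesis"
    let ?J = "{j \<oplus> r \<otimes> a | j r. j \<in> Q \<and> r \<in> carrier R}"
    have J: "ideal ?J R"
    proof (rule ideal_if_closed)
      show "?J \<subseteq> carrier R" using Q.Icarr a by auto
      have "\<zero> = \<zero> \<oplus> \<zero> \<otimes> a" using a by simp
      then show "\<zero> \<in> ?J" using Q.zero_closed by blast
      fix x y assume "x \<in> ?J" "y \<in> ?J"
      then obtain j r j' r' where xy: "x = j \<oplus> r \<otimes> a" "y = j' \<oplus> r' \<otimes> a" "j \<in> Q" "j' \<in> Q" "r \<in> carrier R"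
          "r' \<in> carrier R" by blast
      have "x \<oplus> y = (j \<oplus> j') \<oplus> (r \<oplus> r') \<otimes> a" unfolding xy(1,2) using xy Q.Icarr a by (simp add: l_distr a_ac)
      then show "x \<oplus> y \<in> ?J" using Q.a_closed[OF xy(3,4)] xy(5,6) by blast
    next
      fix b x assume b: "b \<in> carrier R" and "x \<in> ?J"
      then obtain j r where x: "x = j \<oplus> r \<otimes> a" "j \<in> Q" "r \<in> carrier R" by blast
      have "b \<otimes> x = b \<otimes> j \<oplus> (b \<otimes> r) \<otimes> a" unfolding x(1) using x b Q.Icarr a by (simp add: r_distr m_assoc)
      then show "b \<otimes> x \<in> ?J" using Q.I_l_closed[OF x(2) b] x(3) b by blast
    qed
    have QJ: "Q \<subseteq> ?J"
    proof
      fix j assume j: "j \<in> Q"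
      then have "j = j \<oplus> \<zero> \<otimes> a" using a Q.Icarr by simp
      then show "j \<in> ?J" using j by blast
    qed
    have "?J \<inter> S = {}" using no by blast
    then have JQ: "?J = Q" using max[OF J _ _ QJ] QJ Q(2) by blast
    have "a = \<zero> \<oplus> \<one> \<otimes> a" using a by simp
    then have "a \<in> ?J" using Q.zero_closed by blast
    then show False using JQ a(2) by simp
  qed
  have "primeideal Q R"
  proof (rule primeidealI[OF Q(1) is_cring])
    show "carrier R \<noteq> Q" using S(1) Q(3) by auto
    fix a b assume ab: "a \<in> carrier R" "b \<in> carrier R" "a \<otimes> b \<in> Q"
    show "a \<in> Q \<or> b \<in> Q"
    proof (rule ccontr)
      assume "\<not> (a \<in> Q \<or> b \<in> Q)"
      then obtain j r j' r' where h: "j \<in> Q" "r \<in> carrier R" "j \<oplus> r \<otimes> a \<in> S" "j' \<in> Q" "r' \<in> carrier R" "j'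
          \<oplus> r' \<otimes> b \<in> S"
        using hit[OF ab(1)] hit[OF ab(2)] by blast
      have c: "j \<in> carrier R" "j' \<in> carrier R" using h Q.Icarr by auto
      have "(j \<oplus> r \<otimes> a) \<otimes> (j' \<oplus> r' \<otimes> b) = (j' \<oplus> r' \<otimes> b) \<otimes> j \<oplus> ((r \<otimes> a) \<otimes> j' \<oplus> (r \<otimes> r') \<otimes> (a \<otimes> b))"
        using c h(2,5) ab(1,2) by (simp add: l_distr r_distr m_ac a_ac)
      also have "\<dots> \<in> Q"
      proof (intro Q.a_closed)
        show "(j' \<oplus> r' \<otimes> b) \<otimes> j \<in> Q" by (rule Q.I_l_closed) (use h ab c in auto)
        show "(r \<otimes> a) \<otimes> j' \<in> Q" by (rule Q.I_l_closed) (use h ab c in auto)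
        show "(r \<otimes> r') \<otimes> (a \<otimes> b) \<in> Q" by (rule Q.I_l_closed) (use h ab c in auto)
      qed
      finally show False using S(3)[OF h(3,6)] Q(3) by blast
    qed
  qed
  then show ?thesis using Q by blast
qed

context coh_cartier begin

lemma U_antimono: "s \<le> t \<Longrightarrow> U t \<subseteq> U s"
proof -
  assume st: "s \<le> t"
  obtain h0 where h0: "\<And>h. h \<ge> h0 \<Longrightarrow> (cp t ^^ h) (carrier M) = U t" using U_eventually by blast
  obtain h1 where h1: "\<And>h. h \<ge> h1 \<Longrightarrow> (cp s ^^ h) (carrier M) = U s" using U_eventually by blast
  show ?thesis using cp_pow_antimono_exponent[OF st, of "max h0 h1"] h0[of "max h0 h1"] h1[of "max h0 h1"]
      by simp
qed

lemma f_pow_U: "x \<in> U s \<Longrightarrow> f [^] (2 * fexp p t 0) \<odot>\<^bsub>M\<^esub> x \<in> U t"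
proof -
  assume x: "x \<in> U s"
  obtain h0 where h0: "\<And>h. h \<ge> h0 \<Longrightarrow> (cp t ^^ h) (carrier M) = U t" using U_eventually by blast
  obtain h1 where h1: "\<And>h. h \<ge> h1 \<Longrightarrow> (cp s ^^ h) (carrier M) = U s" using U_eventually by blast
  show ?thesis using f_pow_cp_pow[where x = x and s = s and h = "max h0 h1" and t = t] x h0[of "max h0 h1"]
      h1[of "max h0 h1"] by simp
qed

text \<open>Finite generation makes the exponent of \<open>f\<close> uniform, while the multiplier
  outside \<open>P\<close> may still vary with the element.\<close>

lemma f_torsion_bounded:
  assumes P: "primeideal P R" and H: "submodule H R M"
    and tors: "\<And>x. x \<in> H \<Longrightarrow> \<exists>s\<in>carrier R - P. \<exists>k::nat. (s \<otimes> f [^] k) \<odot>\<^bsub>M\<^esub> x = \<zero>\<^bsub>M\<^esub>"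
  shows "\<exists>k::nat. \<forall>x\<in>H. \<exists>s\<in>carrier R - P. (s \<otimes> f [^] k) \<odot>\<^bsub>M\<^esub> x = \<zero>\<^bsub>M\<^esub>"
proof -
  have raise: "\<exists>s\<in>carrier R - P. (s \<otimes> f [^] k') \<odot>\<^bsub>M\<^esub> x = \<zero>\<^bsub>M\<^esub>"
    if "s \<in> carrier R - P" "(s \<otimes> f [^] k) \<odot>\<^bsub>M\<^esub> x = \<zero>\<^bsub>M\<^esub>" "x \<in> carrier M" "k \<le> k'" for s x and k k' :: nat
  proof -
    have "f [^] (k' - k) \<otimes> (s \<otimes> f [^] k) = s \<otimes> (f [^] (k' - k) \<otimes> f [^] k)" using that(1) by (simp add: m_ac)
    also have "\<dots> = s \<otimes> f [^] k'" using that(4) by (simp add: nat_pow_mult)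
    finally have "(s \<otimes> f [^] k') \<odot>\<^bsub>M\<^esub> x = f [^] (k' - k) \<odot>\<^bsub>M\<^esub> ((s \<otimes> f [^] k) \<odot>\<^bsub>M\<^esub> x)"
      using that(1,3) by (metis DiffD1 f_closed m_closed nat_pow_closed smult_assoc1)
    then show ?thesis using that(1,2) by auto
  qed
  obtain F where F: "finite F" "F \<subseteq> H" "H = rspan F" using sub_fg[OF H] by blast
  have Hc: "H \<subseteq> carrier M" using submoduleE(1)[OF H] .
  have "\<exists>k::nat. \<forall>x\<in>F. \<exists>s\<in>carrier R - P. (s \<otimes> f [^] k) \<odot>\<^bsub>M\<^esub> x = \<zero>\<^bsub>M\<^esub>" using F(1,2)
  proof (induction F rule: finite_induct)
    case (insert x F)
    obtain k1 :: nat where k1: "\<forall>x\<in>F. \<exists>s\<in>carrier R - P. (s \<otimes> f [^] k1) \<odot>\<^bsub>M\<^esub> x = \<zero>\<^bsub>M\<^esub>" using insert by blast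
    have xH: "x \<in> H" using insert.prems by blast
    obtain s and k2 :: nat where s: "s \<in> carrier R - P" "(s \<otimes> f [^] k2) \<odot>\<^bsub>M\<^esub> x = \<zero>\<^bsub>M\<^esub>" using tors[OF xH] by
        blast
    have "\<exists>s\<in>carrier R - P. (s \<otimes> f [^] max k1 k2) \<odot>\<^bsub>M\<^esub> y = \<zero>\<^bsub>M\<^esub>" if y: "y \<in> insert x F" for y
    proof (cases "y = x")
      case True
      then show ?thesis using raise[OF s _ max.cobounded2] xH Hc by blast
    next
      case False
      then have yF: "y \<in> F" using y by simp
      then obtain u where u: "u \<in> carrier R - P" "(u \<otimes> f [^] k1) \<odot>\<^bsub>M\<^esub> y = \<zero>\<^bsub>M\<^esub>" using k1 by blast
      show ?thesis by (rule raise[OF u _ max.cobounded1]) (use insert.prems yF Hc in blast)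
    qed
    then show ?case by blast
  qed auto
  then obtain k :: nat where k: "\<And>x. x \<in> F \<Longrightarrow> \<exists>s\<in>carrier R - P. (s \<otimes> f [^] k) \<odot>\<^bsub>M\<^esub> x = \<zero>\<^bsub>M\<^esub>" by blast
  let ?T = "{x \<in> carrier M. \<exists>s\<in>carrier R - P. (s \<otimes> f [^] k) \<odot>\<^bsub>M\<^esub> x = \<zero>\<^bsub>M\<^esub>}"
  have "submodule ?T R M"
  proof (rule submodule_if_closed)
    show "\<zero>\<^bsub>M\<^esub> \<in> ?T" using primeideal.compl_one[OF P] by (auto intro!: bexI[of _ \<one>])
  next
    fix x y assume "x \<in> ?T" "y \<in> ?T"
    then obtain s u where h: "x \<in> carrier M" "y \<in> carrier M" "s \<in> carrier R - P" "u \<in> carrier R - P"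
      "(s \<otimes> f [^] k) \<odot>\<^bsub>M\<^esub> x = \<zero>\<^bsub>M\<^esub>" "(u \<otimes> f [^] k) \<odot>\<^bsub>M\<^esub> y = \<zero>\<^bsub>M\<^esub>" by blast
    have "((s \<otimes> u) \<otimes> f [^] k) \<odot>\<^bsub>M\<^esub> (x \<oplus>\<^bsub>M\<^esub> y) = u \<odot>\<^bsub>M\<^esub> ((s \<otimes> f [^] k) \<odot>\<^bsub>M\<^esub> x) \<oplus>\<^bsub>M\<^esub> s \<odot>\<^bsub>M\<^esub> ((u \<otimes> f [^] k)
        \<odot>\<^bsub>M\<^esub> y)"
      using h(1-4) by (simp add: smult_r_distr smult_assoc1[symmetric] m_ac)
    also have "\<dots> = \<zero>\<^bsub>M\<^esub>" using h by simp
    finally show "x \<oplus>\<^bsub>M\<^esub> y \<in> ?T" using h(1,2) primeideal.compl_mult[OF P h(3,4)] by blast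
  next
    fix a x assume a: "a \<in> carrier R" "x \<in> ?T"
    then obtain s where s: "x \<in> carrier M" "s \<in> carrier R - P" "(s \<otimes> f [^] k) \<odot>\<^bsub>M\<^esub> x = \<zero>\<^bsub>M\<^esub>" by blast
    have "(s \<otimes> f [^] k) \<odot>\<^bsub>M\<^esub> (a \<odot>\<^bsub>M\<^esub> x) = a \<odot>\<^bsub>M\<^esub> ((s \<otimes> f [^] k) \<odot>\<^bsub>M\<^esub> x)"
      using a(1) s(1,2) by (simp add: smult_assoc1[symmetric] m_ac)
    then have "(s \<otimes> f [^] k) \<odot>\<^bsub>M\<^esub> (a \<odot>\<^bsub>M\<^esub> x) = \<zero>\<^bsub>M\<^esub>" using s a by simp
    then show "a \<odot>\<^bsub>M\<^esub> x \<in> ?T" using s(1,2) a(1) by auto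
  qed auto
  moreover have "F \<subseteq> ?T" using k F(2) Hc by blast
  ultimately have "H \<subseteq> ?T" unfolding F(3) by (rule mspan_subset_submodule)
  then show ?thesis by blast
qed

text \<open>For \<open>t > 0\<close> a generic point of \<open>Supp U\<close> does not contain \<open>f\<close>: otherwise \<open>U\<close> would be
  \<open>f\<close>-power torsion there, hence killed by \<open>\<C>\<^sub>e\<close> for large \<open>e\<close>, whereas \<open>U = \<C>\<^sub>+ U\<close>.\<close>

lemma f_notin_generic:
  assumes t: "t > 0" and \<eta>: "\<eta> \<in> generic_points R M (U t)"
  shows "f \<notin> \<eta>"
proof
  assume f\<eta>: "f \<in> \<eta>"
  have P: "primeideal \<eta> R" using generic_points_prime[OF \<eta>] .
  interpret P: primeideal \<eta> R by (rule P)
  have min: "\<And>Q. \<lbrakk>Q \<in> supp R M (U t); Q \<subseteq> \<eta>\<rbrakk> \<Longrightarrow> Q = \<eta>" using \<eta> unfolding generic_points_def by blast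
  have "\<eta> \<in> supp R M (U t)" using \<eta> generic_points_subset by blast
  then obtain x0 where x0: "x0 \<in> U t" "\<And>s. s \<in> carrier R - \<eta> \<Longrightarrow> s \<odot>\<^bsub>M\<^esub> x0 \<noteq> \<zero>\<^bsub>M\<^esub>" using supp_iff[OF U_sub]
      by blast
  \<comment> \<open>Otherwise a prime containing the annihilator of \<open>x\<close> and avoiding
    both \<open>f\<close> and the complement of \<open>\<eta>\<close> exists. It is a point of the
    support inside \<open>\<eta>\<close>, and differs from \<open>\<eta>\<close> because it misses
    \<open>f\<close>.\<close>
  have tors: "\<exists>s\<in>carrier R - \<eta>. \<exists>k::nat. (s \<otimes> f [^] k) \<odot>\<^bsub>M\<^esub> x = \<zero>\<^bsub>M\<^esub>" if x: "x \<in> U t" for x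
  proof (rule ccontr)
    assume no: "\<not> ?thesis"
    have xc: "x \<in> carrier M" using x U_closed by blast
    let ?I = "{a \<in> carrier R. a \<odot>\<^bsub>M\<^esub> x = \<zero>\<^bsub>M\<^esub>}"
    let ?S = "{s \<otimes> f [^] k | s (k::nat). s \<in> carrier R - \<eta>}"
    have "\<exists>Q. primeideal Q R \<and> ?I \<subseteq> Q \<and> Q \<inter> ?S = {}"
    proof (rule prime_avoiding[OF noeth])
      show "ideal ?I R" by (rule ideal_if_closed) (use xc in \<open>auto simp: smult_l_distr smult_assoc1\<close>)
      have "\<one> = \<one> \<otimes> f [^] (0::nat)" by simp
      then show "\<one> \<in> ?S" using P.compl_one by blast
      show "?S \<subseteq> carrier R" by auto
      show "?I \<inter> ?S = {}" using no by blast
      fix a b assume "a \<in> ?S" "b \<in> ?S"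
      then obtain s u and k l :: nat where ab: "a = s \<otimes> f [^] k" "b = u \<otimes> f [^] l" "s \<in> carrier R - \<eta>" "u \<in>
          carrier R - \<eta>" by blast
      have "a \<otimes> b = (s \<otimes> u) \<otimes> (f [^] k \<otimes> f [^] l)" unfolding ab(1,2) using ab(3,4) by (simp add: m_ac)
      then have "a \<otimes> b = (s \<otimes> u) \<otimes> f [^] (k + l)" by (simp add: nat_pow_mult)
      then show "a \<otimes> b \<in> ?S" using P.compl_mult[OF ab(3,4)] by blast
    qed
    then obtain Q where Q: "primeideal Q R" "?I \<subseteq> Q" "Q \<inter> ?S = {}" by blast
    have "Q \<subseteq> \<eta>"
    proof
      fix a assume a: "a \<in> Q"
      have ac: "a \<in> carrier R" using a ideal.Icarr[OF primeideal.axioms(1)[OF Q(1)]] by blast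
      show "a \<in> \<eta>"
      proof (rule ccontr)
        assume "a \<notin> \<eta>"
        moreover have "a = a \<otimes> f [^] (0::nat)" using ac by simp
        ultimately have "a \<in> ?S" using ac by blast
        then show False using a Q(3) by blast
      qed
    qed
    moreover have "Q \<in> supp R M (U t)" using supp_iff[OF U_sub] Q(1,2) x by blast
    ultimately have "Q = \<eta>" using min by blast
    moreover have "f = \<one> \<otimes> f [^] (1::nat)" by simp
    then have "f \<in> ?S" using P.compl_one by blast
    ultimately show False using Q(3) f\<eta> by blast
  qed
  obtain k :: nat where k: "\<And>x. x \<in> U t \<Longrightarrow> \<exists>s\<in>carrier R - \<eta>. (s \<otimes> f [^] k) \<odot>\<^bsub>M\<^esub> x = \<zero>\<^bsub>M\<^esub>"
    using f_torsion_bounded[OF P U_sub tors] by blast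
  \<comment> \<open>From degree \<open>h\<close> on, the power of \<open>f\<close> in an operator
    contains \<open>f^k\<close>, so the operator vanishes locally on \<open>U t\<close>; this is
    where \<open>t > 0\<close> is used.\<close>
  obtain h where h: "\<And>e. e \<ge> h \<Longrightarrow> k \<le> fexp p t e" using fexp_large[OF t p2] by blast
  have "x0 \<in> addspan M (cgens t (Suc h) (U t))" using U_span x0(1) by blast
  then have "\<exists>s\<in>carrier R - \<eta>. s \<odot>\<^bsub>M\<^esub> x0 = \<zero>\<^bsub>M\<^esub>"
  proof induction
    case addspan_zero then show ?case using P.compl_one by (auto intro!: bexI[of _ \<one>])
  next
    case (addspan_add v y)
    obtain e r n where v: "v = cop t e r n" "e \<ge> Suc h" "r \<in> carrier R" "n \<in> U t" using addspan_add by blast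
    obtain s where s: "s \<in> carrier R - \<eta>" "s \<odot>\<^bsub>M\<^esub> y = \<zero>\<^bsub>M\<^esub>" using addspan_add by blast
    obtain u where u: "u \<in> carrier R - \<eta>" "(u \<otimes> f [^] k) \<odot>\<^bsub>M\<^esub> n = \<zero>\<^bsub>M\<^esub>" using k[OF v(4)] by blast
    have nc: "n \<in> carrier M" using v(4) U_closed by blast
    have yc: "y \<in> carrier M" using addspan_add(2) M.addspan_closed[OF cp_gens_closed[OF U_closed]] by blast
    have vc: "v \<in> carrier M" unfolding v(1) by (rule cop_closed[OF v(3) nc])
    obtain q where q: "p ^ e = Suc q" using p2 by (cases "p ^ e") auto
    have "k \<le> fexp p t e" using h v(2) by simp
    then have "f [^] fexp p t e = f [^] (fexp p t e - k) \<otimes> f [^] k" by (simp add: nat_pow_mult)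
    then have "(f [^] fexp p t e \<otimes> r) \<odot>\<^bsub>M\<^esub> (u [^] (p ^ e) \<odot>\<^bsub>M\<^esub> n)
        = (u [^] q \<otimes> f [^] (fexp p t e - k) \<otimes> r) \<odot>\<^bsub>M\<^esub> ((u \<otimes> f [^] k) \<odot>\<^bsub>M\<^esub> n)"
      unfolding q using u(1) v(3) nc by (simp add: smult_assoc1[symmetric] m_ac)
    also have "\<dots> = \<zero>\<^bsub>M\<^esub>" unfolding u(2) using u(1) v(3) by simp
    finally have "u \<odot>\<^bsub>M\<^esub> v = \<zero>\<^bsub>M\<^esub>" unfolding v(1) using smult_cop[OF v(3) nc, of u] u(1) by (simp add:
        cop_def \<kappa>_pow_zero)
    moreover have "(s \<otimes> u) \<odot>\<^bsub>M\<^esub> (v \<oplus>\<^bsub>M\<^esub> y) = s \<odot>\<^bsub>M\<^esub> (u \<odot>\<^bsub>M\<^esub> v) \<oplus>\<^bsub>M\<^esub> u \<odot>\<^bsub>M\<^esub> (s \<odot>\<^bsub>M\<^esub> y)"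
      using s(1) u(1) vc yc by (simp add: smult_r_distr smult_assoc1[symmetric] m_comm)
    ultimately have "(s \<otimes> u) \<odot>\<^bsub>M\<^esub> (v \<oplus>\<^bsub>M\<^esub> y) = \<zero>\<^bsub>M\<^esub>" using s u by simp
    then show ?case using P.compl_mult[OF s(1) u(1)] by blast
  qed
  then show False using x0(2) by blast
qed

end

text \<open>\<open>tau s\<close> is stable under the operators for \<open>t\<close>, but may be
  generically larger than \<open>U t\<close>, so it is cut down to
  \<open>tau s \<inter> U t\<close>. This is generically full for \<open>t\<close>: a generic point
  of \<open>U t\<close> misses \<open>f\<close>, a power of \<open>f\<close> multiplies
  \<open>U s\<close> into \<open>U t\<close>, and so the point is generic for \<open>U s\<close>
  too.\<close>

lemma (in tau_cartier) tau_antimono: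
  assumes s: "s \<ge> 0" and st: "s \<le> t"
  shows "tau t \<subseteq> tau s"
proof (cases "s = t")
  case False
  then have t: "t > 0" and lt: "s \<le> t" using s st by auto
  have c: "csub t (tau s)" by (rule csub_antimono[OF lt tau_csub])
  have "gen_csub t (tau s \<inter> U t)" unfolding gen_csub_iff
  proof (intro conjI ballI)
    show "csub t (tau s \<inter> U t)" by (rule csub_Int[OF c U_csub])
    fix \<eta> assume \<eta>: "\<eta> \<in> generic_points R M (U t)"
    have P: "primeideal \<eta> R" using generic_points_prime[OF \<eta>] .
    have f\<eta>: "f \<notin> \<eta>" by (rule f_notin_generic[OF t \<eta>])
    show "loc_le \<eta> (tau s \<inter> U t) (U t)" by (rule loc_le_subset[OF P]) (use U_closed in auto)
    have "\<eta> \<in> supp R M (U t)" using \<eta> generic_points_subset by blast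
    then have "\<eta> \<in> supp R M (U s)" using supp_iff[OF U_sub] U_antimono[OF lt] by blast
    \<comment> \<open>A prime inside \<open>\<eta>\<close> also misses \<open>f\<close>, so
      multiplying by the power of \<open>f\<close> carries a locally nonzero element of
      \<open>U s\<close> to one of \<open>U t\<close>. Minimality of \<open>\<eta>\<close> for
      \<open>U t\<close> then applies.\<close>
    moreover have "Q = \<eta>" if Q: "Q \<in> supp R M (U s)" "Q \<subseteq> \<eta>" for Q
    proof -
      have QP: "primeideal Q R" and "\<exists>x\<in>U s. \<forall>u\<in>carrier R - Q. u \<odot>\<^bsub>M\<^esub> x \<noteq> \<zero>\<^bsub>M\<^esub>" using Q(1) supp_iff[OF
          U_sub] by auto
      then obtain x where x: "x \<in> U s" "\<And>u. u \<in> carrier R - Q \<Longrightarrow> u \<odot>\<^bsub>M\<^esub> x \<noteq> \<zero>\<^bsub>M\<^esub>" by blast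
      let ?m = "2 * fexp p t 0"
      have xc: "x \<in> carrier M" using x(1) U_closed by blast
      have fQ: "f [^] ?m \<in> carrier R - Q" using primeideal.compl_pow[OF QP, of f ?m] f\<eta> Q(2) by blast
      have "u \<odot>\<^bsub>M\<^esub> (f [^] ?m \<odot>\<^bsub>M\<^esub> x) \<noteq> \<zero>\<^bsub>M\<^esub>" if u: "u \<in> carrier R - Q" for u
        using x(2)[OF primeideal.compl_mult[OF QP u fQ]] u xc by (simp add: smult_assoc1)
      then have "Q \<in> supp R M (U t)" using supp_iff[OF U_sub] QP f_pow_U[OF x(1)] by blast
      then show "Q = \<eta>" using \<eta> Q(2) unfolding generic_points_def by blast
    qed
    ultimately have \<eta>s: "\<eta> \<in> generic_points R M (U s)" unfolding generic_points_def by blast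
    show "loc_le \<eta> (U t) (tau s \<inter> U t)" unfolding loc_le_def
    proof
      fix x assume x: "x \<in> U t"
      then have "x \<in> U s" using U_antimono[OF lt] by blast
      then obtain w where w: "w \<in> carrier R - \<eta>" "w \<odot>\<^bsub>M\<^esub> x \<in> tau s"
        using tau_gen[of s] \<eta>s unfolding gen_csub_iff loc_le_def by blast
      moreover have "w \<odot>\<^bsub>M\<^esub> x \<in> U t" using submoduleE(4)[OF U_sub _ x] w(1) by blast
      ultimately show "\<exists>w\<in>carrier R - \<eta>. w \<odot>\<^bsub>M\<^esub> x \<in> tau s \<inter> U t" by blast
    qed
  qed
  then show ?thesis using tau_least by blast
qed simp

section \<open>Morphisms and nil-isomorphisms\<close>

locale cartier_morphism = M: cartier R M p \<kappa>\<^sub>M f + N: cartier R N p \<kappa>\<^sub>N f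
  for R (structure) and M (structure) and N (structure) and p \<kappa>\<^sub>M \<kappa>\<^sub>N f +
  fixes \<phi>
  assumes \<phi>_closed: "m \<in> carrier M \<Longrightarrow> \<phi> m \<in> carrier N"
    and \<phi>_add: "\<lbrakk>m \<in> carrier M; n \<in> carrier M\<rbrakk> \<Longrightarrow> \<phi> (m \<oplus>\<^bsub>M\<^esub> n) = \<phi> m \<oplus>\<^bsub>N\<^esub> \<phi> n"
    and \<phi>_smult: "\<lbrakk>r \<in> carrier R; m \<in> carrier M\<rbrakk> \<Longrightarrow> \<phi> (r \<odot>\<^bsub>M\<^esub> m) = r \<odot>\<^bsub>N\<^esub> \<phi> m"
    and \<phi>_\<kappa>: "m \<in> carrier M \<Longrightarrow> \<phi> (\<kappa>\<^sub>M m) = \<kappa>\<^sub>N (\<phi> m)"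
begin

lemma \<phi>_zero: "\<phi> \<zero>\<^bsub>M\<^esub> = \<zero>\<^bsub>N\<^esub>"
  using \<phi>_smult[of "\<zero>" "\<zero>\<^bsub>M\<^esub>"] \<phi>_closed[of "\<zero>\<^bsub>M\<^esub>"] by simp

lemma \<phi>_\<kappa>_pow: "m \<in> carrier M \<Longrightarrow> \<phi> ((\<kappa>\<^sub>M ^^ e) m) = (\<kappa>\<^sub>N ^^ e) (\<phi> m)"
  by (induction e) (auto simp: \<phi>_\<kappa> M.\<kappa>_pow_closed)

lemma \<phi>_cop: "\<lbrakk>r \<in> carrier R; m \<in> carrier M\<rbrakk> \<Longrightarrow> \<phi> (M.cop t e r m) = N.cop t e r (\<phi> m)"
  unfolding M.cop_def N.cop_def by (simp add: \<phi>_\<kappa>_pow \<phi>_smult)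

lemma image_submodule:
  assumes "submodule H R M"
  shows "submodule (\<phi> ` H) R N"
proof (rule N.submodule_if_closed)
  note H = M.submoduleE[OF assms] and H0 = M.submodule_zero[OF assms]
  show "\<phi> ` H \<subseteq> carrier N" using H(1) \<phi>_closed by blast
  show "\<zero>\<^bsub>N\<^esub> \<in> \<phi> ` H" using H0 \<phi>_zero by force
  show "x \<oplus>\<^bsub>N\<^esub> y \<in> \<phi> ` H" if xy: "x \<in> \<phi> ` H" "y \<in> \<phi> ` H" for x y
  proof -
    obtain a b where ab: "x = \<phi> a" "y = \<phi> b" "a \<in> H" "b \<in> H" using xy by blast
    then have "x \<oplus>\<^bsub>N\<^esub> y = \<phi> (a \<oplus>\<^bsub>M\<^esub> b)" using H(1) \<phi>_add by (simp add: subset_iff)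
    then show ?thesis using H(5)[OF ab(3,4)] by blast
  qed
  show "r \<odot>\<^bsub>N\<^esub> x \<in> \<phi> ` H" if rx: "r \<in> carrier R" "x \<in> \<phi> ` H" for r x
  proof -
    obtain a where a: "x = \<phi> a" "a \<in> H" using rx by blast
    then have "r \<odot>\<^bsub>N\<^esub> x = \<phi> (r \<odot>\<^bsub>M\<^esub> a)" using H(1) \<phi>_smult rx(1) by (simp add: subset_iff)
    then show ?thesis using H(4)[OF rx(1) a(2)] by blast
  qed
qed

lemma image_csub: "M.csub t H \<Longrightarrow> N.csub t (\<phi> ` H)"
proof -
  assume H: "M.csub t H"
  have "N.cop t e r n \<in> \<phi> ` H" if a: "e \<ge> 1" "r \<in> carrier R" "n \<in> \<phi> ` H" for e r n
  proof -
    obtain m where m: "n = \<phi> m" "m \<in> H" using a(3) by blast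
    have "N.cop t e r n = \<phi> (M.cop t e r m)" unfolding m(1)
      using \<phi>_cop[OF a(2)] m(2) M.csub_closed[OF H] by (simp add: subset_iff)
    then show ?thesis using M.csub_cop[OF H a(1,2) m(2)] by blast
  qed
  then show ?thesis unfolding N.csub_iff using image_submodule[OF M.csub_submodule[OF H]] by blast
qed

lemma image_cp:
  assumes H: "H \<subseteq> carrier M"
  shows "\<phi> ` M.cp t H = N.cp t (\<phi> ` H)"
proof
  have HN: "\<phi> ` H \<subseteq> carrier N" using H \<phi>_closed by blast
  show "N.cp t (\<phi> ` H) \<subseteq> \<phi> ` M.cp t H"
  proof (rule N.cp_least[OF image_submodule[OF M.cp_submodule[OF H]] HN])
    fix e r n assume a: "(1::nat) \<le> e" "r \<in> carrier R" "n \<in> \<phi> ` H"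
    then obtain m where m: "n = \<phi> m" "m \<in> H" by blast
    have "N.cop t e r n = \<phi> (M.cop t e r m)" unfolding m(1)
      using \<phi>_cop[OF a(2)] m(2) H by (simp add: subset_iff)
    then show "N.cop t e r n \<in> \<phi> ` M.cp t H" using M.cop_in_cp[OF H a(1,2) m(2)] by blast
  qed
  show "\<phi> ` M.cp t H \<subseteq> N.cp t (\<phi> ` H)"
  proof
    fix y assume "y \<in> \<phi> ` M.cp t H"
    then obtain x where x: "y = \<phi> x" "x \<in> addspan M (M.cgens t 1 H)"
      unfolding M.cp_eq_addspan[OF H] by blast
    show "y \<in> N.cp t (\<phi> ` H)" unfolding x(1) N.cp_eq_addspan[OF HN]
    proof (rule M.M.addspan_map[OF N.M.abelian_group_axioms M.cp_gens_closed[OF H] x(2) N.cp_gens_closed[OF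
        HN]])
      fix z assume "z \<in> (M.cgens t 1 H)"
      then obtain e r n where z: "z = M.cop t e r n" "e \<ge> 1" "r \<in> carrier R" "n \<in> H" by blast
      have "\<phi> z = N.cop t e r (\<phi> n)" unfolding z(1) using \<phi>_cop[OF z(3)] z(4) H by (simp add: subset_iff)
      then have "\<phi> z \<in> (N.cgens t 1 (\<phi> ` H))" using z by blast
      then show "\<phi> z \<in> addspan N (N.cgens t 1 (\<phi> ` H))"
        by (rule N.M.addspan_incl[OF _ N.cp_gens_closed[OF HN]])
    qed (use \<phi>_zero \<phi>_add in auto)
  qed
qed

lemma image_cp_pow: "M.csub t H \<Longrightarrow> \<phi> ` ((M.cp t ^^ h) H) = (N.cp t ^^ h) (\<phi> ` H)"
  by (induction h) (auto simp: image_cp M.cp_pow_closed)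

text \<open>The image is stable under \<open>\<kappa>\<^sub>N\<close>, so the map induced on cosets
  can be computed on any representative, and its vanishing power says that
  \<open>\<kappa>\<^sub>N^e\<close> ends in the image.\<close>

lemma nilpotent_coker:
  assumes "nilpotent_cartier (quot_mod N (\<phi> ` carrier M)) (quot_map N (\<phi> ` carrier M) \<kappa>\<^sub>N)"
  shows "\<exists>e. \<forall>n\<in>carrier N. (\<kappa>\<^sub>N ^^ e) n \<in> \<phi> ` carrier M"
proof -
  define I where "I = \<phi> ` carrier M"
  have I: "submodule I R N" unfolding I_def by (rule image_submodule[OF M.carrier_is_submodule])
  note IN = N.submoduleE[OF I]
  have I\<kappa>: "\<kappa>\<^sub>N i \<in> I" if "i \<in> I" for i
    using that \<phi>_\<kappa> M.\<kappa>_closed unfolding I_def by (metis (no_types, lifting) imageE imageI)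
  have coset: "I +>\<^bsub>N\<^esub> x = {i \<oplus>\<^bsub>N\<^esub> x | i. i \<in> I}" for x unfolding a_r_coset_def' by auto
  have shift: "I +>\<^bsub>N\<^esub> (i \<oplus>\<^bsub>N\<^esub> x) = I +>\<^bsub>N\<^esub> x" if "i \<in> I" "x \<in> carrier N" for i x
    by (rule N.M.a_repr_independence[OF _ that(2) submodule.axioms(1)[OF I], symmetric])
       (use that(1) in \<open>auto simp: coset\<close>)
  have self: "x \<in> I +>\<^bsub>N\<^esub> x" if x: "x \<in> carrier N" for x
  proof -
    have "x = \<zero>\<^bsub>N\<^esub> \<oplus>\<^bsub>N\<^esub> x" using x by simp
    then show ?thesis unfolding coset using N.submodule_zero[OF I] by blast
  qed
  have step: "quot_map N I \<kappa>\<^sub>N (I +>\<^bsub>N\<^esub> x) = I +>\<^bsub>N\<^esub> \<kappa>\<^sub>N x" if x: "x \<in> carrier N" for x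
  proof -
    have "I +>\<^bsub>N\<^esub> \<kappa>\<^sub>N y = I +>\<^bsub>N\<^esub> \<kappa>\<^sub>N x" if y: "y \<in> I +>\<^bsub>N\<^esub> x" for y
    proof -
      obtain i where i: "y = i \<oplus>\<^bsub>N\<^esub> x" "i \<in> I" using y unfolding coset by blast
      have "\<kappa>\<^sub>N y = \<kappa>\<^sub>N i \<oplus>\<^bsub>N\<^esub> \<kappa>\<^sub>N x" unfolding i(1) using i(2) IN(1) x by (intro N.\<kappa>_add) auto
      then show ?thesis using shift[OF I\<kappa>[OF i(2)] N.\<kappa>_closed[OF x]] by simp
    qed
    then show ?thesis unfolding quot_map_def using self[OF x] by blast
  qed
  have pow: "(quot_map N I \<kappa>\<^sub>N ^^ e) (I +>\<^bsub>N\<^esub> x) = I +>\<^bsub>N\<^esub> (\<kappa>\<^sub>N ^^ e) x" if x: "x \<in> carrier N" for e x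
    by (induction e) (auto simp: step N.\<kappa>_pow_closed x)
  obtain e where e: "\<And>V. V \<in> carrier (quot_mod N I) \<Longrightarrow> (quot_map N I \<kappa>\<^sub>N ^^ e) V = \<zero>\<^bsub>quot_mod N I\<^esub>"
    using assms unfolding nilpotent_cartier_def I_def by blast
  have "(\<kappa>\<^sub>N ^^ e) n \<in> I" if n: "n \<in> carrier N" for n
  proof -
    have "I +>\<^bsub>N\<^esub> n \<in> carrier (quot_mod N I)" unfolding quot_mod_def A_RCOSETS_def' using n by auto
    then have "I +>\<^bsub>N\<^esub> (\<kappa>\<^sub>N ^^ e) n = I" using e[of "I +>\<^bsub>N\<^esub> n"] unfolding pow[OF n] by (simp add: quot_mod_def)
    then show ?thesis using self[OF N.\<kappa>_pow_closed[OF n, of e]] by simp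
  qed
  then show ?thesis unfolding I_def by blast
qed

end

locale nil_iso = cartier_morphism R M N p \<kappa>\<^sub>M \<kappa>\<^sub>N f \<phi> +
    M: tau_cartier R M p \<kappa>\<^sub>M f + N: tau_cartier R N p \<kappa>\<^sub>N f
  for R (structure) and M (structure) and N (structure) and p \<kappa>\<^sub>M \<kappa>\<^sub>N f \<phi> +
  assumes nil_ker: "\<exists>e. \<forall>m\<in>carrier M. \<phi> m = \<zero>\<^bsub>N\<^esub> \<longrightarrow> (\<kappa>\<^sub>M ^^ e) m = \<zero>\<^bsub>M\<^esub>"
    and nil_coker: "\<exists>e. \<forall>n\<in>carrier N. (\<kappa>\<^sub>N ^^ e) n \<in> \<phi> ` carrier M"
begin

text \<open>\<open>N.U t\<close> is spanned by operators of degree above \<open>c\<close>, whose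
  outermost \<open>c\<close> applications of \<open>\<kappa>\<^sub>N\<close> already land in the
  image of \<open>\<phi>\<close>. Applying \<open>N.cp t\<close> repeatedly to this inclusion leaves
  \<open>N.U t\<close> fixed and turns the image of \<open>M\<close> into the image of
  \<open>M.U t\<close>.\<close>

lemma image_U: "\<phi> ` M.U t = N.U t"
proof -
  obtain h0 where h0: "\<And>h. h \<ge> h0 \<Longrightarrow> (M.cp t ^^ h) (carrier M) = M.U t" using M.U_eventually by blast
  obtain h1 where h1: "\<And>h. h \<ge> h1 \<Longrightarrow> (N.cp t ^^ h) (carrier N) = N.U t" using N.U_eventually by blast
  obtain c where c: "\<And>n. n \<in> carrier N \<Longrightarrow> (\<kappa>\<^sub>N ^^ c) n \<in> \<phi> ` carrier M" using nil_coker by blast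
  note Ic = image_csub[OF M.csub_carrier]
  define h where "h = max h0 h1"
  have MU: "\<phi> ` M.U t = (N.cp t ^^ h) (\<phi> ` carrier M)"
    using image_cp_pow[OF M.csub_carrier, where t = t and h = h] h0[of h] unfolding h_def by simp
  have "N.U t \<subseteq> addspan N (N.cgens t (Suc c) (N.U t))" by (rule N.U_span)
  also have "\<dots> \<subseteq> \<phi> ` carrier M"
  proof (rule addspan_least)
    show "(N.cgens t (Suc c) (N.U t)) \<subseteq> \<phi> ` carrier M"
    proof
      fix x assume "x \<in> (N.cgens t (Suc c) (N.U t))"
      then obtain e r n where x: "x = N.cop t e r n" "e \<ge> Suc c" "r \<in> carrier R" "n \<in> N.U t" by blast
      have nc: "n \<in> carrier N" using x(4) N.U_closed by blast
      define z where "z = (\<kappa>\<^sub>N ^^ (e - c)) ((f [^] fexp p t e \<otimes> r) \<odot>\<^bsub>N\<^esub> n)"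
      have "x = (\<kappa>\<^sub>N ^^ (c + (e - c))) ((f [^] fexp p t e \<otimes> r) \<odot>\<^bsub>N\<^esub> n)"
        unfolding x(1) N.cop_def using x(2) by simp
      then have "x = (\<kappa>\<^sub>N ^^ c) z" unfolding z_def funpow_add by simp
      moreover have "z \<in> carrier N" unfolding z_def using x(3) nc by (intro N.\<kappa>_pow_closed) simp
      ultimately show "x \<in> \<phi> ` carrier M" using c by simp
    qed
  qed (use N.submoduleE(5)[OF N.csub_submodule[OF Ic]] N.submodule_zero[OF N.csub_submodule[OF Ic]] in auto)
  finally have "N.U t \<subseteq> \<phi> ` carrier M" .
  then have "(N.cp t ^^ h) (N.U t) \<subseteq> (N.cp t ^^ h) (\<phi> ` carrier M)" by (rule N.cp_pow_mono[OF N.U_csub Ic])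
  then have "N.U t \<subseteq> \<phi> ` M.U t" unfolding N.cp_pow_U MU .
  moreover have "(N.cp t ^^ h) (\<phi> ` carrier M) \<subseteq> (N.cp t ^^ h) (carrier N)"
    by (rule N.cp_pow_mono[OF Ic N.csub_carrier N.csub_closed[OF Ic]])
  then have "\<phi> ` M.U t \<subseteq> N.U t" unfolding MU using h1[of h] unfolding h_def by simp
  ultimately show ?thesis by blast
qed

lemma supp_U: "supp R M (M.U t) = supp R N (N.U t)"
proof
  show "supp R N (N.U t) \<subseteq> supp R M (M.U t)"
  proof
    fix P assume P: "P \<in> supp R N (N.U t)"
    then obtain x where x: "primeideal P R" "x \<in> N.U t" "\<And>s. s \<in> carrier R - P \<Longrightarrow> s \<odot>\<^bsub>N\<^esub> x \<noteq> \<zero>\<^bsub>N\<^esub>"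
      using N.supp_iff[OF N.U_sub] by blast
    obtain y where y: "x = \<phi> y" "y \<in> M.U t" using x(2) image_U by blast
    have yc: "y \<in> carrier M" using y(2) M.U_closed by blast
    have "s \<odot>\<^bsub>M\<^esub> y \<noteq> \<zero>\<^bsub>M\<^esub>" if s: "s \<in> carrier R - P" for s
      using x(3)[OF s] \<phi>_smult[of s y] \<phi>_zero s yc unfolding y(1) by auto
    then show "P \<in> supp R M (M.U t)" using M.supp_iff[OF M.U_sub] x(1) y(2) by blast
  qed
  show "supp R M (M.U t) \<subseteq> supp R N (N.U t)"
  proof
    fix P assume P: "P \<in> supp R M (M.U t)"
    have pr: "primeideal P R" using P M.supp_iff[OF M.U_sub] by blast
    obtain c where c: "\<And>m. \<lbrakk>m \<in> carrier M; \<phi> m = \<zero>\<^bsub>N\<^esub>\<rbrakk> \<Longrightarrow> (\<kappa>\<^sub>M ^^ c) m = \<zero>\<^bsub>M\<^esub>" using nil_ker by blast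
    let ?K = "{m \<in> carrier M. \<phi> m = \<zero>\<^bsub>N\<^esub>}"
    have K: "submodule ?K R M"
      by (rule M.submodule_if_closed) (auto simp: \<phi>_zero \<phi>_add \<phi>_smult)
    show "P \<in> supp R N (N.U t)"
    proof (rule ccontr)
      assume no: "P \<notin> supp R N (N.U t)"
      \<comment> \<open>If \<open>N.U t\<close> vanishes at \<open>P\<close>, then
        \<open>M.U t\<close> lies locally in the kernel \<open>?K\<close>; applying operators of
        high degree to it then gives zero.\<close>
      have le: "M.loc_le P (M.U t) ?K" unfolding M.loc_le_def
      proof
        fix x assume x: "x \<in> M.U t"
        have xc: "x \<in> carrier M" using x M.U_closed by blast
        have "\<phi> x \<in> N.U t" using x image_U by blast
        then obtain s where s: "s \<in> carrier R - P" "s \<odot>\<^bsub>N\<^esub> \<phi> x = \<zero>\<^bsub>N\<^esub>" using no pr N.supp_iff[OF N.U_sub]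
            by blast
        then have "s \<odot>\<^bsub>M\<^esub> x \<in> ?K" using \<phi>_smult[of s x] xc by auto
        then show "\<exists>s\<in>carrier R - P. s \<odot>\<^bsub>M\<^esub> x \<in> ?K" using s(1) by blast
      qed
      have zero: "addspan M (M.cgens t (Suc c) ?K) \<subseteq> {\<zero>\<^bsub>M\<^esub>}"
      proof (rule addspan_least)
        show "(M.cgens t (Suc c) ?K) \<subseteq> {\<zero>\<^bsub>M\<^esub>}"
        proof
          fix x assume "x \<in> (M.cgens t (Suc c) ?K)"
          then obtain e r n where x: "x = M.cop t e r n" "e \<ge> Suc c" "r \<in> carrier R" "n \<in> ?K" by blast
          have "(f [^] fexp p t e \<otimes> r) \<odot>\<^bsub>M\<^esub> n \<in> ?K" by (rule M.submoduleE(4)[OF K _ x(4)]) (use x(3) in auto)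
          then have z: "(\<kappa>\<^sub>M ^^ c) ((f [^] fexp p t e \<otimes> r) \<odot>\<^bsub>M\<^esub> n) = \<zero>\<^bsub>M\<^esub>" using c by blast
          \<comment> \<open>Here the innermost \<open>c\<close> applications count, since they kill
            the kernel; for the cokernel in \<open>image_U\<close> it was the outermost
            ones.\<close>
          have "x = (\<kappa>\<^sub>M ^^ ((e - c) + c)) ((f [^] fexp p t e \<otimes> r) \<odot>\<^bsub>M\<^esub> n)"
            unfolding x(1) M.cop_def using x(2) by simp
          then show "x \<in> {\<zero>\<^bsub>M\<^esub>}" unfolding funpow_add comp_def z by (simp add: M.\<kappa>_pow_zero)
        qed
      qed auto
      have "\<exists>s\<in>carrier R - P. s \<odot>\<^bsub>M\<^esub> x = \<zero>\<^bsub>M\<^esub>" if x: "x \<in> M.U t" for x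
      proof -
        have "x \<in> addspan M (M.cgens t (Suc c) (M.U t))" using M.U_span x by blast
        from M.cop_loc[OF pr K M.U_closed le this] show ?thesis using zero by blast
      qed
      then show False using P M.supp_iff[OF M.U_sub] by blast
    qed
  qed
qed

lemma generic_points_U: "generic_points R M (M.U t) = generic_points R N (N.U t)"
  unfolding generic_points_def supp_U ..

lemma image_tau: "\<phi> ` M.tau t = N.tau t"
proof
  have "N.gen_csub t (\<phi> ` M.tau t)" unfolding N.gen_csub_iff
  proof (intro conjI ballI)
    show "N.csub t (\<phi> ` M.tau t)" by (rule image_csub[OF M.tau_csub])
    have tr: "N.loc_le P (\<phi> ` H) (\<phi> ` K)" if le: "M.loc_le P H K" and H: "H \<subseteq> carrier M" for P H K
      unfolding N.loc_le_def
    proof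
      fix x assume "x \<in> \<phi> ` H"
      then obtain y where y: "x = \<phi> y" "y \<in> H" by blast
      obtain s where s: "s \<in> carrier R - P" "s \<odot>\<^bsub>M\<^esub> y \<in> K" using M.loc_leD[OF le y(2)] by blast
      have "s \<odot>\<^bsub>N\<^esub> x = \<phi> (s \<odot>\<^bsub>M\<^esub> y)" unfolding y(1) using \<phi>_smult[of s y] s(1) y(2) H by auto
      then show "\<exists>s\<in>carrier R - P. s \<odot>\<^bsub>N\<^esub> x \<in> \<phi> ` K" using s by auto
    qed
    fix \<eta> assume "\<eta> \<in> generic_points R N (N.U t)"
    then have \<eta>: "\<eta> \<in> generic_points R M (M.U t)" unfolding generic_points_U .
    then have "M.loc_le \<eta> (M.tau t) (M.U t)" "M.loc_le \<eta> (M.U t) (M.tau t)"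
      using M.tau_gen[of t] unfolding M.gen_csub_iff by auto
    from tr[OF this(1) M.csub_closed[OF M.tau_csub]] tr[OF this(2) M.U_closed]
    show "N.loc_le \<eta> (\<phi> ` M.tau t) (N.U t)" "N.loc_le \<eta> (N.U t) (\<phi> ` M.tau t)"
      unfolding image_U by auto
  qed
  then show "N.tau t \<subseteq> \<phi> ` M.tau t" by (rule N.tau_least)
  \<comment> \<open>The plain preimage contains the whole kernel, which need not lie in
    \<open>M.U t\<close> at the generic points; hence the restriction to
    \<open>M.U t\<close>.\<close>
  define T where "T = {x \<in> M.U t. \<phi> x \<in> N.tau t}"
  note tN = N.submoduleE[OF N.csub_submodule[OF N.tau_csub[of t]]] and uM = M.submoduleE[OF M.U_sub[of t]]
  have "M.gen_csub t T" unfolding M.gen_csub_iff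
  proof (intro conjI ballI)
    show "M.csub t T" unfolding M.csub_iff
    proof (intro conjI allI impI)
      show "submodule T R M"
      proof (rule M.submodule_if_closed)
        show "T \<subseteq> carrier M" unfolding T_def using M.U_closed by blast
        show "\<zero>\<^bsub>M\<^esub> \<in> T" unfolding T_def
          using M.submodule_zero[OF M.U_sub] N.submodule_zero[OF N.csub_submodule[OF N.tau_csub]] by (simp
              add: \<phi>_zero)
        show "a \<oplus>\<^bsub>M\<^esub> b \<in> T" if "a \<in> T" "b \<in> T" for a b
          using that \<phi>_add[of a b] subsetD[OF M.U_closed[of t]] uM(5)[of a b] tN(5)[of "\<phi> a" "\<phi> b"]
              unfolding T_def by auto
        show "r \<odot>\<^bsub>M\<^esub> a \<in> T" if "r \<in> carrier R" "a \<in> T" for r a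
          using that \<phi>_smult[of r a] subsetD[OF M.U_closed[of t]] uM(4)[of r a] tN(4)[of r "\<phi> a"] unfolding
              T_def by auto
      qed
      fix e r n assume a: "(1::nat) \<le> e" "r \<in> carrier R" "n \<in> T"
      then have n: "n \<in> M.U t" "\<phi> n \<in> N.tau t" unfolding T_def by auto
      have "\<phi> (M.cop t e r n) = N.cop t e r (\<phi> n)" using \<phi>_cop[OF a(2)] n(1) M.U_closed by blast
      then show "M.cop t e r n \<in> T" unfolding T_def
        using M.csub_cop[OF M.U_csub a(1,2) n(1)] N.csub_cop[OF N.tau_csub a(1,2) n(2)] by simp
    qed
    fix \<eta> assume \<eta>: "\<eta> \<in> generic_points R M (M.U t)"
    then have \<eta>N: "\<eta> \<in> generic_points R N (N.U t)" unfolding generic_points_U .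
    show "M.loc_le \<eta> T (M.U t)"
      by (rule M.loc_le_subset[OF M.generic_points_prime[OF \<eta>]]) (use M.U_closed in \<open>auto simp: T_def\<close>)
    have le: "N.loc_le \<eta> (N.U t) (N.tau t)" using N.tau_gen[of t] \<eta>N unfolding N.gen_csub_iff by blast
    show "M.loc_le \<eta> (M.U t) T" unfolding M.loc_le_def
    proof
      fix x assume x: "x \<in> M.U t"
      then have "\<phi> x \<in> N.U t" using image_U by blast
      then obtain s where s: "s \<in> carrier R - \<eta>" "s \<odot>\<^bsub>N\<^esub> \<phi> x \<in> N.tau t" using N.loc_leD[OF le] by blast
      have "\<phi> (s \<odot>\<^bsub>M\<^esub> x) = s \<odot>\<^bsub>N\<^esub> \<phi> x" using \<phi>_smult[of s x] s(1) x M.U_closed by blast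
      moreover have "s \<odot>\<^bsub>M\<^esub> x \<in> M.U t" using uM(4)[of s x] s(1) x by blast
      ultimately have "s \<odot>\<^bsub>M\<^esub> x \<in> T" unfolding T_def using s(2) by simp
      then show "\<exists>s\<in>carrier R - \<eta>. s \<odot>\<^bsub>M\<^esub> x \<in> T" using s(1) by blast
    qed
  qed
  then have "M.tau t \<subseteq> T" by (rule M.tau_least)
  then show "\<phi> ` M.tau t \<subseteq> N.tau t" unfolding T_def by blast
qed

end

section \<open>Colimits\<close>

locale seq_colim =
  fixes R :: "('a, 'x) ring_scheme" and G :: "nat \<Rightarrow> ('a, 'c, 'y) module_scheme" and T :: "'c \<Rightarrow> 'c"
  assumes G_module: "module R (G i)"
    and T_closed: "x \<in> carrier (G i) \<Longrightarrow> T x \<in> carrier (G (Suc i))"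
    and T_add: "\<lbrakk>x \<in> carrier (G i); y \<in> carrier (G i)\<rbrakk> \<Longrightarrow> T (x \<oplus>\<^bsub>G i\<^esub> y) = T x \<oplus>\<^bsub>G (Suc i)\<^esub> T y"
    and T_smult: "\<lbrakk>r \<in> carrier R; x \<in> carrier (G i)\<rbrakk> \<Longrightarrow> T (r \<odot>\<^bsub>G i\<^esub> x) = r \<odot>\<^bsub>G (Suc i)\<^esub> T x"
begin

abbreviation cls where "cls \<equiv> colim_class G T"

lemma G_cring: "cring R" using module.axioms(1)[OF G_module] .

lemma Tp_closed: "x \<in> carrier (G i) \<Longrightarrow> (T ^^ k) x \<in> carrier (G (i + k))"
  by (induction k) (auto intro: T_closed)

lemma Tp_closed': "x \<in> carrier (G i) \<Longrightarrow> (T ^^ k) x \<in> carrier (G (k + i))"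
  using Tp_closed[of x i k] by (simp add: add.commute)

lemma Tp_add: "\<lbrakk>x \<in> carrier (G i); y \<in> carrier (G i)\<rbrakk> \<Longrightarrow> (T ^^ k) (x \<oplus>\<^bsub>G i\<^esub> y) = (T ^^ k) x \<oplus>\<^bsub>G (i + k)\<^esub> (T
    ^^ k) y"
  by (induction k) (auto simp: T_add Tp_closed)

lemma Tp_smult: "\<lbrakk>r \<in> carrier R; x \<in> carrier (G i)\<rbrakk> \<Longrightarrow> (T ^^ k) (r \<odot>\<^bsub>G i\<^esub> x) = r \<odot>\<^bsub>G (i + k)\<^esub> (T ^^ k) x"
  by (induction k) (auto simp: T_smult Tp_closed)

lemma Tp_zero: "(T ^^ k) \<zero>\<^bsub>G i\<^esub> = \<zero>\<^bsub>G (i + k)\<^esub>"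
proof -
  interpret Gi: module R "G i" by (rule G_module)
  interpret Gk: module R "G (i + k)" by (rule G_module)
  have "(T ^^ k) (\<zero>\<^bsub>R\<^esub> \<odot>\<^bsub>G i\<^esub> \<zero>\<^bsub>G i\<^esub>) = \<zero>\<^bsub>R\<^esub> \<odot>\<^bsub>G (i + k)\<^esub> (T ^^ k) \<zero>\<^bsub>G i\<^esub>"
    by (rule Tp_smult) auto
  then show ?thesis using Tp_closed[of "\<zero>\<^bsub>G i\<^esub>" i k] by simp
qed

lemma Tp_Tp: "(T ^^ k) ((T ^^ l) x) = (T ^^ (k + l)) x"
  by (simp add: funpow_add)

lemma rel_equiv: "equiv (SIGMA i:UNIV. carrier (G i)) (colim_rel G T)"
proof (rule equivI)
  show "colim_rel G T \<subseteq> (SIGMA i:UNIV. carrier (G i)) \<times> (SIGMA i:UNIV. carrier (G i))"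
    unfolding colim_rel_def by auto
  show "refl_on (SIGMA i:UNIV. carrier (G i)) (colim_rel G T)"
    unfolding refl_on_def colim_rel_def by blast
  show "sym (colim_rel G T)"
    unfolding sym_def colim_rel_def by (auto; metis)
  show "trans (colim_rel G T)"
  proof (rule transI)
    fix a b c assume "(a, b) \<in> colim_rel G T" "(b, c) \<in> colim_rel G T"
    then obtain i x j y m z k l k' l' where h: "a = (i, x)" "b = (j, y)" "c = (m, z)"
      "x \<in> carrier (G i)" "z \<in> carrier (G m)" "i + k = j + l" "(T ^^ k) x = (T ^^ l) y"
      "j + k' = m + l'" "(T ^^ k') y = (T ^^ l') z" unfolding colim_rel_def by auto
    have "(T ^^ (k' + k)) x = (T ^^ (k' + l)) y" using h(7) by (simp add: funpow_add)
    also have "\<dots> = (T ^^ (l + k')) y" by (simp add: add.commute)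
    also have "\<dots> = (T ^^ (l + l')) z" using h(9) by (simp add: funpow_add)
    finally have "(T ^^ (k' + k)) x = (T ^^ (l + l')) z" .
    moreover have "i + (k' + k) = m + (l + l')" using h(6,8) by simp
    ultimately show "(a, c) \<in> colim_rel G T" unfolding colim_rel_def using h(1,3-5) by blast
  qed
qed

lemma cls_mem: "x \<in> carrier (G i) \<Longrightarrow> (j, y) \<in> cls i x \<longleftrightarrow> y \<in> carrier (G j) \<and> (\<exists>k l. i + k = j + l \<and> (T ^^ k)
    x = (T ^^ l) y)"
  unfolding colim_class_def colim_rel_def by auto

lemma cls_memE:
  assumes "(j, y) \<in> cls i x" "x \<in> carrier (G i)"
  obtains k l where "y \<in> carrier (G j)" "i + k = j + l" "(T ^^ k) x = (T ^^ l) y"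
  using assms(1) unfolding cls_mem[OF assms(2)] by blast

lemma cls_eqI:
  assumes "x \<in> carrier (G i)" "y \<in> carrier (G j)" "i + k = j + l" "(T ^^ k) x = (T ^^ l) y"
  shows "cls i x = cls j y"
proof -
  have "((i, x), (j, y)) \<in> colim_rel G T" unfolding colim_rel_def using assms by blast
  then show ?thesis unfolding colim_class_def by (rule equiv_class_eq[OF rel_equiv])
qed

lemma cls_eqD:
  assumes "x \<in> carrier (G i)" "y \<in> carrier (G j)" "cls i x = cls j y"
  shows "\<exists>k l. i + k = j + l \<and> (T ^^ k) x = (T ^^ l) y"
proof -
  have "(j, y) \<in> cls j y" using cls_mem[OF assms(2)] assms(2) by blast
  then show ?thesis using assms(3) cls_mem[OF assms(1)] by blast
qed

lemma cls_shift: "x \<in> carrier (G i) \<Longrightarrow> cls i x = cls (i + k) ((T ^^ k) x)"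
  by (rule cls_eqI[where k = k and l = 0]) (auto intro: Tp_closed)

lemma cls_carrier: "x \<in> carrier (G i) \<Longrightarrow> cls i x \<in> carrier (colim G T)"
  unfolding colim_def colim_class_def by (auto intro: quotientI)

lemma carrierE:
  assumes "U \<in> carrier (colim G T)"
  obtains i x where "x \<in> carrier (G i)" "U = cls i x"
  using assms unfolding colim_def colim_class_def by (auto elim!: quotientE)

lemma common_level:
  assumes "U \<in> carrier (colim G T)" "V \<in> carrier (colim G T)"
  obtains i x y where "x \<in> carrier (G i)" "y \<in> carrier (G i)" "U = cls i x" "V = cls i y"
proof -
  obtain i x where x: "x \<in> carrier (G i)" "U = cls i x" using carrierE[OF assms(1)] .
  obtain j y where y: "y \<in> carrier (G j)" "V = cls j y" using carrierE[OF assms(2)] .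
  show ?thesis
    by (rule that[of "(T ^^ j) x" "i + j" "(T ^^ i) y"])
       (use x y cls_shift[OF x(1), of j] cls_shift[OF y(1), of i] Tp_closed[OF x(1), of j] Tp_closed[OF
           y(1), of i]
         in \<open>simp_all add: add.commute\<close>)
qed

text \<open>The operations on colimits are unions over all representatives; such a union collapses
  as soon as the value is seen not to depend on the representative.\<close>

lemma UN_const:
  assumes "(i, x) \<in> U" "\<And>j y. (j, y) \<in> U \<Longrightarrow> F j y = F i x"
  shows "(\<Union>(j, y)\<in>U. F j y) = F i x"
proof
  show "(\<Union>(j, y)\<in>U. F j y) \<subseteq> F i x"
  proof
    fix z assume "z \<in> (\<Union>(j, y)\<in>U. F j y)"
    then obtain j y where "(j, y) \<in> U" "z \<in> F j y" by auto
    then show "z \<in> F i x" using assms(2)[of j y] by simp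
  qed
  show "F i x \<subseteq> (\<Union>(j, y)\<in>U. F j y)" using assms(1) by auto
qed

lemma cls_self: "x \<in> carrier (G i) \<Longrightarrow> (i, x) \<in> cls i x"
  using cls_mem by blast

lemma add_cls:
  assumes x: "x \<in> carrier (G i)" and y: "y \<in> carrier (G i)"
  shows "cls i x \<oplus>\<^bsub>colim G T\<^esub> cls i y = cls i (x \<oplus>\<^bsub>G i\<^esub> y)"
proof -
  let ?F = "\<lambda>i x j y. cls (i + j) ((T ^^ j) x \<oplus>\<^bsub>G (i + j)\<^esub> (T ^^ i) y)"
  have Fin: "(T ^^ j) x \<oplus>\<^bsub>G (i + j)\<^esub> (T ^^ i) y \<in> carrier (G (i + j))" if "x \<in> carrier (G i)" "y \<in> carrier
      (G j)" for x y i j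
  proof -
    interpret module R "G (i + j)" by (rule G_module)
    show ?thesis using Tp_closed[OF that(1), of j] Tp_closed'[OF that(2), of i] by simp
  qed
  have F: "?F i' x' j' y' = ?F i x i y" if x': "(i', x') \<in> cls i x" and y': "(j', y') \<in> cls i y" for i' x' j' y'
  proof -
    obtain k k' where k: "x' \<in> carrier (G i')" "i + k = i' + k'" "(T ^^ k) x = (T ^^ k') x'" using
        cls_memE[OF x' x] .
    obtain l l' where l: "y' \<in> carrier (G j')" "i + l = j' + l'" "(T ^^ l) y = (T ^^ l') y'" using
        cls_memE[OF y' y] .
    \<comment> \<open>A common level for the two sums: \<open>k' + l'\<close> steps above
      \<open>i' + j'\<close> and \<open>k + l\<close> steps above \<open>i + i\<close>.\<close>
    have lev: "(i' + j') + (k' + l') = (i + i) + (k + l)" using k(2) l(2) by simp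
    show ?thesis
    proof (rule cls_eqI[OF Fin[OF k(1) l(1)] Fin[OF x y] lev])
      have "(T ^^ (k' + l')) ((T ^^ j') x' \<oplus>\<^bsub>G (i' + j')\<^esub> (T ^^ i') y')
          = (T ^^ (k' + l')) ((T ^^ j') x') \<oplus>\<^bsub>G ((i' + j') + (k' + l'))\<^esub> (T ^^ (k' + l')) ((T ^^ i') y')"
        by (rule Tp_add[OF Tp_closed[OF k(1)] Tp_closed'[OF l(1)]])
      also have "(T ^^ (k' + l')) ((T ^^ j') x') = (T ^^ (l' + j')) ((T ^^ k') x')" by (simp add: Tp_Tp add_ac)
      also have "\<dots> = (T ^^ (l' + j')) ((T ^^ k) x)" unfolding k(3) ..
      also have "\<dots> = (T ^^ (k + l)) ((T ^^ i) x)" 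
      proof -
        have e: "l' + j' + k = k + l + i" using l(2) by simp
        show ?thesis unfolding Tp_Tp e ..
      qed
      also have "(T ^^ (k' + l')) ((T ^^ i') y') = (T ^^ (k' + i')) ((T ^^ l') y')" by (simp add: Tp_Tp add_ac)
      also have "\<dots> = (T ^^ (k' + i')) ((T ^^ l) y)" unfolding l(3) ..
      also have "\<dots> = (T ^^ (k + l)) ((T ^^ i) y)" 
      proof -
        have e: "k' + i' + l = k + l + i" using k(2) by simp
        show ?thesis unfolding Tp_Tp e ..
      qed
      also have "(T ^^ (k + l)) ((T ^^ i) x) \<oplus>\<^bsub>G ((i' + j') + (k' + l'))\<^esub> (T ^^ (k + l)) ((T ^^ i) y)
          = (T ^^ (k + l)) ((T ^^ i) x \<oplus>\<^bsub>G (i + i)\<^esub> (T ^^ i) y)"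
        unfolding lev by (rule Tp_add[OF Tp_closed[OF x] Tp_closed[OF y], symmetric])
      finally show "(T ^^ (k' + l')) ((T ^^ j') x' \<oplus>\<^bsub>G (i' + j')\<^esub> (T ^^ i') y')
          = (T ^^ (k + l)) ((T ^^ i) x \<oplus>\<^bsub>G (i + i)\<^esub> (T ^^ i) y)" .
    qed
  qed
  have inner: "(\<Union>(j', y')\<in>cls i y. ?F i' x' j' y') = ?F i x i y" if x': "(i', x') \<in> cls i x" for i' x'
  proof -
    have "(\<Union>(j', y')\<in>cls i y. ?F i' x' j' y') = ?F i' x' i y"
      by (rule UN_const[OF cls_self[OF y]]) (use F[OF x'] cls_self[OF y] in simp)
    then show ?thesis using F[OF x' cls_self[OF y]] by simp
  qed
  have "cls i x \<oplus>\<^bsub>colim G T\<^esub> cls i y = (\<Union>(i', x')\<in>cls i x. \<Union>(j', y')\<in>cls i y. ?F i' x' j' y')"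
    unfolding colim_def by simp
  also have "\<dots> = (\<Union>(j', y')\<in>cls i y. ?F i x j' y')"
    by (rule UN_const[OF cls_self[OF x], where F = "\<lambda>i' x'. \<Union>(j', y')\<in>cls i y. ?F i' x' j' y'"])
       (use inner cls_self[OF x] in simp)
  also have "\<dots> = ?F i x i y" by (rule inner[OF cls_self[OF x]])
  also have "\<dots> = cls (i + i) ((T ^^ i) (x \<oplus>\<^bsub>G i\<^esub> y))" unfolding Tp_add[OF x y] ..
  also have "\<dots> = cls i (x \<oplus>\<^bsub>G i\<^esub> y)"
  proof -
    interpret module R "G i" by (rule G_module)
    show ?thesis using cls_shift[of "x \<oplus>\<^bsub>G i\<^esub> y" i i] x y by simp
  qed
  finally show ?thesis .
qed

lemma smult_cls:
  assumes r: "r \<in> carrier R" and x: "x \<in> carrier (G i)"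
  shows "r \<odot>\<^bsub>colim G T\<^esub> cls i x = cls i (r \<odot>\<^bsub>G i\<^esub> x)"
proof -
  have sc: "r \<odot>\<^bsub>G i\<^esub> x \<in> carrier (G i)" if "x \<in> carrier (G i)" for i x
    using module.smult_closed[OF G_module r that] .
  have "r \<odot>\<^bsub>colim G T\<^esub> cls i x = (\<Union>(j, y)\<in>cls i x. cls j (r \<odot>\<^bsub>G j\<^esub> y))" unfolding colim_def by simp
  also have "\<dots> = cls i (r \<odot>\<^bsub>G i\<^esub> x)"
  proof (rule UN_const[OF cls_self[OF x]])
    fix j y assume "(j, y) \<in> cls i x"
    then obtain k l where h: "y \<in> carrier (G j)" "i + k = j + l" "(T ^^ k) x = (T ^^ l) y" using cls_memE x
        by metis
    show "cls j (r \<odot>\<^bsub>G j\<^esub> y) = cls i (r \<odot>\<^bsub>G i\<^esub> x)"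
      by (rule cls_eqI[OF sc[OF h(1)] sc[OF x] h(2)[symmetric]])
         (use h Tp_smult[OF r h(1), of l] Tp_smult[OF r x, of k] in simp)
  qed
  finally show ?thesis .
qed

lemma zero_cls: "\<zero>\<^bsub>colim G T\<^esub> = cls i \<zero>\<^bsub>G i\<^esub>"
proof -
  have c: "\<zero>\<^bsub>G i\<^esub> \<in> carrier (G i)" for i
  proof -
    interpret module R "G i" by (rule G_module)
    show ?thesis by simp
  qed
  have "\<zero>\<^bsub>colim G T\<^esub> = cls 0 \<zero>\<^bsub>G 0\<^esub>" unfolding colim_def by simp
  also have "\<dots> = cls (0 + i) ((T ^^ i) \<zero>\<^bsub>G 0\<^esub>)" by (rule cls_shift[OF c])
  also have "\<dots> = cls i \<zero>\<^bsub>G i\<^esub>" unfolding Tp_zero by simp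
  finally show ?thesis .
qed

lemma colim_module: "module R (colim G T)"
proof (rule moduleI)
  show "cring R" by (rule G_cring)
  have level2: "\<exists>i x y. x \<in> carrier (G i) \<and> y \<in> carrier (G i) \<and> U = cls i x \<and> V = cls i y"
    if "U \<in> carrier (colim G T)" "V \<in> carrier (colim G T)" for U V
    using common_level[OF that] by blast
  have level1: "\<exists>i x. x \<in> carrier (G i) \<and> U = cls i x" if "U \<in> carrier (colim G T)" for U
    using carrierE[OF that] by blast
  show "abelian_group (colim G T)"
  proof (rule abelian_groupI)
    fix U V assume UV: "U \<in> carrier (colim G T)" "V \<in> carrier (colim G T)"
    obtain i x y where xy: "x \<in> carrier (G i)" "y \<in> carrier (G i)" "U = cls i x" "V = cls i y" using
        level2[OF UV] by blast
    interpret Gi: module R "G i" by (rule G_module)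
    show "U \<oplus>\<^bsub>colim G T\<^esub> V \<in> carrier (colim G T)" using xy by (simp add: add_cls cls_carrier)
    show "U \<oplus>\<^bsub>colim G T\<^esub> V = V \<oplus>\<^bsub>colim G T\<^esub> U" using xy by (simp add: add_cls Gi.M.a_comm)
  next
    fix U V W assume UV: "U \<in> carrier (colim G T)" "V \<in> carrier (colim G T)" "W \<in> carrier (colim G T)"
    obtain i x y where xy: "x \<in> carrier (G i)" "y \<in> carrier (G i)" "U = cls i x" "V = cls i y" using
        level2[OF UV(1,2)] by blast
    obtain j z where z: "z \<in> carrier (G j)" "W = cls j z" using level1[OF UV(3)] by blast
    interpret Gi: module R "G (i + j)" by (rule G_module)
    have e: "U = cls (i + j) ((T ^^ j) x)" "V = cls (i + j) ((T ^^ j) y)" "W = cls (i + j) ((T ^^ i) z)"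
      using xy(3,4) z(2) cls_shift[OF xy(1), of j] cls_shift[OF xy(2), of j] cls_shift[OF z(1), of i] by
          (simp_all add: add.commute)
    have c: "(T ^^ j) x \<in> carrier (G (i + j))" "(T ^^ j) y \<in> carrier (G (i + j))" "(T ^^ i) z \<in> carrier (G
        (i + j))"
      using Tp_closed xy Tp_closed'[OF z(1)] by auto
    show "U \<oplus>\<^bsub>colim G T\<^esub> V \<oplus>\<^bsub>colim G T\<^esub> W = U \<oplus>\<^bsub>colim G T\<^esub> (V \<oplus>\<^bsub>colim G T\<^esub> W)"
      unfolding e using c by (simp add: add_cls Gi.M.a_assoc)
  next
    interpret G0: module R "G 0" by (rule G_module)
    show "\<zero>\<^bsub>colim G T\<^esub> \<in> carrier (colim G T)" unfolding zero_cls[of 0] by (simp add: cls_carrier)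
  next
    fix U assume U: "U \<in> carrier (colim G T)"
    obtain i x where x: "x \<in> carrier (G i)" "U = cls i x" using level1[OF U] by blast
    interpret Gi: module R "G i" by (rule G_module)
    show "\<zero>\<^bsub>colim G T\<^esub> \<oplus>\<^bsub>colim G T\<^esub> U = U" unfolding zero_cls[of i] using x by (simp add: add_cls)
    have "cls i (\<ominus>\<^bsub>G i\<^esub> x) \<oplus>\<^bsub>colim G T\<^esub> U = \<zero>\<^bsub>colim G T\<^esub>"
      unfolding zero_cls[of i] using x by (simp add: add_cls Gi.M.l_neg)
    then show "\<exists>V\<in>carrier (colim G T). V \<oplus>\<^bsub>colim G T\<^esub> U = \<zero>\<^bsub>colim G T\<^esub>" using x cls_carrier[of "\<ominus>\<^bsub>G i\<^esub> x"
        i] by auto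
  qed
  show "\<one>\<^bsub>R\<^esub> \<odot>\<^bsub>colim G T\<^esub> U = U" if U: "U \<in> carrier (colim G T)" for U
  proof -
    obtain i x where x: "x \<in> carrier (G i)" "U = cls i x" using level1[OF U] by blast
    interpret Gi: module R "G i" by (rule G_module)
    show ?thesis unfolding x(2) using x(1) by (simp add: smult_cls)
  qed
  fix a U assume a: "a \<in> carrier R" and U: "U \<in> carrier (colim G T)"
  obtain i x where x: "x \<in> carrier (G i)" "U = cls i x" using level1[OF U] by blast
  interpret Gi: module R "G i" by (rule G_module)
  show "a \<odot>\<^bsub>colim G T\<^esub> U \<in> carrier (colim G T)" unfolding x(2) using a x(1) by (simp add: smult_cls cls_carrier)
  show "(a \<oplus>\<^bsub>R\<^esub> b) \<odot>\<^bsub>colim G T\<^esub> U = a \<odot>\<^bsub>colim G T\<^esub> U \<oplus>\<^bsub>colim G T\<^esub> b \<odot>\<^bsub>colim G T\<^esub> U" if "b \<in> carrier R" for b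
    unfolding x(2) using a that x(1) by (simp add: smult_cls add_cls Gi.smult_l_distr)
  show "(a \<otimes>\<^bsub>R\<^esub> b) \<odot>\<^bsub>colim G T\<^esub> U = a \<odot>\<^bsub>colim G T\<^esub> (b \<odot>\<^bsub>colim G T\<^esub> U)" if "b \<in> carrier R" for b
    unfolding x(2) using a that x(1) by (simp add: smult_cls Gi.smult_assoc1)
  show "a \<odot>\<^bsub>colim G T\<^esub> (U \<oplus>\<^bsub>colim G T\<^esub> V) = a \<odot>\<^bsub>colim G T\<^esub> U \<oplus>\<^bsub>colim G T\<^esub> a \<odot>\<^bsub>colim G T\<^esub> V"
    if V: "V \<in> carrier (colim G T)" for V
  proof -
    obtain j z y where zy: "z \<in> carrier (G j)" "y \<in> carrier (G j)" "U = cls j z" "V = cls j y" using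
        level2[OF U V] by blast
    interpret Gj: module R "G j" by (rule G_module)
    show ?thesis unfolding zy(3,4) using a zy(1,2) by (simp add: smult_cls add_cls Gj.smult_r_distr)
  qed
qed

end

text \<open>Injectivity and surjectivity are asked for only after further transition maps. This is
  what nilpotent kernels and cokernels provide, and it is enough for bijectivity on
  colimits.\<close>

locale seq_colim_hom = A: seq_colim R G T + B: seq_colim R G' T'
  for R :: "('a, 'x) ring_scheme" and G :: "nat \<Rightarrow> ('a, 'c, 'y) module_scheme" and T
    and G' :: "nat \<Rightarrow> ('a, 'd, 'z) module_scheme" and T' +
  fixes h :: "'c \<Rightarrow> 'd"
  assumes h_closed: "x \<in> carrier (G i) \<Longrightarrow> h x \<in> carrier (G' i)"
    and h_add: "\<lbrakk>x \<in> carrier (G i); y \<in> carrier (G i)\<rbrakk> \<Longrightarrow> h (x \<oplus>\<^bsub>G i\<^esub> y) = h x \<oplus>\<^bsub>G' i\<^esub> h y"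
    and h_smult: "\<lbrakk>r \<in> carrier R; x \<in> carrier (G i)\<rbrakk> \<Longrightarrow> h (r \<odot>\<^bsub>G i\<^esub> x) = r \<odot>\<^bsub>G' i\<^esub> h x"
    and h_T: "x \<in> carrier (G i) \<Longrightarrow> h (T x) = T' (h x)"
    and h_inj: "\<lbrakk>x \<in> carrier (G i); y \<in> carrier (G i); h x = h y\<rbrakk> \<Longrightarrow> \<exists>k. (T ^^ k) x = (T ^^ k) y"
    and h_surj: "z \<in> carrier (G' i) \<Longrightarrow> \<exists>k. \<exists>x\<in>carrier (G (i + k)). h x = (T' ^^ k) z"
begin

definition hmap where "hmap V = (\<Union>(i, x)\<in>V. colim_class G' T' i (h x))"

lemma h_Tp: "x \<in> carrier (G i) \<Longrightarrow> h ((T ^^ k) x) = (T' ^^ k) (h x)"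
proof (induction k)
  case (Suc k)
  then show ?case using h_T[OF A.Tp_closed[OF Suc.prems, of k]] by simp
qed simp

lemma hmap_cls:
  assumes x: "x \<in> carrier (G i)"
  shows "hmap (A.cls i x) = B.cls i (h x)"
  unfolding hmap_def
proof (rule A.UN_const[OF A.cls_self[OF x]])
  fix j y assume "(j, y) \<in> A.cls i x"
  then obtain k l where kl: "y \<in> carrier (G j)" "i + k = j + l" "(T ^^ k) x = (T ^^ l) y" using A.cls_memE
      x by metis
  show "B.cls j (h y) = B.cls i (h x)"
    by (rule B.cls_eqI[OF h_closed[OF kl(1)] h_closed[OF x] kl(2)[symmetric]])
       (use kl(3) h_Tp[OF x, of k] h_Tp[OF kl(1), of l] in simp)
qed

lemma hmap_iso: "hmap \<in> mod_iso R (colim G T) (colim G' T')"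
proof -
  have closed: "hmap V \<in> carrier (colim G' T')" if V: "V \<in> carrier (colim G T)" for V
  proof -
    obtain i x where x: "x \<in> carrier (G i)" "V = A.cls i x" using A.carrierE[OF V] .
    show ?thesis unfolding x(2) hmap_cls[OF x(1)] by (rule B.cls_carrier[OF h_closed[OF x(1)]])
  qed
  have "hmap \<in> mod_hom R (colim G T) (colim G' T')" unfolding mod_hom_def
  proof (intro CollectI conjI ballI)
    show "hmap \<in> carrier (colim G T) \<rightarrow> carrier (colim G' T')" using closed by blast
    fix U V assume UV: "U \<in> carrier (colim G T)" "V \<in> carrier (colim G T)"
    obtain i x y where xy: "x \<in> carrier (G i)" "y \<in> carrier (G i)" "U = A.cls i x" "V = A.cls i y" using
        A.common_level[OF UV] .
    interpret Gi: module R "G i" by (rule A.G_module)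
    show "hmap (U \<oplus>\<^bsub>colim G T\<^esub> V) = hmap U \<oplus>\<^bsub>colim G' T'\<^esub> hmap V"
      unfolding xy(3,4) using xy(1,2) by (simp add: A.add_cls B.add_cls hmap_cls h_closed h_add)
  next
    fix r U assume r: "r \<in> carrier R" and U: "U \<in> carrier (colim G T)"
    obtain i x where x: "x \<in> carrier (G i)" "U = A.cls i x" using A.carrierE[OF U] .
    interpret Gi: module R "G i" by (rule A.G_module)
    show "hmap (r \<odot>\<^bsub>colim G T\<^esub> U) = r \<odot>\<^bsub>colim G' T'\<^esub> hmap U"
      unfolding x(2) using r x(1) by (simp add: A.smult_cls B.smult_cls hmap_cls h_closed h_smult)
  qed
  moreover have "bij_betw hmap (carrier (colim G T)) (carrier (colim G' T'))"
  proof (rule bij_betwI')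
    fix U V assume UV: "U \<in> carrier (colim G T)" "V \<in> carrier (colim G T)"
    obtain i x y where xy: "x \<in> carrier (G i)" "y \<in> carrier (G i)" "U = A.cls i x" "V = A.cls i y" using
        A.common_level[OF UV] .
    show "hmap U = hmap V \<longleftrightarrow> U = V"
    proof
      assume "hmap U = hmap V"
      then have "B.cls i (h x) = B.cls i (h y)" unfolding xy(3,4) hmap_cls[OF xy(1)] hmap_cls[OF xy(2)] .
      then obtain k l where "i + k = i + l" "(T' ^^ k) (h x) = (T' ^^ l) (h y)"
        using B.cls_eqD[OF h_closed[OF xy(1)] h_closed[OF xy(2)]] by blast
      then have "h ((T ^^ k) x) = h ((T ^^ k) y)" using h_Tp[OF xy(1)] h_Tp[OF xy(2)] by simp
      then obtain m where "(T ^^ m) ((T ^^ k) x) = (T ^^ m) ((T ^^ k) y)"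
        using h_inj[OF A.Tp_closed[OF xy(1)] A.Tp_closed[OF xy(2)]] by blast
      then have "(T ^^ (m + k)) x = (T ^^ (m + k)) y" by (simp add: A.Tp_Tp)
      then show "U = V" unfolding xy(3,4) by (intro A.cls_eqI[OF xy(1,2) refl])
    qed simp
  next
    fix V assume V: "V \<in> carrier (colim G' T')"
    obtain i y where y: "y \<in> carrier (G' i)" "V = B.cls i y" using B.carrierE[OF V] .
    obtain k x where x: "x \<in> carrier (G (i + k))" "h x = (T' ^^ k) y" using h_surj[OF y(1)] by blast
    have "V = hmap (A.cls (i + k) x)" unfolding hmap_cls[OF x(1)] x(2) y(2) by (rule B.cls_shift[OF y(1)])
    then show "\<exists>U\<in>carrier (colim G T). V = hmap U" using A.cls_carrier[OF x(1)] by blast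
  qed (rule closed)
  ultimately show ?thesis unfolding mod_iso_def by blast
qed

end

section \<open>The colimit of a Cartier module\<close>

context cartier begin

lemma shriek_carrier:
  "\<psi> \<in> carrier (shriek R p M e) \<longleftrightarrow> \<psi> \<in> extensional (carrier R) \<and> (\<forall>r\<in>carrier R. \<psi> r \<in> carrier M) \<and>
    (\<forall>r\<in>carrier R. \<forall>s\<in>carrier R. \<psi> (r \<oplus> s) = \<psi> r \<oplus>\<^bsub>M\<^esub> \<psi> s) \<and>
    (\<forall>a\<in>carrier R. \<forall>r\<in>carrier R. \<psi> (a [^] (p ^ e) \<otimes> r) = a \<odot>\<^bsub>M\<^esub> \<psi> r)"
  unfolding shriek_def mod_hom_def frob_push_def reg_mod_def by auto

lemma shriek_sel [simp]:
  "\<zero>\<^bsub>shriek R p M e\<^esub> = (\<lambda>r\<in>carrier R. \<zero>\<^bsub>M\<^esub>)"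
  "\<psi> \<oplus>\<^bsub>shriek R p M e\<^esub> \<chi> = (\<lambda>r\<in>carrier R. \<psi> r \<oplus>\<^bsub>M\<^esub> \<chi> r)"
  "s \<odot>\<^bsub>shriek R p M e\<^esub> \<psi> = (\<lambda>r\<in>carrier R. \<psi> (s \<otimes> r))"
  unfolding shriek_def by auto

text \<open>The canonical isomorphism evaluates the inner homomorphism at \<open>1\<close>, and the
  adjoint structure map sends \<open>m\<close> to \<open>\<kappa> m\<close> there.\<close>

lemma shriek_trans_eq: "\<psi> \<in> carrier (shriek R p M e) \<Longrightarrow> shriek_trans R M \<kappa> \<psi> = (\<lambda>r\<in>carrier R. \<kappa> (\<psi> r))"
  unfolding shriek_trans_def shriek_comp_def shriek_map_def adj_structure_def shriek_carrier
  by (rule restrict_ext) auto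

lemma shriek_module: "module R (shriek R p M e)"
proof (rule moduleI)
  show "cring R" by (rule is_cring)
  show "abelian_group (shriek R p M e)"
  proof (rule abelian_groupI)
    fix \<psi> assume \<psi>: "\<psi> \<in> carrier (shriek R p M e)"
    let ?n = "\<lambda>r\<in>carrier R. \<ominus>\<^bsub>M\<^esub> \<psi> r"
    have "?n \<in> carrier (shriek R p M e)" using \<psi> unfolding shriek_carrier
      by (auto simp: M.minus_add smult_r_minus)
    moreover have "?n \<oplus>\<^bsub>shriek R p M e\<^esub> \<psi> = \<zero>\<^bsub>shriek R p M e\<^esub>"
      using \<psi> unfolding shriek_sel shriek_carrier by (intro restrict_ext) (auto simp: M.l_neg)
    ultimately show "\<exists>\<chi>\<in>carrier (shriek R p M e). \<chi> \<oplus>\<^bsub>shriek R p M e\<^esub> \<psi> = \<zero>\<^bsub>shriek R p M e\<^esub>" by blast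
    show "\<zero>\<^bsub>shriek R p M e\<^esub> \<oplus>\<^bsub>shriek R p M e\<^esub> \<psi> = \<psi>"
      using \<psi> unfolding shriek_sel shriek_carrier by (intro extensionalityI[of _ "carrier R"]) auto
  qed (auto simp: shriek_carrier M.a_ac smult_r_distr intro!: restrict_ext)
next
  fix a \<psi> assume a: "a \<in> carrier R" and \<psi>: "\<psi> \<in> carrier (shriek R p M e)"
  have lc: "a \<otimes> (b \<otimes> r) = b \<otimes> (a \<otimes> r)" if "b \<in> carrier R" "r \<in> carrier R" for b r
    using that a by (simp add: m_lcomm)
  show "a \<odot>\<^bsub>shriek R p M e\<^esub> \<psi> \<in> carrier (shriek R p M e)"
    using a \<psi> unfolding shriek_sel shriek_carrier by (auto simp: r_distr lc)
next
  show "\<one> \<odot>\<^bsub>shriek R p M e\<^esub> \<psi> = \<psi>" if "\<psi> \<in> carrier (shriek R p M e)" for \<psi>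
    using that unfolding shriek_sel shriek_carrier by (intro extensionalityI[of _ "carrier R"]) auto
qed (auto simp: shriek_carrier l_distr m_assoc m_lcomm intro!: restrict_ext)

lemma shriek_colim: "seq_colim R (shriek R p M) (shriek_trans R M \<kappa>)"
proof (rule seq_colim.intro)
  show "module R (shriek R p M i)" for i by (rule shriek_module)
  fix \<psi> i assume \<psi>: "\<psi> \<in> carrier (shriek R p M i)"
  note h = \<psi>[unfolded shriek_carrier]
  \<comment> \<open>The new homomorphism must be semilinear for \<open>p^(i+1)\<close>:
    \<open>\<psi>\<close> lets \<open>a^p\<close> out of its \<open>p^i\<close>-th power, and
    \<open>\<kappa>\<close> then lets out \<open>a\<close>.\<close>
  have k: "\<kappa> (\<psi> (a [^] (p ^ Suc i) \<otimes> r)) = a \<odot>\<^bsub>M\<^esub> \<kappa> (\<psi> r)" if "a \<in> carrier R" "r \<in> carrier R" for a r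
  proof -
    have "a [^] (p ^ Suc i) = (a [^] p) [^] (p ^ i)" using that by (simp add: nat_pow_pow)
    then have "\<psi> (a [^] (p ^ Suc i) \<otimes> r) = a [^] p \<odot>\<^bsub>M\<^esub> \<psi> r" using h that by simp
    then show ?thesis using h that by (simp add: \<kappa>_smult)
  qed
  show "shriek_trans R M \<kappa> \<psi> \<in> carrier (shriek R p M (Suc i))"
    unfolding shriek_trans_eq[OF \<psi>] shriek_carrier using h k by (auto simp: \<kappa>_closed \<kappa>_add simp del: power_Suc)
  have sc: "r \<odot>\<^bsub>shriek R p M i\<^esub> \<psi> \<in> carrier (shriek R p M i)" if "r \<in> carrier R" for r
    using module.smult_closed[OF shriek_module that \<psi>] .
  show "shriek_trans R M \<kappa> (r \<odot>\<^bsub>shriek R p M i\<^esub> \<psi>) = r \<odot>\<^bsub>shriek R p M (Suc i)\<^esub> shriek_trans R M \<kappa> \<psi>" if "r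
      \<in> carrier R" for r
    unfolding shriek_trans_eq[OF \<psi>] shriek_trans_eq[OF sc[OF that]] unfolding shriek_sel
    using that by (intro restrict_ext) auto
  fix \<chi> assume \<chi>: "\<chi> \<in> carrier (shriek R p M i)"
  note h' = \<chi>[unfolded shriek_carrier]
  interpret S: module R "shriek R p M i" by (rule shriek_module)
  have "\<psi> \<oplus>\<^bsub>shriek R p M i\<^esub> \<chi> \<in> carrier (shriek R p M i)" using \<psi> \<chi> by (rule S.M.a_closed)
  from shriek_trans_eq[OF this]
  show "shriek_trans R M \<kappa> (\<psi> \<oplus>\<^bsub>shriek R p M i\<^esub> \<chi>) =
      shriek_trans R M \<kappa> \<psi> \<oplus>\<^bsub>shriek R p M (Suc i)\<^esub> shriek_trans R M \<kappa> \<chi>"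
    unfolding shriek_trans_eq[OF \<psi>] shriek_trans_eq[OF \<chi>] unfolding shriek_sel
    using h h' by (auto simp: \<kappa>_add intro!: restrict_ext)
qed

lemma shriek_trans_pow:
  assumes "\<psi> \<in> carrier (shriek R p M e)"
  shows "(shriek_trans R M \<kappa> ^^ k) \<psi> = (\<lambda>r\<in>carrier R. (\<kappa> ^^ k) (\<psi> r))"
proof (induction k)
  case 0
  show ?case using assms unfolding shriek_carrier by (simp add: extensional_restrict)
next
  case (Suc k)
  have "(shriek_trans R M \<kappa> ^^ k) \<psi> \<in> carrier (shriek R p M (e + k))"
    by (rule seq_colim.Tp_closed[OF shriek_colim assms])
  from shriek_trans_eq[OF this] show ?case unfolding funpow.simps comp_def Suc.IH by (auto intro!: restrict_ext)
qed

definition emb where "emb m = (\<lambda>r\<in>carrier R. r \<odot>\<^bsub>M\<^esub> m)"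

lemma emb_closed: "m \<in> carrier M \<Longrightarrow> emb m \<in> carrier (shriek R p M 0)"
  unfolding emb_def shriek_carrier by (auto simp: smult_l_distr smult_assoc1)

lemma to_cartier_colim_submodule:
  assumes H: "submodule H R M"
  shows "submodule (to_cartier_colim R p M \<kappa> ` H) R (cartier_colim R p M \<kappa>)"
proof -
  interpret S: seq_colim R "shriek R p M" "shriek_trans R M \<kappa>" by (rule shriek_colim)
  interpret C: module R "cartier_colim R p M \<kappa>" unfolding cartier_colim_def by (rule S.colim_module)
  have to: "to_cartier_colim R p M \<kappa> m = S.cls 0 (emb m)" for m unfolding to_cartier_colim_def emb_def ..
  note Hc = subsetD[OF submoduleE(1)[OF H]]
  show ?thesis
  proof (rule C.submodule_if_closed)
    show "to_cartier_colim R p M \<kappa> ` H \<subseteq> carrier (cartier_colim R p M \<kappa>)"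
      unfolding cartier_colim_def to using S.cls_carrier[OF emb_closed] Hc by blast
    have "emb \<zero>\<^bsub>M\<^esub> = \<zero>\<^bsub>shriek R p M 0\<^esub>" unfolding emb_def shriek_sel by (auto intro!: restrict_ext)
    then have "\<zero>\<^bsub>cartier_colim R p M \<kappa>\<^esub> = to_cartier_colim R p M \<kappa> \<zero>\<^bsub>M\<^esub>"
      unfolding cartier_colim_def to S.zero_cls[of 0] by simp
    then show "\<zero>\<^bsub>cartier_colim R p M \<kappa>\<^esub> \<in> to_cartier_colim R p M \<kappa> ` H" using submodule_zero[OF H] by blast
  next
    fix U V assume "U \<in> to_cartier_colim R p M \<kappa> ` H" "V \<in> to_cartier_colim R p M \<kappa> ` H"
    then obtain m n where mn: "U = S.cls 0 (emb m)" "V = S.cls 0 (emb n)" "m \<in> H" "n \<in> H" unfolding to by blast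
    have "emb m \<oplus>\<^bsub>shriek R p M 0\<^esub> emb n = emb (m \<oplus>\<^bsub>M\<^esub> n)"
      unfolding emb_def shriek_sel using Hc[OF mn(3)] Hc[OF mn(4)] by (auto simp: smult_r_distr intro!:
          restrict_ext)
    then have "U \<oplus>\<^bsub>cartier_colim R p M \<kappa>\<^esub> V = S.cls 0 (emb (m \<oplus>\<^bsub>M\<^esub> n))"
      unfolding cartier_colim_def mn(1,2) using S.add_cls[OF emb_closed[OF Hc[OF mn(3)]] emb_closed[OF
          Hc[OF mn(4)]]] by simp
    then show "U \<oplus>\<^bsub>cartier_colim R p M \<kappa>\<^esub> V \<in> to_cartier_colim R p M \<kappa> ` H"
      unfolding to using submoduleE(5)[OF H mn(3,4)] by blast
  next
    fix a U assume a: "a \<in> carrier R" and "U \<in> to_cartier_colim R p M \<kappa> ` H"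
    then obtain m where m: "U = S.cls 0 (emb m)" "m \<in> H" unfolding to by blast
    have "a \<odot>\<^bsub>shriek R p M 0\<^esub> emb m = emb (a \<odot>\<^bsub>M\<^esub> m)"
      unfolding emb_def shriek_sel using Hc[OF m(2)] a by (auto simp: smult_assoc1[symmetric] m_comm
          intro!: restrict_ext)
    then have "a \<odot>\<^bsub>cartier_colim R p M \<kappa>\<^esub> U = S.cls 0 (emb (a \<odot>\<^bsub>M\<^esub> m))"
      unfolding cartier_colim_def m(1) using S.smult_cls[OF a emb_closed[OF Hc[OF m(2)]]] by simp
    then show "a \<odot>\<^bsub>cartier_colim R p M \<kappa>\<^esub> U \<in> to_cartier_colim R p M \<kappa> ` H"
      unfolding to using submoduleE(4)[OF H a m(2)] by blast
  qed
qed

end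

section \<open>The map on colimits induced by a nil-isomorphism\<close>

context nil_iso begin

text \<open>Nilpotence of the kernel, applied to a difference, becomes injectivity up to
  \<open>\<kappa>\<^sub>M^b\<close>.\<close>

lemma \<phi>_eq_nil:
  "\<exists>b. \<forall>x\<in>carrier M. \<forall>y\<in>carrier M. \<phi> x = \<phi> y \<longrightarrow> (\<kappa>\<^sub>M ^^ b) x = (\<kappa>\<^sub>M ^^ b) y"
proof -
  obtain b where b: "\<And>m. \<lbrakk>m \<in> carrier M; \<phi> m = \<zero>\<^bsub>N\<^esub>\<rbrakk> \<Longrightarrow> (\<kappa>\<^sub>M ^^ b) m = \<zero>\<^bsub>M\<^esub>" using nil_ker by blast
  have "(\<kappa>\<^sub>M ^^ b) x = (\<kappa>\<^sub>M ^^ b) y" if xy: "x \<in> carrier M" "y \<in> carrier M" "\<phi> x = \<phi> y" for x y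
  proof -
    define d where "d = (\<ominus> \<one>) \<odot>\<^bsub>M\<^esub> y \<oplus>\<^bsub>M\<^esub> x"
    have dc: "d \<in> carrier M" unfolding d_def using xy by simp
    have "\<phi> d = (\<ominus> \<one>) \<odot>\<^bsub>N\<^esub> \<phi> y \<oplus>\<^bsub>N\<^esub> \<phi> y" unfolding d_def using xy by (simp add: \<phi>_add \<phi>_smult)
    also have "\<dots> = \<zero>\<^bsub>N\<^esub>" using \<phi>_closed[OF xy(2)] by (simp add: N.smult_l_minus N.M.l_neg)
    finally have "(\<kappa>\<^sub>M ^^ b) d = \<zero>\<^bsub>M\<^esub>" using b dc by blast
    moreover have "x = y \<oplus>\<^bsub>M\<^esub> d" unfolding d_def using xy by (simp add: M.smult_l_minus M.M.r_neg2)
    ultimately show ?thesis using M.\<kappa>_pow_add[OF xy(2) dc, of b] M.\<kappa>_pow_closed[OF xy(2)] by simp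
  qed
  then show ?thesis by blast
qed

text \<open>After \<open>a\<close> steps the values of \<open>\<psi>\<close> lie in the image of
  \<open>\<phi>\<close> and can be lifted, but the chosen lifts \<open>l\<close> need not be linear.
  Two lifts of one value agree after \<open>\<kappa>\<^sub>M^b\<close>, so \<open>b\<close> further
  steps make the lift additive and semilinear; the total shift is \<open>a + b\<close>.\<close>

lemma shriek_lift:
  assumes \<psi>: "\<psi> \<in> carrier (shriek R p N i)"
  shows "\<exists>k. \<exists>\<chi>\<in>carrier (shriek R p M (i + k)). shriek_map R \<phi> \<chi> = (shriek_trans R N \<kappa>\<^sub>N ^^ k) \<psi>"
proof -
  obtain a where a: "\<And>n. n \<in> carrier N \<Longrightarrow> (\<kappa>\<^sub>N ^^ a) n \<in> \<phi> ` carrier M" using nil_coker by blast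
  obtain b where same: "\<And>x y. \<lbrakk>x \<in> carrier M; y \<in> carrier M; \<phi> x = \<phi> y\<rbrakk> \<Longrightarrow> (\<kappa>\<^sub>M ^^ b) x = (\<kappa>\<^sub>M ^^ b) y"
    using \<phi>_eq_nil by blast
  note h = \<psi>[unfolded N.shriek_carrier]
  have "\<forall>n\<in>carrier N. \<exists>m. m \<in> carrier M \<and> \<phi> m = (\<kappa>\<^sub>N ^^ a) n"
    using a by (metis imageE)
  then obtain l where l: "\<And>n. n \<in> carrier N \<Longrightarrow> l n \<in> carrier M \<and> \<phi> (l n) = (\<kappa>\<^sub>N ^^ a) n" by metis
  define \<chi> where "\<chi> = (\<lambda>r\<in>carrier R. (\<kappa>\<^sub>M ^^ b) (l (\<psi> r)))"
  have lc: "l (\<psi> r) \<in> carrier M" "\<phi> (l (\<psi> r)) = (\<kappa>\<^sub>N ^^ a) (\<psi> r)" if "r \<in> carrier R" for r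
    using l h that by auto
  have "\<chi> \<in> carrier (shriek R p M (i + (a + b)))" unfolding M.shriek_carrier
  proof (intro conjI ballI)
    show "\<chi> \<in> extensional (carrier R)" unfolding \<chi>_def by simp
    show "\<chi> r \<in> carrier M" if "r \<in> carrier R" for r
      unfolding \<chi>_def using lc that by (simp add: M.\<kappa>_pow_closed)
    show "\<chi> (r \<oplus> s) = \<chi> r \<oplus>\<^bsub>M\<^esub> \<chi> s" if rs: "r \<in> carrier R" "s \<in> carrier R" for r s
    proof -
      have "(\<kappa>\<^sub>M ^^ b) (l (\<psi> (r \<oplus> s))) = (\<kappa>\<^sub>M ^^ b) (l (\<psi> r) \<oplus>\<^bsub>M\<^esub> l (\<psi> s))"
      proof (rule same)
        show "l (\<psi> (r \<oplus> s)) \<in> carrier M" using lc(1)[of "r \<oplus> s"] rs by simp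
        show "l (\<psi> r) \<oplus>\<^bsub>M\<^esub> l (\<psi> s) \<in> carrier M" using lc(1) rs by simp
        have "\<phi> (l (\<psi> (r \<oplus> s))) = (\<kappa>\<^sub>N ^^ a) (\<psi> (r \<oplus> s))" using lc(2)[of "r \<oplus> s"] rs by simp
        also have "\<dots> = \<phi> (l (\<psi> r) \<oplus>\<^bsub>M\<^esub> l (\<psi> s))" using h rs lc by (simp add: \<phi>_add N.\<kappa>_pow_add)
        finally show "\<phi> (l (\<psi> (r \<oplus> s))) = \<phi> (l (\<psi> r) \<oplus>\<^bsub>M\<^esub> l (\<psi> s))" .
      qed
      then show ?thesis unfolding \<chi>_def using rs lc by (simp add: M.\<kappa>_pow_add)
    qed
    show "\<chi> (c [^] (p ^ (i + (a + b))) \<otimes> r) = c \<odot>\<^bsub>M\<^esub> \<chi> r" if cr: "c \<in> carrier R" "r \<in> carrier R" for c r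
    proof -
      let ?c = "c [^] (p ^ b)"
      \<comment> \<open>The exponent is spent in three portions: \<open>p^i\<close> on
        \<open>\<psi>\<close>, \<open>p^a\<close> on \<open>\<kappa>\<^sub>N^a\<close>, and
        \<open>p^b\<close> on \<open>\<kappa>\<^sub>M^b\<close>.\<close>
      have "c [^] (p ^ (i + (a + b))) = ((?c) [^] (p ^ a)) [^] (p ^ i)"
        using cr by (simp add: M.R.nat_pow_pow power_add mult_ac)
      then have e: "\<psi> (c [^] (p ^ (i + (a + b))) \<otimes> r) = ?c [^] (p ^ a) \<odot>\<^bsub>N\<^esub> \<psi> r" using h cr by simp
      have "(\<kappa>\<^sub>M ^^ b) (l (\<psi> (c [^] (p ^ (i + (a + b))) \<otimes> r))) = (\<kappa>\<^sub>M ^^ b) (?c \<odot>\<^bsub>M\<^esub> l (\<psi> r))"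
      proof (rule same)
        show "l (\<psi> (c [^] (p ^ (i + (a + b))) \<otimes> r)) \<in> carrier M" using lc cr by simp
        show "?c \<odot>\<^bsub>M\<^esub> l (\<psi> r) \<in> carrier M" using lc cr by simp
        have "\<phi> (l (\<psi> (c [^] (p ^ (i + (a + b))) \<otimes> r))) = (\<kappa>\<^sub>N ^^ a) (?c [^] (p ^ a) \<odot>\<^bsub>N\<^esub> \<psi> r)"
          unfolding e[symmetric] using lc cr by simp
        also have "\<dots> = ?c \<odot>\<^bsub>N\<^esub> (\<kappa>\<^sub>N ^^ a) (\<psi> r)" using cr h by (simp add: N.\<kappa>_pow_smult)
        also have "\<dots> = \<phi> (?c \<odot>\<^bsub>M\<^esub> l (\<psi> r))" using cr lc by (simp add: \<phi>_smult)
        finally show "\<phi> (l (\<psi> (c [^] (p ^ (i + (a + b))) \<otimes> r))) = \<phi> (?c \<odot>\<^bsub>M\<^esub> l (\<psi> r))" .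
      qed
      also have "\<dots> = c \<odot>\<^bsub>M\<^esub> (\<kappa>\<^sub>M ^^ b) (l (\<psi> r))" using cr lc by (simp add: M.\<kappa>_pow_smult)
      finally show ?thesis unfolding \<chi>_def using cr by simp
    qed
  qed
  moreover have "shriek_map R \<phi> \<chi> = (shriek_trans R N \<kappa>\<^sub>N ^^ (a + b)) \<psi>"
    unfolding N.shriek_trans_pow[OF \<psi>] shriek_map_def
  proof (rule restrict_ext)
    fix r assume r: "r \<in> carrier R"
    have "\<phi> (\<chi> r) = (\<kappa>\<^sub>N ^^ b) ((\<kappa>\<^sub>N ^^ a) (\<psi> r))" unfolding \<chi>_def using r lc by (simp add: \<phi>_\<kappa>_pow)
    also have "\<dots> = (\<kappa>\<^sub>N ^^ (b + a)) (\<psi> r)" by (simp add: funpow_add)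
    finally show "\<phi> (\<chi> r) = (\<kappa>\<^sub>N ^^ (a + b)) (\<psi> r)" by (simp add: add.commute)
  qed
  ultimately show ?thesis by blast
qed

lemma shriek_colim_hom:
  "seq_colim_hom R (shriek R p M) (shriek_trans R M \<kappa>\<^sub>M) (shriek R p N) (shriek_trans R N \<kappa>\<^sub>N) (shriek_map R \<phi>)"
proof (intro seq_colim_hom.intro seq_colim_hom_axioms.intro)
  show "seq_colim R (shriek R p M) (shriek_trans R M \<kappa>\<^sub>M)" by (rule M.shriek_colim)
  show "seq_colim R (shriek R p N) (shriek_trans R N \<kappa>\<^sub>N)" by (rule N.shriek_colim)
  show "\<And>y i. y \<in> carrier (shriek R p N i) \<Longrightarrow>
      \<exists>k. \<exists>x\<in>carrier (shriek R p M (i + k)). shriek_map R \<phi> x = (shriek_trans R N \<kappa>\<^sub>N ^^ k) y"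
    by (rule shriek_lift)
  fix \<psi> i assume \<psi>: "\<psi> \<in> carrier (shriek R p M i)"
  note h = \<psi>[unfolded M.shriek_carrier]
  show hc: "shriek_map R \<phi> \<psi> \<in> carrier (shriek R p N i)"
    unfolding N.shriek_carrier shriek_map_def using h by (auto simp: \<phi>_closed \<phi>_add \<phi>_smult)
  show "shriek_map R \<phi> (shriek_trans R M \<kappa>\<^sub>M \<psi>) = shriek_trans R N \<kappa>\<^sub>N (shriek_map R \<phi> \<psi>)"
    unfolding M.shriek_trans_eq[OF \<psi>] N.shriek_trans_eq[OF hc] unfolding shriek_map_def
    using h by (auto simp: \<phi>_\<kappa> intro!: restrict_ext)
  show "shriek_map R \<phi> (r \<odot>\<^bsub>shriek R p M i\<^esub> \<psi>) = r \<odot>\<^bsub>shriek R p N i\<^esub> shriek_map R \<phi> \<psi>" if "r \<in> carrier R" for r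
    unfolding M.shriek_sel N.shriek_sel unfolding shriek_map_def using that by (auto intro!: restrict_ext)
  fix \<chi> assume \<chi>: "\<chi> \<in> carrier (shriek R p M i)"
  note h' = \<chi>[unfolded M.shriek_carrier]
  show "shriek_map R \<phi> (\<psi> \<oplus>\<^bsub>shriek R p M i\<^esub> \<chi>) = shriek_map R \<phi> \<psi> \<oplus>\<^bsub>shriek R p N i\<^esub> shriek_map R \<phi> \<chi>"
    unfolding M.shriek_sel N.shriek_sel unfolding shriek_map_def using h h' by (auto simp: \<phi>_add intro!:
        restrict_ext)
  assume eq: "shriek_map R \<phi> \<psi> = shriek_map R \<phi> \<chi>"
  obtain b where b: "\<And>x y. \<lbrakk>x \<in> carrier M; y \<in> carrier M; \<phi> x = \<phi> y\<rbrakk> \<Longrightarrow> (\<kappa>\<^sub>M ^^ b) x = (\<kappa>\<^sub>M ^^ b) y"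
    using \<phi>_eq_nil by blast
  have "(\<kappa>\<^sub>M ^^ b) (\<psi> r) = (\<kappa>\<^sub>M ^^ b) (\<chi> r)" if r: "r \<in> carrier R" for r
  proof (rule b)
    show "\<psi> r \<in> carrier M" "\<chi> r \<in> carrier M" using h h' r by auto
    have "shriek_map R \<phi> \<psi> r = shriek_map R \<phi> \<chi> r" using eq by simp
    then show "\<phi> (\<psi> r) = \<phi> (\<chi> r)" unfolding shriek_map_def using r by simp
  qed
  then have "(shriek_trans R M \<kappa>\<^sub>M ^^ b) \<psi> = (shriek_trans R M \<kappa>\<^sub>M ^^ b) \<chi>"
    unfolding M.shriek_trans_pow[OF \<psi>] M.shriek_trans_pow[OF \<chi>] by (rule restrict_ext)
  then show "\<exists>k. (shriek_trans R M \<kappa>\<^sub>M ^^ k) \<psi> = (shriek_trans R M \<kappa>\<^sub>M ^^ k) \<chi>" by blast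
qed

lemma cartier_colim_map_iso:
  "cartier_colim_map R p N \<kappa>\<^sub>N \<phi> \<in> mod_iso R (cartier_colim R p M \<kappa>\<^sub>M) (cartier_colim R p N \<kappa>\<^sub>N)"
proof -
  interpret H: seq_colim_hom R "shriek R p M" "shriek_trans R M \<kappa>\<^sub>M" "shriek R p N" "shriek_trans R N \<kappa>\<^sub>N"
      "shriek_map R \<phi>"
    by (rule shriek_colim_hom)
  have "cartier_colim_map R p N \<kappa>\<^sub>N \<phi> = H.hmap" unfolding cartier_colim_map_def H.hmap_def ..
  then show ?thesis unfolding cartier_colim_def using H.hmap_iso by simp
qed

lemma cartier_colim_map_to_cartier_colim:
  assumes m: "m \<in> carrier M"
  shows "cartier_colim_map R p N \<kappa>\<^sub>N \<phi> (to_cartier_colim R p M \<kappa>\<^sub>M m) = to_cartier_colim R p N \<kappa>\<^sub>N (\<phi> m)"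
proof -
  interpret H: seq_colim_hom R "shriek R p M" "shriek_trans R M \<kappa>\<^sub>M" "shriek R p N" "shriek_trans R N \<kappa>\<^sub>N"
      "shriek_map R \<phi>"
    by (rule shriek_colim_hom)
  have "cartier_colim_map R p N \<kappa>\<^sub>N \<phi> = H.hmap" unfolding cartier_colim_map_def H.hmap_def ..
  moreover have "to_cartier_colim R p M \<kappa>\<^sub>M m = H.A.cls 0 (M.emb m)" unfolding to_cartier_colim_def M.emb_def ..
  moreover have "to_cartier_colim R p N \<kappa>\<^sub>N (\<phi> m) = H.B.cls 0 (N.emb (\<phi> m))" unfolding to_cartier_colim_def
      N.emb_def ..
  moreover have "shriek_map R \<phi> (M.emb m) = N.emb (\<phi> m)"
    unfolding shriek_map_def M.emb_def N.emb_def using m by (auto simp: \<phi>_smult intro!: restrict_ext)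
  ultimately show ?thesis using H.hmap_cls[OF M.emb_closed[OF m]] by simp
qed

end

section \<open>Presentations of the base ring\<close>

lemma (in gauged) tau_cartier:
  assumes "fin_gen R M"
  shows "tau_cartier R M p \<kappa> f"
proof -
  obtain E where E: "finite E" "E \<subseteq> carrier M" "rspan E = carrier M"
    "\<And>b v w. \<lbrakk>b \<in> B; v \<in> box R xs (p - 1); w \<in> E\<rbrakk> \<Longrightarrow> \<kappa> ((g b \<otimes> v) \<odot>\<^bsub>M\<^esub> w) \<in> mspan M \<AA> E"
    using adapted_generators[OF assms] by blast
  interpret gauged_gens R M p \<kappa> f k g xs B E
    by (intro gauged_gens.intro gauged_axioms gauged_gens_axioms.intro E)
  show ?thesis
    by (intro tau_cartier.intro coh_cartier.intro coh_cartier_axioms.intro tau_cartier_axioms.intro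
        cartier_axioms noeth assms test_module_exists)
qed

lemma cartierI:
  assumes "p \<ge> 2" "f \<in> carrier R" "cartier_module R p M \<kappa>"
  shows "cartier R M p \<kappa> f"
proof (rule cartier.intro)
  show "module R M" using assms(3) unfolding cartier_module_def by blast
  show "cartier_axioms R M p \<kappa> f"
    using assms by unfold_locales (auto simp: cartier_module_def mod_hom_def frob_push_def)
qed

text \<open>The generators are symmetrized, \<open>B \<union> -B\<close>, so that sums of \<open>p\<close>-th power multiples form a subgroup
  without appeal to the characteristic.\<close>

lemma (in cring) frob_span:
  assumes "fin_gen R (frob_push R p 1 (reg_mod R))"
  shows "\<exists>B. finite B \<and> B \<subseteq> carrier R \<and>
    (\<forall>c\<in>carrier R. c \<in> addspan R {l [^] p \<otimes> b | l b. l \<in> carrier R \<and> b \<in> B})"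
proof -
  let ?F = "frob_push R p 1 (reg_mod R)"
  have F: "carrier ?F = carrier R" "\<And>r x. r \<odot>\<^bsub>?F\<^esub> x = r [^] p \<otimes> x"
    "\<And>x y. x \<oplus>\<^bsub>?F\<^esub> y = x \<oplus> y" "\<zero>\<^bsub>?F\<^esub> = \<zero>"
    unfolding frob_push_def reg_mod_def by auto
  have Finv: "inv\<^bsub>add_monoid ?F\<^esub> x = \<ominus> x" for x
    unfolding a_inv_def m_inv_def frob_push_def reg_mod_def by simp
  obtain B where B: "finite B" "B \<subseteq> carrier R" "\<And>N. \<lbrakk>submodule N R ?F; B \<subseteq> N\<rbrakk> \<Longrightarrow> N = carrier R"
    using assms unfolding fin_gen_def F(1) by blast
  define B' where "B' = B \<union> a_inv R ` B"
  let ?A = "{l [^] p \<otimes> b | l b. l \<in> carrier R \<and> b \<in> B'}"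
  have B': "finite B'" "B' \<subseteq> carrier R" unfolding B'_def using B(1,2) by auto
  have B'm: "\<ominus> b \<in> B'" if "b \<in> B'" for b using that B(2) unfolding B'_def by auto
  have Ac: "?A \<subseteq> carrier R" using B'(2) by auto
  have Am: "\<ominus> x \<in> ?A" if x: "x \<in> ?A" for x
  proof -
    obtain l b where lb: "x = l [^] p \<otimes> b" "l \<in> carrier R" "b \<in> B'" using x by blast
    have "\<ominus> x = l [^] p \<otimes> \<ominus> b" unfolding lb(1) using lb B'(2) by (auto simp: r_minus)
    then show ?thesis using lb(2) B'm[OF lb(3)] by blast
  qed
  have "submodule (addspan R ?A) R ?F"
  proof (intro submodule.intro submodule_axioms.intro)
    show "subgroup (addspan R ?A) (add_monoid ?F)"
    proof (rule subgroup.intro)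
      show "addspan R ?A \<subseteq> carrier (add_monoid ?F)" using addspan_closed[OF Ac] F(1) by simp
      show "x \<otimes>\<^bsub>add_monoid ?F\<^esub> y \<in> addspan R ?A" if "x \<in> addspan R ?A" "y \<in> addspan R ?A" for x y
        using addspan_plus[OF Ac that] F(3) by simp
      show "\<one>\<^bsub>add_monoid ?F\<^esub> \<in> addspan R ?A" using addspan_zero[of R ?A] F(4) by simp
      show "inv\<^bsub>add_monoid ?F\<^esub> x \<in> addspan R ?A" if "x \<in> addspan R ?A" for x
        unfolding Finv by (rule addspan_minus[OF Ac Am that])
    qed
    fix a x assume a: "a \<in> carrier R" and x: "x \<in> addspan R ?A"
    show "a \<odot>\<^bsub>?F\<^esub> x \<in> addspan R ?A" unfolding F(2)
    proof (rule addspan_map[OF abelian_group_axioms Ac x Ac])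
      fix y assume "y \<in> ?A"
      then obtain l b where lb: "y = l [^] p \<otimes> b" "l \<in> carrier R" "b \<in> B'" by blast
      have "b \<in> carrier R" using lb(3) B'(2) by blast
      then have "a [^] p \<otimes> y = (a \<otimes> l) [^] p \<otimes> b" unfolding lb(1) using a lb(2) by (simp add:
          nat_pow_distrib m_assoc)
      then have "a [^] p \<otimes> y \<in> ?A" using a lb(2,3) by blast
      then show "a [^] p \<otimes> y \<in> addspan R ?A" by (rule addspan_incl[OF _ Ac])
    qed (use a in \<open>auto simp: r_distr\<close>)
  qed
  moreover have "B \<subseteq> addspan R ?A"
  proof
    fix b assume b: "b \<in> B"
    then have "b = \<one> [^] p \<otimes> b" using B(2) by auto
    then have "b \<in> ?A" using b unfolding B'_def by blast
    then show "b \<in> addspan R ?A" by (rule addspan_incl[OF _ Ac])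
  qed
  ultimately have "addspan R ?A = carrier R" by (rule B(3))
  then show ?thesis using B' by blast
qed

lemma ess_finite_type_presentation:
  assumes e: "ess_finite_type k A \<alpha> W \<iota> R"
  obtains g xs where "g \<in> ring_hom k R" "set xs \<subseteq> carrier R"
    "\<And>r. r \<in> carrier R \<Longrightarrow> \<exists>w\<in>Units R \<inter> gen_alg R (g ` carrier k) xs. w \<otimes>\<^bsub>R\<^esub> r \<in> gen_alg R (g ` carrier k) xs"
proof -
  interpret k: cring k using e unfolding ess_finite_type_def by blast
  interpret A: cring A using e unfolding ess_finite_type_def by blast
  interpret R: cring R using e unfolding ess_finite_type_def by blast
  have ft: "finite_type_algebra k A \<alpha>" and W: "submonoid W A" and l: "is_localization A W R \<iota>"
    using e unfolding ess_finite_type_def by auto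
  obtain S where \<alpha>: "\<alpha> \<in> ring_hom k A" and S: "finite S" "S \<subseteq> carrier A"
    "generate_ring A (\<alpha> ` carrier k \<union> S) = carrier A" using ft unfolding finite_type_algebra_def by blast
  have \<iota>: "\<iota> \<in> ring_hom A R" using l unfolding is_localization_def by blast
  interpret \<iota>: ring_hom_ring A R \<iota> by (simp add: \<iota> A.ring_axioms R.ring_axioms ring_hom_ringI2)
  obtain ys where ys: "set ys = S" using finite_list[OF S(1)] by blast
  define xs where "xs = map \<iota> ys"
  define g where "g = \<iota> \<circ> \<alpha>"
  have g: "g \<in> ring_hom k R" unfolding g_def by (rule ring_hom_trans[OF \<alpha> \<iota>])
  interpret g: ring_hom_ring k R g by (simp add: g k.ring_axioms R.ring_axioms ring_hom_ringI2)
  have xs: "set xs \<subseteq> carrier R" "set xs = \<iota> ` S" unfolding xs_def using S(2) ys by auto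
  let ?B = "gen_alg R (g ` carrier k) xs"
  have C: "subring (g ` carrier k) R" using g.img_is_subring[OF k.carrier_is_subring] .
  have B: "subring ?B R" by (rule R.gen_alg_subring[OF C xs(1)])
  have gens: "\<alpha> ` carrier k \<union> S \<subseteq> carrier A" using S(2) ring_hom_closed[OF \<alpha>] by blast
  have gc: "generate_ring A (\<alpha> ` carrier k \<union> S) \<subseteq> carrier A" using A.generate_ring_in_carrier[OF gens] by blast
  have "\<iota> a \<in> ?B" if "a \<in> generate_ring A (\<alpha> ` carrier k \<union> S)" for a
    using that
  proof induction
    case one then show ?case using subringE(3)[OF B] by simp
  next
    case (incl h)
    then have "\<iota> h \<in> g ` carrier k \<union> set xs" unfolding xs(2) g_def by auto
    then show ?case using R.gen_alg_base[OF C xs(1)] R.gen_alg_mem[OF C xs(1)] by blast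
  next
    case (a_inv h)
    then show ?case using subringE(5)[OF B] subsetD[OF gc a_inv.hyps] by simp
  next
    case (eng_add a b)
    then show ?case using subringE(7)[OF B] subsetD[OF gc eng_add.hyps(1)] subsetD[OF gc eng_add.hyps(2)]
        by simp
  next
    case (eng_mult a b)
    then show ?case using subringE(6)[OF B] subsetD[OF gc eng_mult.hyps(1)] subsetD[OF gc eng_mult.hyps(2)]
        by simp
  qed
  then have im: "\<iota> a \<in> ?B" if "a \<in> carrier A" for a using that S(3) by simp
  have "\<exists>w\<in>Units R \<inter> ?B. w \<otimes>\<^bsub>R\<^esub> r \<in> ?B" if r: "r \<in> carrier R" for r
  proof -
    obtain a w where aw: "a \<in> carrier A" "w \<in> W" "r \<otimes>\<^bsub>R\<^esub> \<iota> w = \<iota> a" using l r unfolding is_localization_def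
        by blast
    have wA: "w \<in> carrier A" using submonoid.subset[OF W] aw(2) by blast
    have wU: "\<iota> w \<in> Units R" using l aw(2) unfolding is_localization_def by blast
    have "\<iota> w \<otimes>\<^bsub>R\<^esub> r = \<iota> a" using aw(3) r wA by (simp add: R.m_comm)
    then show ?thesis using wU im[OF wA] im[OF aw(1)] by (intro bexI[of _ "\<iota> w"]) auto
  qed
  then show ?thesis using that[OF g xs(1)] by blast
qed

lemma nil_isoI:
  assumes tM: "tau_cartier R M p \<kappa>\<^sub>M f" and tN: "tau_cartier R N p \<kappa>\<^sub>N f"
    and nil: "nil_isomorphism R M \<kappa>\<^sub>M N \<kappa>\<^sub>N \<phi>"
  shows "nil_iso R M N p \<kappa>\<^sub>M \<kappa>\<^sub>N f \<phi>"
proof -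
  have cM: "cartier R M p \<kappa>\<^sub>M f" and cN: "cartier R N p \<kappa>\<^sub>N f"
    using tM tN unfolding tau_cartier_def coh_cartier_def by auto
  have "cartier_morphism_axioms R M N \<kappa>\<^sub>M \<kappa>\<^sub>N \<phi>"
    using nil unfolding cartier_morphism_axioms_def nil_isomorphism_def cartier_hom_def mod_hom_def by auto
  then have h: "cartier_morphism R M N p \<kappa>\<^sub>M \<kappa>\<^sub>N f \<phi>" by (rule cartier_morphism.intro[OF cM cN])
  have "\<exists>e. \<forall>m\<in>carrier M. \<phi> m = \<zero>\<^bsub>N\<^esub> \<longrightarrow> (\<kappa>\<^sub>M ^^ e) m = \<zero>\<^bsub>M\<^esub>"
    using nil unfolding nil_isomorphism_def nilpotent_cartier_def sub_mod_def a_kernel_def' by auto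
  moreover have "\<exists>e. \<forall>n\<in>carrier N. (\<kappa>\<^sub>N ^^ e) n \<in> \<phi> ` carrier M"
    by (rule cartier_morphism.nilpotent_coker[OF h]) (use nil in \<open>simp add: nil_isomorphism_def\<close>)
  ultimately show ?thesis by (intro nil_iso.intro[OF h tM tN] nil_iso_axioms.intro)
qed

theorem theorem2p8:
  fixes k :: "('k, 'kx) ring_scheme" and A :: "('d, 'dx) ring_scheme"
    and R :: "('a, 'ax) ring_scheme"
    and M :: "('a, 'b, 'bx) module_scheme" and N :: "('a, 'c, 'cx) module_scheme"
    and \<kappa>\<^sub>M :: "'b \<Rightarrow> 'b" and \<kappa>\<^sub>N :: "'c \<Rightarrow> 'c" and \<phi> :: "'b \<Rightarrow> 'c"
    and p :: nat and f :: 'a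
  assumes "Factorial_Ring.prime p"
    and "field k" and "F_finite p k"
    and "ess_finite_type k A \<alpha> W \<iota> R"
    and "f \<in> carrier R"
    and "coherent_cartier R p M \<kappa>\<^sub>M" and "coherent_cartier R p N \<kappa>\<^sub>N"
    and "nil_isomorphism R M \<kappa>\<^sub>M N \<kappa>\<^sub>N \<phi>"
  shows "(\<forall>t\<ge>0. \<phi> ` test_module R p M \<kappa>\<^sub>M f t = test_module R p N \<kappa>\<^sub>N f t) \<and>
    (\<forall>t\<ge>0. submodule (test_module_colim R p M \<kappa>\<^sub>M f t) R (cartier_colim R p M \<kappa>\<^sub>M)) \<and>
    (\<forall>s\<ge>0. \<forall>t\<ge>s. test_module_colim R p M \<kappa>\<^sub>M f t \<subseteq> test_module_colim R p M \<kappa>\<^sub>M f s) \<and>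
    cartier_colim_map R p N \<kappa>\<^sub>N \<phi> \<in> mod_iso R (cartier_colim R p M \<kappa>\<^sub>M) (cartier_colim R p N \<kappa>\<^sub>N) \<and>
    (\<forall>t\<ge>0. cartier_colim_map R p N \<kappa>\<^sub>N \<phi> ` test_module_colim R p M \<kappa>\<^sub>M f t
       = test_module_colim R p N \<kappa>\<^sub>N f t)"
proof -
  have p2: "p \<ge> 2" using assms(1) prime_ge_2_nat by blast
  interpret k: field k by (rule assms(2))
  obtain B where B: "finite B" "B \<subseteq> carrier k"
    "\<And>c. c \<in> carrier k \<Longrightarrow> c \<in> addspan k {l [^]\<^bsub>k\<^esub> p \<otimes>\<^bsub>k\<^esub> b | l b. l \<in> carrier k \<and> b \<in> B}"
    using k.frob_span[of p] assms(3) unfolding F_finite_def by blast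
  obtain g xs where g: "g \<in> ring_hom k R" "set xs \<subseteq> carrier R"
    "\<And>r. r \<in> carrier R \<Longrightarrow> \<exists>w\<in>Units R \<inter> gen_alg R (g ` carrier k) xs. w \<otimes>\<^bsub>R\<^esub> r \<in> gen_alg R (g ` carrier k) xs"
    using ess_finite_type_presentation[OF assms(4)] by blast
  have cM: "cartier R M p \<kappa>\<^sub>M f" and cN: "cartier R N p \<kappa>\<^sub>N f"
    using cartierI[OF p2 assms(5)] assms(6,7) unfolding coherent_cartier_def by auto
  have gM: "gauged R M p \<kappa>\<^sub>M f k g xs B"
    by (intro gauged.intro cM assms(2) gauged_axioms.intro g B)
  have gN: "gauged R N p \<kappa>\<^sub>N f k g xs B"
    by (intro gauged.intro cN assms(2) gauged_axioms.intro g B)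
  have tM: "tau_cartier R M p \<kappa>\<^sub>M f" using gauged.tau_cartier[OF gM] assms(6) unfolding coherent_cartier_def by blast
  have tN: "tau_cartier R N p \<kappa>\<^sub>N f" using gauged.tau_cartier[OF gN] assms(7) unfolding coherent_cartier_def by blast
  interpret nil_iso R M N p \<kappa>\<^sub>M \<kappa>\<^sub>N f \<phi> by (rule nil_isoI[OF tM tN assms(8)])
  have sub: "submodule (test_module R p M \<kappa>\<^sub>M f t) R M" for t by (rule M.csub_submodule[OF M.tau_csub])
  have "cartier_colim_map R p N \<kappa>\<^sub>N \<phi> ` test_module_colim R p M \<kappa>\<^sub>M f t = test_module_colim R p N \<kappa>\<^sub>N f t" for t
  proof -
    \<comment> \<open>The natural maps commute with \<open>\<phi>\<close> and the induced map, so
      the claim on colimits is the image of the equality of test modules.\<close>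
    have "cartier_colim_map R p N \<kappa>\<^sub>N \<phi> ` to_cartier_colim R p M \<kappa>\<^sub>M ` test_module R p M \<kappa>\<^sub>M f t
        = to_cartier_colim R p N \<kappa>\<^sub>N ` \<phi> ` test_module R p M \<kappa>\<^sub>M f t"
      unfolding image_image
      by (rule image_cong[OF refl]) (use cartier_colim_map_to_cartier_colim M.submoduleE(1)[OF sub] in blast)
    then show ?thesis unfolding test_module_colim_def image_tau .
  qed
  moreover have "test_module_colim R p M \<kappa>\<^sub>M f t \<subseteq> test_module_colim R p M \<kappa>\<^sub>M f s" if "s \<ge> 0" "t \<ge> s" for s t
    unfolding test_module_colim_def by (rule image_mono[OF M.tau_antimono[OF that]])
  moreover have "submodule (test_module_colim R p M \<kappa>\<^sub>M f t) R (cartier_colim R p M \<kappa>\<^sub>M)" for t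
    unfolding test_module_colim_def by (rule M.to_cartier_colim_submodule[OF sub])
  ultimately show ?thesis using image_tau cartier_colim_map_iso by simp
qed

end
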